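(* Let $I\subseteq[m]\times[r]$, $J\subseteq[n]\times[r]$, with notation below. Assume that for all $k\in\bar T$, $\mathcal{S}'_k$ is rectangular, and that for all $k,l\in\bar T$ either $\mathcal{S}'_k=\mathcal{S}'_l$ or $\mathcal{S}'_k\cap\mathcal{S}'_l=\emptyset$. Then (i) the pair $(I^1_{\bar T},J^1_{\bar T})$ has pairwise disjoint representative rank-one supports (i.e. $\mathcal{S}_P\cap\mathcal{S}_{P'}=\emptyset$ for distinct equivalence classes $P,P'$ of $(I^1_{\bar T},J^1_{\bar T})$); (ii) for any $A\in\mathbb{R}^{m\times n}$, the two instances of (FSMF) with data $(A,I,J)$ and $(A\odot\bar{\mathcal{S}}_T, I^1_{\bar T}, J^1_{\bar T})$ have the same infimum, and from an optimal solution of one instance an optimal solution of the other can be constructed in polynomial time; in other words (FSMF) with data $(A,I,J)$ is polynomially tractable.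
   Context: $[p]=\{1,\dots,p\}$; $\|\cdot\|$ Frobenius norm; $\mathrm{supp}(M)=\{(i,j):M_{i,j}\ne0\}$; for $S\subseteq[m]\times[n]$, $M\odot S$ is $M$ with entries outside $S$ set to zero. (FSMF) with data $(A,I,J)$, $A\in\mathbb{R}^{m\times n}$, $I\subseteq[m]\times[r]$, $J\subseteq[n]\times[r]$: minimize $\|A-XY^\top\|^2$ over $X\in\mathbb{R}^{m\times r},Y\in\mathbb{R}^{n\times r}$ with $\mathrm{supp}(X)\subseteq I$, $\mathrm{supp}(Y)\subseteq J$. Rank-one supports: $\mathcal{S}_k=\{i:(i,k)\in I\}\times\{j:(j,k)\in J\}$, $k\in[r]$. Equivalence $k\sim l$ iff $\mathcal{S}_k=\mathcal{S}_l$ (columns $k,l$ of $I$ and of $J$ coincide); classes $\mathcal{P}$; for $P\in\mathcal{P}$: $\mathcal{S}_P$ the common support, $R_P=\{i:(i,k)\in I\}$, $C_P=\{j:(j,k)\in J\}$ for $k\in P$. $P$ is a complete equivalence class (CEC) if $|P|\ge\min(|R_P|,|C_P|)$; $\mathcal{P}^\star$ the set of CECs; $T=\bigcup_{P\in\mathcal{P}^\star}P$, $\bar T=[r]\setminus T$, $\mathcal{S}_T=\bigcup_{P\in\mathcal{P}^\star}\mathcal{S}_P$, $\bar{\mathcal{S}}_T=([m]\times[n])\setminus\mathcal{S}_T$. For $k\in\bar T$, $\mathcal{S}'_k=\mathcal{S}_k\setminus\mathcal{S}_T$; it is rectangular if $\mathcal{S}'_k=R_k\times C_k$ for some $R_k\subseteq[m]$,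 $C_k\subseteq[n]$. Under rectangularity, $I^1_{\bar T}=\{(i,k)\in I: k\notin T, i\in R_k\}$ and $J^1_{\bar T}=\{(j,k)\in J: k\notin T, j\in C_k\}$. *)

theory Defs
  imports
    Complex_Main
    "Jordan_Normal_Form.Matrix"
    "HOL-Library.Disjoint_Sets"
    "HOL-Computational_Algebra.Polynomial"
begin

text \<open>All index sets are zero-based: \<open>[p]\<close> is rendered as \<open>{..<p}\<close>. A support is a set of
  index pairs.\<close>

section \<open>Sparse matrix factorization with fixed support\<close>

definition frob_norm :: "real mat \<Rightarrow> real" where
  "frob_norm M = sqrt (\<Sum>i<dim_row M. \<Sum>j<dim_col M. (M $$ (i, j))\<^sup>2)"

definition supp :: "real mat \<Rightarrow> (nat \<times> nat) set" where
  "supp M = {(i, j). i < dim_row M \<and> j < dim_col M \<and> M $$ (i, j) \<noteq> 0}"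

definition restrict_mat :: "real mat \<Rightarrow> (nat \<times> nat) set \<Rightarrow> real mat" where
  "restrict_mat M S = mat (dim_row M) (dim_col M) (\<lambda>(i, j). if (i, j) \<in> S then M $$ (i, j) else 0)"

definition fsmf_feasible ::
  "nat \<Rightarrow> nat \<Rightarrow> nat \<Rightarrow> (nat \<times> nat) set \<Rightarrow> (nat \<times> nat) set \<Rightarrow> (real mat \<times> real mat) set" where
  "fsmf_feasible m n r I J =
     {(X, Y). X \<in> carrier_mat m r \<and> Y \<in> carrier_mat n r \<and> supp X \<subseteq> I \<and> supp Y \<subseteq> J}"

definition fsmf_obj :: "real mat \<Rightarrow> real mat \<times> real mat \<Rightarrow> real" where
  "fsmf_obj A = (\<lambda>(X, Y). (frob_norm (A - X * transpose_mat Y))\<^sup>2)"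

definition fsmf_inf ::
  "nat \<Rightarrow> nat \<Rightarrow> nat \<Rightarrow> real mat \<Rightarrow> (nat \<times> nat) set \<Rightarrow> (nat \<times> nat) set \<Rightarrow> real" where
  "fsmf_inf m n r A I J = (INF XY\<in>fsmf_feasible m n r I J. fsmf_obj A XY)"

definition fsmf_optimal ::
  "nat \<Rightarrow> nat \<Rightarrow> nat \<Rightarrow> real mat \<Rightarrow> (nat \<times> nat) set \<Rightarrow> (nat \<times> nat) set \<Rightarrow> real mat \<times> real mat \<Rightarrow> bool"
  where
  "fsmf_optimal m n r A I J XY \<longleftrightarrow>
     XY \<in> fsmf_feasible m n r I J \<and>
     (\<forall>XY' \<in> fsmf_feasible m n r I J. fsmf_obj A XY \<le> fsmf_obj A XY')"

section \<open>Rank-one supports and complete equivalence classes\<close>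

definition column :: "(nat \<times> nat) set \<Rightarrow> nat \<Rightarrow> nat set" where
  "column I k = {i. (i, k) \<in> I}"

definition rank1_supp :: "(nat \<times> nat) set \<Rightarrow> (nat \<times> nat) set \<Rightarrow> nat \<Rightarrow> (nat \<times> nat) set" where
  "rank1_supp I J k = column I k \<times> column J k"

definition supp_classes :: "nat \<Rightarrow> (nat \<times> nat) set \<Rightarrow> (nat \<times> nat) set \<Rightarrow> nat set set" where
  "supp_classes r I J =
     {..<r} // {(k, l). k < r \<and> l < r \<and> rank1_supp I J k = rank1_supp I J l}"

text \<open>The members of a class have the same rank-one support, so this union is the common one.\<close>

definition class_supp :: "(nat \<times> nat) set \<Rightarrow> (nat \<times> nat) set \<Rightarrow> nat set \<Rightarrow> (nat \<times> nat) set" where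
  "class_supp I J P = (\<Union>k\<in>P. rank1_supp I J k)"

text \<open>The inequality below does not depend on \<open>k \<in> P\<close>: a nonempty rank-one support determines
  both columns, and for an empty one the minimum is \<open>0\<close> whichever \<open>k\<close> is used (the two columns
  are then not determined by the support, which is why no \<open>R_P\<close>, \<open>C_P\<close> are defined).\<close>

definition is_CEC :: "(nat \<times> nat) set \<Rightarrow> (nat \<times> nat) set \<Rightarrow> nat set \<Rightarrow> bool" where
  "is_CEC I J P \<longleftrightarrow> (\<forall>k\<in>P. card P \<ge> min (card (column I k)) (card (column J k)))"

definition CECs :: "nat \<Rightarrow> (nat \<times> nat) set \<Rightarrow> (nat \<times> nat) set \<Rightarrow> nat set set" where
  "CECs r I J = {P \<in> supp_classes r I J. is_CEC I J P}"

definition T_set :: "nat \<Rightarrow> (nat \<times> nat) set \<Rightarrow> (nat \<times> nat) set \<Rightarrow> nat set" where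
  "T_set r I J = \<Union> (CECs r I J)"

definition Tbar :: "nat \<Rightarrow> (nat \<times> nat) set \<Rightarrow> (nat \<times> nat) set \<Rightarrow> nat set" where
  "Tbar r I J = {..<r} - T_set r I J"

definition S_T :: "nat \<Rightarrow> (nat \<times> nat) set \<Rightarrow> (nat \<times> nat) set \<Rightarrow> (nat \<times> nat) set" where
  "S_T r I J = (\<Union>P\<in>CECs r I J. class_supp I J P)"

definition S_Tbar ::
  "nat \<Rightarrow> nat \<Rightarrow> nat \<Rightarrow> (nat \<times> nat) set \<Rightarrow> (nat \<times> nat) set \<Rightarrow> (nat \<times> nat) set" where
  "S_Tbar m n r I J = {..<m} \<times> {..<n} - S_T r I J"

definition S' :: "nat \<Rightarrow> (nat \<times> nat) set \<Rightarrow> (nat \<times> nat) set \<Rightarrow> nat \<Rightarrow> (nat \<times> nat) set" where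
  "S' r I J k = rank1_supp I J k - S_T r I J"

text \<open>\<open>R\<close> and \<open>C\<close> are the factors witnessing that each \<open>S' r I J k\<close> is rectangular; they are not
  unique when that set is empty.\<close>

definition reducible ::
  "nat \<Rightarrow> nat \<Rightarrow> nat \<Rightarrow> (nat \<times> nat) set \<Rightarrow> (nat \<times> nat) set \<Rightarrow> (nat \<Rightarrow> nat set) \<Rightarrow> (nat \<Rightarrow> nat set) \<Rightarrow> bool"
  where
  "reducible m n r I J R C \<longleftrightarrow>
     I \<subseteq> {..<m} \<times> {..<r} \<and> J \<subseteq> {..<n} \<times> {..<r} \<and>
     (\<forall>k \<in> Tbar r I J. R k \<subseteq> {..<m} \<and> C k \<subseteq> {..<n} \<and> S' r I J k = R k \<times> C k) \<and>
     (\<forall>k \<in> Tbar r I J. \<forall>l \<in> Tbar r I J.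
        S' r I J k = S' r I J l \<or> S' r I J k \<inter> S' r I J l = {})"

definition I1 ::
  "nat \<Rightarrow> (nat \<times> nat) set \<Rightarrow> (nat \<times> nat) set \<Rightarrow> (nat \<Rightarrow> nat set) \<Rightarrow> (nat \<times> nat) set" where
  "I1 r I J R = {(i, k). (i, k) \<in> I \<and> k \<notin> T_set r I J \<and> i \<in> R k}"

definition J1 ::
  "nat \<Rightarrow> (nat \<times> nat) set \<Rightarrow> (nat \<times> nat) set \<Rightarrow> (nat \<Rightarrow> nat set) \<Rightarrow> (nat \<times> nat) set" where
  "J1 r I J C = {(j, k). (j, k) \<in> J \<and> k \<notin> T_set r I J \<and> j \<in> C k}"

section \<open>Polynomial time\<close>

text \<open>
  Data and solutions are exact real matrices, so running time is that of a real random-access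
  machine: exact real arithmetic and comparisons at unit cost on two-dimensional real arrays indexed
  by natural-number registers, and rational constants only. Optimal solutions of (FSMF) are in
  general not obtainable from the data by arithmetic alone (already without support constraints,
  where one needs a truncated singular value decomposition), so there is one further primitive, the
  singular value decomposition of a matrix. Programs not using it are \<open>svd_free\<close>.

  The machine is presented as a loop language whose loops have a bound that is evaluated on entry.
  Every program therefore terminates, and no polynomial-time computation is lost, since a while loop
  can be run under a polynomial clock. Registers admit addition but no multiplication, so that no
  computing power is hidden in large integers.
\<close>

definition is_svd :: "real mat \<Rightarrow> real mat \<times> real vec \<times> real mat \<Rightarrow> bool" where
  "is_svd M = (\<lambda>(U, \<sigma>, V).
     let p = dim_row M; q = dim_col M; k = min p q in
       U \<in> carrier_mat p k \<and> \<sigma> \<in> carrier_vec k \<and> V \<in> carrier_mat q k \<and>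
       transpose_mat U * U = 1\<^sub>m k \<and> transpose_mat V * V = 1\<^sub>m k \<and>
       (\<forall>l<k. 0 \<le> \<sigma> $ l) \<and> (\<forall>l<k. \<forall>l'<k. l \<le> l' \<longrightarrow> \<sigma> $ l' \<le> \<sigma> $ l) \<and>
       M = U * mat_diag k (\<lambda>l. \<sigma> $ l) * transpose_mat V)"

type_synonym svd_oracle = "real mat \<Rightarrow> real mat \<times> real vec \<times> real mat"

definition valid_svd_oracle :: "svd_oracle \<Rightarrow> bool" where
  "valid_svd_oracle \<O> \<longleftrightarrow> (\<forall>M. is_svd M (\<O> M))"

type_synonym name = string

record state =
  reg :: "name \<Rightarrow> nat"
  arr :: "name \<Rightarrow> nat \<Rightarrow> nat \<Rightarrow> real"

datatype iexp = IConst nat | IVar name | IAdd iexp iexp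

datatype rexp =
    RConst int
  | Entry name iexp iexp
  | RAdd rexp rexp
  | RSub rexp rexp
  | RMul rexp rexp
  | RDiv rexp rexp

datatype bexp =
    ILess iexp iexp
  | RLess rexp rexp
  | BNot bexp
  | BAnd bexp bexp

datatype com =
    Skip
  | AssignI name iexp
  | AssignR name iexp iexp rexp
  | Seq com com
  | Cond bexp com com
  | For name iexp com
  | SVD name iexp iexp name name name

primrec ival :: "iexp \<Rightarrow> state \<Rightarrow> nat" where
  "ival (IConst c) s = c"
| "ival (IVar x) s = reg s x"
| "ival (IAdd e f) s = ival e s + ival f s"

primrec rval :: "rexp \<Rightarrow> state \<Rightarrow> real" where
  "rval (RConst c) s = of_int c"
| "rval (Entry a e f) s = arr s a (ival e s) (ival f s)"
| "rval (RAdd e f) s = rval e s + rval f s"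
| "rval (RSub e f) s = rval e s - rval f s"
| "rval (RMul e f) s = rval e s * rval f s"
| "rval (RDiv e f) s = rval e s / rval f s"

primrec bval :: "bexp \<Rightarrow> state \<Rightarrow> bool" where
  "bval (ILess e f) s \<longleftrightarrow> ival e s < ival f s"
| "bval (RLess e f) s \<longleftrightarrow> rval e s < rval f s"
| "bval (BNot b) s \<longleftrightarrow> \<not> bval b s"
| "bval (BAnd b c) s \<longleftrightarrow> bval b s \<and> bval c s"

definition set_reg :: "name \<Rightarrow> nat \<Rightarrow> state \<Rightarrow> state" where
  "set_reg x v s = s\<lparr>reg := (reg s)(x := v)\<rparr>"

definition set_entry :: "name \<Rightarrow> nat \<Rightarrow> nat \<Rightarrow> real \<Rightarrow> state \<Rightarrow> state" where
  "set_entry a i j v s = s\<lparr>arr := (arr s)(a := (arr s a)(i := (arr s a i)(j := v)))\<rparr>"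

definition read_mat :: "name \<Rightarrow> nat \<Rightarrow> nat \<Rightarrow> state \<Rightarrow> real mat" where
  "read_mat a p q s = mat p q (\<lambda>(i, j). arr s a i j)"

definition write_mat :: "name \<Rightarrow> real mat \<Rightarrow> state \<Rightarrow> state" where
  "write_mat a M s = s\<lparr>arr := (arr s)(a :=
     (\<lambda>i j. if i < dim_row M \<and> j < dim_col M then M $$ (i, j) else arr s a i j))\<rparr>"

text \<open>\<open>run \<O> c s\<close> is the final state together with the number of steps. Evaluating an expression
  contributes a constant that depends only on the program text. \<open>SVD a p q u z v\<close> decomposes the
  \<open>p \<times> q\<close> matrix held in array \<open>a\<close>, storing the left singular vectors in \<open>u\<close>, the singular values
  in the first column of \<open>z\<close> and the right singular vectors in \<open>v\<close>; it is charged the usual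
  operation count of a dense decomposition.\<close>

primrec run :: "svd_oracle \<Rightarrow> com \<Rightarrow> state \<Rightarrow> state \<times> nat" where
  "run \<O> Skip s = (s, 1)"
| "run \<O> (AssignI x e) s = (set_reg x (ival e s) s, 1)"
| "run \<O> (AssignR a e f g) s = (set_entry a (ival e s) (ival f s) (rval g s) s, 1)"
| "run \<O> (Seq c d) s =
     (case run \<O> c s of (s', t) \<Rightarrow> case run \<O> d s' of (s'', t') \<Rightarrow> (s'', t + t'))"
| "run \<O> (Cond b c d) s =
     (case (if bval b s then run \<O> c s else run \<O> d s) of (s', t) \<Rightarrow> (s', Suc t))"
| "run \<O> (For x e c) s =
     fold (\<lambda>i (s', t). case run \<O> c (set_reg x i s') of (s'', t') \<Rightarrow> (s'', Suc (t + t')))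
       [0..<ival e s] (s, 1)"
| "run \<O> (SVD a e f u z v) s =
     (let p = ival e s; q = ival f s in
      case \<O> (read_mat a p q s) of (U, \<sigma>, V) \<Rightarrow>
        (write_mat v V (write_mat z (mat (dim_vec \<sigma>) 1 (\<lambda>(l, _). \<sigma> $ l)) (write_mat u U s)),
         Suc (p * q * min p q)))"

primrec svd_free :: "com \<Rightarrow> bool" where
  "svd_free Skip \<longleftrightarrow> True"
| "svd_free (AssignI x e) \<longleftrightarrow> True"
| "svd_free (AssignR a e f g) \<longleftrightarrow> True"
| "svd_free (Seq c d) \<longleftrightarrow> svd_free c \<and> svd_free d"
| "svd_free (Cond b c d) \<longleftrightarrow> svd_free c \<and> svd_free d"
| "svd_free (For x e c) \<longleftrightarrow> svd_free c"
| "svd_free (SVD a e f u z v) \<longleftrightarrow> False"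

text \<open>Initial memory: the supports are stored as 0/1 arrays; \<open>XY\<close> is an input solution. Everything
  not mentioned is zero.\<close>

definition input_of ::
  "nat \<Rightarrow> nat \<Rightarrow> nat \<Rightarrow> real mat \<Rightarrow> (nat \<times> nat) set \<Rightarrow> (nat \<times> nat) set \<Rightarrow> real mat \<times> real mat \<Rightarrow> state"
  where
  "input_of m n r A I J XY =
     write_mat ''A'' A (write_mat ''X'' (fst XY) (write_mat ''Y'' (snd XY)
       \<lparr>reg = (\<lambda>_. 0)(''m'' := m, ''n'' := n, ''r'' := r),
        arr = (\<lambda>_ _ _. 0)(''I'' := (\<lambda>i k. of_bool ((i, k) \<in> I)),
                           ''J'' := (\<lambda>j k. of_bool ((j, k) \<in> J)))\<rparr>))"

definition output_of :: "nat \<Rightarrow> nat \<Rightarrow> nat \<Rightarrow> state \<Rightarrow> real mat \<times> real mat" where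
  "output_of m n r s = (read_mat ''X'' m r s, read_mat ''Y'' n r s)"

text \<open>From the start state \<open>s\<close>, program \<open>c\<close> reaches within \<open>t\<close> steps a pair of an
  \<open>m \<times> r\<close> and an \<open>n \<times> r\<close> matrix satisfying \<open>Q\<close>.\<close>

definition computes_within ::
  "svd_oracle \<Rightarrow> com \<Rightarrow> nat \<Rightarrow> nat \<Rightarrow> nat \<Rightarrow> state \<Rightarrow> nat \<Rightarrow> (real mat \<times> real mat \<Rightarrow> bool) \<Rightarrow> bool" where
  "computes_within \<O> c m n r s t Q \<longleftrightarrow>
     snd (run \<O> c s) \<le> t \<and> Q (output_of m n r (fst (run \<O> c s)))"

end

theory Submission
  imports Defs
begin

text \<open>
  The columns of a complete equivalence class can produce every matrix supported on the class
  support: one factor consists of unit vectors, the other of the rows (or columns) of the matrix.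
  Hence the entries in \<open>\<S>\<^sub>T\<close> can always be fitted exactly, and masking the remaining columns to
  \<open>\<S>'\<^sub>k\<close> and, conversely, adding columns that reproduce \<open>A\<close> on \<open>\<S>\<^sub>T\<close> passes between the two
  instances without increasing the objective. The reduced instance splits into disjoint rectangular
  blocks, each of which is a best approximation problem of bounded rank, solved by a truncated
  singular value decomposition.
\<close>

section \<open>Running time and array tables\<close>

text \<open>Two obstacles shape the proof. Supports of distinct complete classes may overlap, so the
  classes cannot each reproduce \<open>A\<close> on their support: every entry of \<open>ST\<close>
  is split into portions, one for each class covering it. That the portions add up to the entry is a
  double count (\<open>sum_matches\<close>).

  The second obstacle is the complexity claim, which asks for concrete programs. They are given
  \<open>A\<close>, \<open>I\<close>, \<open>J\<close> but neither \<open>R\<close>,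
  \<open>C\<close> nor the classes, registers cannot be compared with reals, and array entries
  cannot serve as indices. Hence each notion is recast as a count over index ranges: sizes of
  intersections decide equality of supports, ranks assign unit vectors to columns, and positive
  counts detect rows and columns of a block. Everything except the decomposition itself then becomes
  a table of guarded sums, covered by one correctness rule, and running time becomes a syntactic
  property of the program.

  The two instances can be compared entry by entry because a reduced product vanishes on
  \<open>ST\<close>, where the masked data vanish too.\<close>

definition exec :: "svd_oracle \<Rightarrow> com \<Rightarrow> state \<Rightarrow> state" where
  "exec \<O> c s = fst (run \<O> c s)"

lemma fst_fold_run:
  "fst (fold (\<lambda>i (s', t). case run \<O> c (set_reg x i s') of (s'', t') \<Rightarrow> (s'', Suc (t + t'))) is (s, t))
   = fold (\<lambda>i s'. exec \<O> c (set_reg x i s')) is s"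
  by (induction "is" arbitrary: s t) (auto simp: exec_def split: prod.splits)

lemma exec_simps [simp]:
  "exec \<O> Skip s = s"
  "exec \<O> (AssignR a e f g) s = set_entry a (ival e s) (ival f s) (rval g s) s"
  "exec \<O> (Seq c d) s = exec \<O> d (exec \<O> c s)"
  "exec \<O> (Cond b c d) s = (if bval b s then exec \<O> c s else exec \<O> d s)"
  by (auto simp: exec_def split: prod.splits)

lemma exec_SVD:
  "exec \<O> (SVD a e f u z v) s =
     (case \<O> (read_mat a (ival e s) (ival f s) s) of (U, \<sigma>, V) \<Rightarrow>
        write_mat v V (write_mat z (mat (dim_vec \<sigma>) 1 (\<lambda>(l, _). \<sigma> $ l)) (write_mat u U s)))"
  by (auto simp: exec_def Let_def split: prod.splits)

lemma exec_For:
  "exec \<O> (For x e c) s = fold (\<lambda>i s'. exec \<O> c (set_reg x i s')) [0..<ival e s] s"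
  by (simp add: exec_def fst_fold_run[unfolded exec_def])

text \<open>The bound is evaluated once, on entry, so the loop is a fold over a fixed list and
  \<open>P\<close> can be indexed by the number of completed passes. The loop register is set before
  every pass, so \<open>P\<close> may stay silent about it.\<close>

lemma exec_For_inv:
  assumes "ival e s = n" and "P 0 s"
    and "\<And>i t. i < n \<Longrightarrow> P i t \<Longrightarrow> P (Suc i) (exec \<O> c (set_reg x i t))"
  shows "P n (exec \<O> (For x e c) s)"
proof -
  have "P k (fold (\<lambda>i s'. exec \<O> c (set_reg x i s')) [0..<k] s)" if "k \<le> n" for k
    using that by (induction k) (auto simp: assms)
  then show ?thesis by (simp add: exec_For assms(1))
qed

text \<open>The step bound is read off the program text: every loop bound is one of \<open>m\<close>, \<open>n\<close>, \<open>r\<close>, \<open>1\<close>, and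
  no program changes these registers.\<close>

definition size_exps :: "iexp set" where
  "size_exps = {IVar ''m'', IVar ''n'', IVar ''r'', IConst 1}"

primrec size_bounded :: "com \<Rightarrow> bool" where
  "size_bounded Skip \<longleftrightarrow> True"
| "size_bounded (AssignI x e) \<longleftrightarrow> x \<notin> {''m'', ''n'', ''r''}"
| "size_bounded (AssignR a e f g) \<longleftrightarrow> True"
| "size_bounded (Seq c d) \<longleftrightarrow> size_bounded c \<and> size_bounded d"
| "size_bounded (Cond b c d) \<longleftrightarrow> size_bounded c \<and> size_bounded d"
| "size_bounded (For x e c) \<longleftrightarrow> x \<notin> {''m'', ''n'', ''r''} \<and> e \<in> size_exps \<and> size_bounded c"
| "size_bounded (SVD a e f u z v) \<longleftrightarrow> e \<in> size_exps \<and> f \<in> size_exps"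

text \<open>\<open>[:1, 1:]\<close> is the polynomial \<open>1 + x\<close>; at
  \<open>size_of s\<close> it bounds every expression in \<open>size_exps\<close>, the summand 1
  covering \<open>IConst 1\<close> when all dimensions are 0. Adding both branches of a conditional
  replaces a maximum, which polynomials do not offer.\<close>

primrec cost :: "com \<Rightarrow> nat poly" where
  "cost Skip = 1"
| "cost (AssignI x e) = 1"
| "cost (AssignR a e f g) = 1"
| "cost (Seq c d) = cost c + cost d"
| "cost (Cond b c d) = 1 + cost c + cost d"
| "cost (For x e c) = 1 + [:1, 1:] * (1 + cost c)"
| "cost (SVD a e f u z v) = 1 + [:1, 1:] ^ 3"

definition size_of :: "state \<Rightarrow> nat" where
  "size_of s = reg s ''m'' + reg s ''n'' + reg s ''r''"

lemma reg_write_mat [simp]: "reg (write_mat a M s) = reg s"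
  by (simp add: write_mat_def)

lemma reg_set_reg [simp]: "reg (set_reg x v s) = (reg s)(x := v)"
  and arr_set_reg [simp]: "arr (set_reg x v s) = arr s"
  and reg_set_entry [simp]: "reg (set_entry a i j w s) = reg s"
  and arr_set_entry:
    "arr (set_entry a i j w s) b x' y' = (if b = a \<and> x' = i \<and> y' = j then w else arr s b x' y')"
  by (auto simp: set_reg_def set_entry_def)

lemma ival_size_exps: "e \<in> size_exps \<Longrightarrow> ival e s \<le> 1 + size_of s"
  by (auto simp: size_exps_def size_of_def)

text \<open>The second conjunct carries the induction: as the size registers never change, a loop
  bound met late in a run is still controlled by the size of the start state.\<close>

lemma run_cost:
  assumes "size_bounded c"
  shows "snd (run \<O> c s) \<le> poly (cost c) (size_of s) \<and>
    (\<forall>x\<in>{''m'', ''n'', ''r''}. reg (fst (run \<O> c s)) x = reg s x)"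
  using assms
proof (induction c arbitrary: s)
  case (Seq c d)
  obtain s' t where c: "run \<O> c s = (s', t)" by (cases "run \<O> c s")
  obtain s'' t' where d: "run \<O> d s' = (s'', t')" by (cases "run \<O> d s'")
  have "size_of s' = size_of s" using Seq.IH(1)[of s] Seq.prems c by (simp add: size_of_def)
  then show ?case using Seq.IH(1)[of s] Seq.IH(2)[of s'] Seq.prems c d
    by (auto simp: size_of_def)
next
  case (Cond b c d)
  obtain s' t where c: "run \<O> c s = (s', t)" by (cases "run \<O> c s")
  obtain s'' t' where d: "run \<O> d s = (s'', t')" by (cases "run \<O> d s")
  show ?case using Cond.IH(1)[of s] Cond.IH(2)[of s] Cond.prems c d by auto
next
  case (For x e c)
  let ?B = "poly (cost c) (size_of s)"
  let ?f = "\<lambda>i (s', t). case run \<O> c (set_reg x i s') of (s'', t') \<Rightarrow> (s'', Suc (t + t'))"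
  have *: "snd (fold ?f is (s', t)) \<le> t + length is * (1 + ?B) \<and>
      (\<forall>y\<in>{''m'', ''n'', ''r''}. reg (fst (fold ?f is (s', t))) y = reg s y)"
    if "\<forall>y\<in>{''m'', ''n'', ''r''}. reg s' y = reg s y" for "is" s' t
    using that
  proof (induction "is" arbitrary: s' t)
    case (Cons i "is")
    obtain s'' t' where r: "run \<O> c (set_reg x i s') = (s'', t')" by (cases "run \<O> c (set_reg x i s')")
    have reg': "\<forall>y\<in>{''m'', ''n'', ''r''}. reg (set_reg x i s') y = reg s y"
      using Cons.prems For.prems by auto
    then have sz: "size_of (set_reg x i s') = size_of s" by (simp add: size_of_def)
    have t': "t' \<le> ?B" and s'': "\<forall>y\<in>{''m'', ''n'', ''r''}. reg s'' y = reg s y"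
      using For.IH[of "set_reg x i s'"] For.prems r sz reg' by auto
    show ?case using Cons.IH[OF s'', of "Suc (t + t')"] t' r by auto
  qed simp
  have e: "ival e s \<le> 1 + size_of s" using For.prems ival_size_exps by auto
  have "ival e s * (1 + ?B) \<le> (1 + size_of s) * (1 + ?B)" using e by (rule mult_le_mono1)
  then show ?case using *[of s "[0..<ival e s]" 1] by (auto simp: algebra_simps)
next
  case (SVD a e f u z v)
  have "ival e s * ival f s * min (ival e s) (ival f s) \<le> (1 + size_of s) * (1 + size_of s) * (1 +
    size_of s)"
    using SVD ival_size_exps[of e s] ival_size_exps[of f s] by (intro mult_le_mono) auto
  then show ?case by (auto simp: Let_def power3_eq_cube algebra_simps split: prod.splits)
qed auto

text \<open>A fact \<open>(a, p, q, f)\<close> says that array \<open>a\<close> holds \<open>f\<close> on its first \<open>p\<close> rows and \<open>q\<close> columns.\<close>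

type_synonym array_facts = "(name \<times> nat \<times> nat \<times> (nat \<Rightarrow> nat \<Rightarrow> real)) list"

definition ok :: "(name \<times> nat) list \<Rightarrow> array_facts \<Rightarrow> state \<Rightarrow> bool" where
  "ok \<rho> \<Gamma> s \<longleftrightarrow> (\<forall>(x, v)\<in>set \<rho>. reg s x = v) \<and>
     (\<forall>(a, p, q, f)\<in>set \<Gamma>. \<forall>i<p. \<forall>j<q. arr s a i j = f i j)"

lemma ok_simps [simp]:
  "ok ((x, v) # \<rho>) \<Gamma> s \<longleftrightarrow> reg s x = v \<and> ok \<rho> \<Gamma> s"
  "ok \<rho> ((a, p, q, f) # \<Gamma>) s \<longleftrightarrow> (\<forall>i<p. \<forall>j<q. arr s a i j = f i j) \<and> ok \<rho> \<Gamma> s"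
  "ok [] [] s"
  by (auto simp: ok_def)

lemma ok_mono: "ok \<rho> \<Gamma> s \<Longrightarrow> set \<rho>' \<subseteq> set \<rho> \<Longrightarrow> set \<Gamma>' \<subseteq> set \<Gamma> \<Longrightarrow> ok \<rho>' \<Gamma>' s"
  unfolding ok_def by (meson in_mono)

lemma ok_stable:
  assumes "ok \<rho> \<Gamma> s" "\<And>x. x \<in> fst ` set \<rho> \<Longrightarrow> reg t x = reg s x"
    "\<And>a. a \<in> fst ` set \<Gamma> \<Longrightarrow> arr t a = arr s a"
  shows "ok \<rho> \<Gamma> t"
  unfolding ok_def
proof (intro conjI ballI)
  fix z assume z: "z \<in> set \<rho>"
  have "case z of (x, v) \<Rightarrow> reg s x = v" using assms(1) z unfolding ok_def by (elim conjE bspec)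
  moreover have "reg t (fst z) = reg s (fst z)" using z by (intro assms(2) imageI)
  ultimately show "case z of (x, v) \<Rightarrow> reg t x = v" by (simp add: case_prod_beta)
next
  fix z assume z: "z \<in> set \<Gamma>"
  have "case z of (a, p, q, f) \<Rightarrow> \<forall>i<p. \<forall>j<q. arr s a i j = f i j"
    using assms(1) z unfolding ok_def by (elim conjE bspec)
  moreover have "arr t (fst z) = arr s (fst z)" using z by (intro assms(3) imageI)
  ultimately show "case z of (a, p, q, f) \<Rightarrow> \<forall>i<p. \<forall>j<q. arr t a i j = f i j"
    by (simp add: case_prod_beta)
qed

lemma ok_set_reg:
  assumes "x \<notin> fst ` set \<rho>"
  shows "ok \<rho> \<Gamma> (set_reg x v s) \<longleftrightarrow> ok \<rho> \<Gamma> s"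
proof -
  have *: "reg (set_reg x v s) y = reg s y" if "y \<in> fst ` set \<rho>" for y
    using that assms by (cases "y = x") auto
  show ?thesis
  proof
    assume "ok \<rho> \<Gamma> (set_reg x v s)"
    then show "ok \<rho> \<Gamma> s" by (rule ok_stable) (simp_all only: * arr_set_reg)
  next
    assume "ok \<rho> \<Gamma> s"
    then show "ok \<rho> \<Gamma> (set_reg x v s)" by (rule ok_stable) (simp_all only: * arr_set_reg)
  qed
qed

lemma ok_set_entry:
  assumes "a \<notin> fst ` set \<Gamma>"
  shows "ok \<rho> \<Gamma> (set_entry a i j w s) \<longleftrightarrow> ok \<rho> \<Gamma> s"
proof -
  have *: "arr (set_entry a i j w s) b = arr s b" if "b \<in> fst ` set \<Gamma>" for b
    using that assms by (cases "b = a") (auto simp: set_entry_def)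
  show ?thesis
  proof
    assume "ok \<rho> \<Gamma> (set_entry a i j w s)"
    then show "ok \<rho> \<Gamma> s" by (rule ok_stable) (simp_all only: * reg_set_entry)
  next
    assume "ok \<rho> \<Gamma> s"
    then show "ok \<rho> \<Gamma> (set_entry a i j w s)" by (rule ok_stable) (simp_all only: * reg_set_entry)
  qed
qed

text \<open>All array computations are guarded sums; with \<open>l = 1\<close> they are conditional assignments. The
  registers \<open>i\<close>, \<open>j\<close>, \<open>k\<close> are reserved for them.\<close>

definition tabcol :: "name \<Rightarrow> iexp \<Rightarrow> iexp \<Rightarrow> iexp \<Rightarrow> bexp \<Rightarrow> rexp \<Rightarrow> com" where
  "tabcol a e p l b g =
     For ''i'' p (Seq (AssignR a (IVar ''i'') e (RConst 0))
       (For ''k'' l (Cond b (AssignR a (IVar ''i'') e (RAdd (Entry a (IVar ''i'') e) g)) Skip)))"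

definition tab :: "name \<Rightarrow> iexp \<Rightarrow> iexp \<Rightarrow> iexp \<Rightarrow> bexp \<Rightarrow> rexp \<Rightarrow> com" where
  "tab a p q l b g = For ''j'' q (tabcol a (IVar ''j'') p l b g)"

text \<open>Since \<open>a\<close> is absent from \<open>\<Gamma>\<close> and the loop registers
  from \<open>\<rho>\<close>, no assignment in the loops can destroy
  \<open>ok \<rho> \<Gamma>\<close>. Guard and summand are therefore evaluated (\<open>eval\<close>)
  only through these stable facts, never through the half-built column.\<close>

lemma tabcol_ok:
  assumes ok: "ok \<rho> ((a, P, y, F) # \<Gamma>) s"
    and a: "a \<notin> fst ` set \<Gamma>" and \<rho>: "''i'' \<notin> fst ` set \<rho>" "''k'' \<notin> fst ` set \<rho>"
    and ivals: "\<And>t. ok \<rho> \<Gamma> t \<Longrightarrow> ival e t = y \<and> ival p t = P \<and> ival l t = L"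
    and eval: "\<And>t i k. ok ((''i'', i) # (''k'', k) # \<rho>) \<Gamma> t \<Longrightarrow> i < P \<Longrightarrow> k < L \<Longrightarrow>
      (if bval b t then rval g t else 0) = H i k"
    and F: "\<And>i. i < P \<Longrightarrow> F i y = (\<Sum>k<L. H i k)"
  shows "ok \<rho> ((a, P, Suc y, F) # \<Gamma>) (exec \<O> (tabcol a e p l b g) s)"
proof -
  let ?inner = "For ''k'' l (Cond b (AssignR a (IVar ''i'') e (RAdd (Entry a (IVar ''i'') e) g)) Skip)"
  have stable: "ok \<rho> \<Gamma> (set_reg ''i'' i (set_reg ''k'' k t)) = ok \<rho> \<Gamma> t"
     "ok \<rho> \<Gamma> (set_reg ''i'' i t) = ok \<rho> \<Gamma> t"
     "ok \<rho> \<Gamma> (set_reg ''k'' i t) = ok \<rho> \<Gamma> t"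
     "ok \<rho> \<Gamma> (set_entry a i k w t) = ok \<rho> \<Gamma> t" for i k t w
    using \<rho> a by (simp_all add: ok_set_reg ok_set_entry)
  \<comment> \<open>\<open>Q\<close> determines array \<open>a\<close> everywhere, not only in
    column \<open>y\<close>, so that the columns tabulated earlier survive.\<close>
  define Q where "Q i t \<longleftrightarrow> ok \<rho> \<Gamma> t \<and>
    (\<forall>i' y'. arr t a i' y' = (if i' < i \<and> y' = y then F i' y else arr s a i' y'))" for i t
  have "Q P (exec \<O> (tabcol a e p l b g) s)"
    unfolding tabcol_def
  proof (rule exec_For_inv)
    show "ival p s = P" "Q 0 s" using ok ivals[of s] by (auto simp: Q_def)
    fix i t assume i: "i < P" and Q: "Q i t"
    define t0 where "t0 = exec \<O> (AssignR a (IVar ''i'') e (RConst 0)) (set_reg ''i'' i t)"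
    define Q' where "Q' k u \<longleftrightarrow> ok \<rho> \<Gamma> u \<and> reg u ''i'' = i \<and>
      (\<forall>i' y'. arr u a i' y' = (if i' = i \<and> y' = y then (\<Sum>k'<k. H i k') else arr t a i' y'))" for k u
    have okt: "ok \<rho> \<Gamma> (set_reg ''i'' i t)" using Q stable by (auto simp: Q_def)
    have "Q' L (exec \<O> ?inner t0)"
    proof (rule exec_For_inv)
      have ok0: "ok \<rho> \<Gamma> t0" using okt by (auto simp: stable t0_def)
      with ivals show "ival l t0 = L" by blast
      show "Q' 0 t0" using ok0 ivals[OF okt] by (auto simp: Q'_def t0_def arr_set_entry)
      fix k u assume k: "k < L" and Q': "Q' k u"
      let ?u = "set_reg ''k'' k u"
      have oku: "ok \<rho> \<Gamma> ?u" using Q' by (simp add: Q'_def stable)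
      have H: "(if bval b ?u then rval g ?u else 0) = H i k"
        using i k Q' oku by (intro eval) (auto simp: Q'_def)
      show "Q' (Suc k) (exec \<O> (Cond b (AssignR a (IVar ''i'') e (RAdd (Entry a (IVar ''i'')
        e) g)) Skip) ?u)"
        using Q' oku ivals[OF oku] H
        by (auto simp: Q'_def stable arr_set_entry split: if_splits)
    qed
    then show "Q (Suc i) (exec \<O> (Seq (AssignR a (IVar ''i'') e (RConst 0)) ?inner) (set_reg ''i'' i t))"
      using Q F[OF i] by (auto simp: Q_def Q'_def t0_def less_Suc_eq)
  qed
  then show ?thesis using ok by (auto simp: Q_def less_Suc_eq)
qed

text \<open>\<open>\<Delta>\<close> lists just the facts that the expressions read, which keeps the
  obligation \<open>eval\<close> small however long \<open>\<Gamma>\<close> has grown. The table is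
  filled column by column, with \<open>j\<close> passed to \<open>tabcol_ok\<close> as one more
  known register.\<close>

lemma tab_ok:
  assumes ok: "ok \<rho> \<Gamma> s" and \<Delta>: "set \<Delta> \<subseteq> set \<Gamma>"
    and a: "a \<notin> fst ` set \<Gamma>" and \<rho>: "{''i'', ''j'', ''k''} \<inter> fst ` set \<rho> = {}"
    and ivals: "\<And>t. ok \<rho> \<Gamma> t \<Longrightarrow> ival p t = P \<and> ival q t = Q \<and> ival l t = L"
    and eval: "\<And>t i j k. ok ((''i'', i) # (''j'', j) # (''k'', k) # \<rho>) \<Delta> t \<Longrightarrow> i < P \<Longrightarrow> j < Q \<Longrightarrow> k < L \<Longrightarrow>
      (if bval b t then rval g t else 0) = H i j k"
    and F: "\<And>i j. i < P \<Longrightarrow> j < Q \<Longrightarrow> F i j = (\<Sum>k<L. H i j k)"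
  shows "ok \<rho> ((a, P, Q, F) # \<Gamma>) (exec \<O> (tab a p q l b g) s)"
  unfolding tab_def
proof (rule exec_For_inv)
  show "ival q s = Q" "ok \<rho> ((a, P, 0, F) # \<Gamma>) s" using ok ivals[OF ok] by auto
  fix j t assume j: "j < Q" and ok: "ok \<rho> ((a, P, j, F) # \<Gamma>) t"
  have "ok ((''j'', j) # \<rho>) ((a, P, Suc j, F) # \<Gamma>) (exec \<O> (tabcol a (IVar ''j'') p l b g)
    (set_reg ''j'' j t))"
  proof (rule tabcol_ok[where H = "\<lambda>i k. H i j k" and L = L])
    have "ok \<rho> ((a, P, j, F) # \<Gamma>) (set_reg ''j'' j t)"
      using ok \<rho> by (subst ok_set_reg) auto
    then show "ok ((''j'', j) # \<rho>) ((a, P, j, F) # \<Gamma>) (set_reg ''j'' j t)" by simp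
  next
    fix t' i k
    assume "ok ((''i'', i) # (''k'', k) # (''j'', j) # \<rho>) \<Gamma> t'" "i < P" "k < L"
    then show "(if bval b t' then rval g t' else 0) = H i j k"
      by (intro eval j) (auto elim: ok_mono[OF _ subset_refl \<Delta>])
  qed (use a \<rho> ivals F j in auto)
  then show "ok \<rho> ((a, P, Suc j, F) # \<Gamma>) (exec \<O> (tabcol a (IVar ''j'') p l b g) (set_reg ''j'' j t))"
    by simp
qed

text \<open>\<open>is_svd\<close> fixes the shapes of the three factors, hence the extent of what is
  written. Fresh and distinct names keep the three writes from destroying one another or the old
  facts.\<close>

lemma svd_ok:
  assumes ok: "ok \<rho> \<Gamma> s" and a: "(a, p, q, F) \<in> set \<Gamma>"
    and names: "u \<notin> fst ` set \<Gamma>" "z \<notin> fst ` set \<Gamma>" "v \<notin> fst ` set \<Gamma>" "distinct [u, z, v]"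
    and ivals: "ival e s = p" "ival f s = q"
    and valid: "valid_svd_oracle \<O>" and svd: "\<O> (mat p q (\<lambda>(i, j). F i j)) = (U, \<sigma>, V)"
  shows "ok \<rho> ((u, p, min p q, \<lambda>i t. U $$ (i, t)) # (z, min p q, 1, \<lambda>t _. \<sigma> $ t) #
    (v, q, min p q, \<lambda>j t. V $$ (j, t)) # \<Gamma>) (exec \<O> (SVD a e f u z v) s)"
proof -
  let ?M = "mat p q (\<lambda>(i, j). F i j)"
  have "\<forall>i<p. \<forall>j<q. arr s a i j = F i j"
    using ok a unfolding ok_def by (elim conjE) (drule (1) bspec, simp)
  then have read: "read_mat a p q s = ?M"
    by (auto simp: read_mat_def intro!: cong_mat)
  have "is_svd ?M (U, \<sigma>, V)" using valid svd by (metis valid_svd_oracle_def)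
  then have dims: "dim_row U = p" "dim_col U = min p q" "dim_vec \<sigma> = min p q"
    "dim_row V = q" "dim_col V = min p q"
    by (auto simp: is_svd_def Let_def)
  let ?t = "write_mat v V (write_mat z (mat (dim_vec \<sigma>) 1 (\<lambda>(l, _). \<sigma> $ l)) (write_mat u U s))"
  have "exec \<O> (SVD a e f u z v) s = ?t"
    by (simp add: exec_SVD ivals read svd)
  moreover have "arr ?t b = arr s b" if "b \<in> fst ` set \<Gamma>" for b
  proof -
    have "b \<noteq> u" "b \<noteq> z" "b \<noteq> v" using that names by metis+
    then show ?thesis by (simp add: write_mat_def)
  qed
  then have "ok \<rho> \<Gamma> ?t" by (intro ok_stable[OF ok]) simp_all
  ultimately show ?thesis using names(4) dims by (simp add: write_mat_def)
qed

section \<open>Best approximation of given rank\<close>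

definition inner_on :: "nat \<Rightarrow> (nat \<Rightarrow> real) \<Rightarrow> (nat \<Rightarrow> real) \<Rightarrow> real" where
  "inner_on p u v = (\<Sum>i<p. u i * v i)"

definition orthonormal :: "nat \<Rightarrow> nat \<Rightarrow> (nat \<Rightarrow> nat \<Rightarrow> real) \<Rightarrow> bool" where
  "orthonormal p d q \<longleftrightarrow> (\<forall>a<d. \<forall>b<d. inner_on p (q a) (q b) = of_bool (a = b))"

lemma inner_on_commute: "inner_on p u v = inner_on p v u"
  by (simp add: inner_on_def mult.commute)

lemma inner_on_diff_left: "inner_on p (\<lambda>i. u i - v i) w = inner_on p u w - inner_on p v w"
  by (simp add: inner_on_def left_diff_distrib sum_subtractf)

lemma inner_on_diff_right: "inner_on p w (\<lambda>i. u i - v i) = inner_on p w u - inner_on p w v"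
  by (simp add: inner_on_def right_diff_distrib sum_subtractf)

lemma inner_on_sum_right:
  "inner_on p u (\<lambda>i. \<Sum>b\<in>B. c b * q b i) = (\<Sum>b\<in>B. c b * inner_on p u (q b))"
  unfolding inner_on_def sum_distrib_left by (subst sum.swap) (simp add: mult_ac)

lemma inner_on_sum_left:
  "inner_on p (\<lambda>i. \<Sum>b\<in>B. c b * q b i) u = (\<Sum>b\<in>B. c b * inner_on p (q b) u)"
  by (subst inner_on_commute) (simp add: inner_on_sum_right inner_on_commute)

lemma inner_on_self: "inner_on p u u = (\<Sum>i<p. (u i)\<^sup>2)"
  by (simp add: inner_on_def power2_eq_square)

lemma orthonormal_inner_sum:
  assumes "orthonormal p d q" "B \<subseteq> {..<d}" "a < d"
  shows "(\<Sum>b\<in>B. c b * inner_on p (q a) (q b)) = (if a \<in> B then c a else 0)"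
proof -
  have "finite B" using assms(2) finite_subset by blast
  have "(\<Sum>b\<in>B. c b * inner_on p (q a) (q b)) = (\<Sum>b\<in>B. if a = b then c b else 0)"
    using assms by (intro sum.cong) (auto simp: orthonormal_def)
  then show ?thesis using \<open>finite B\<close> by simp
qed

lemma inner_on_orthonormal_comb:
  assumes "orthonormal p d q" "B \<subseteq> {..<d}"
  shows "inner_on p (\<lambda>i. \<Sum>b\<in>B. c b * q b i) (\<lambda>i. \<Sum>b\<in>B. c b * q b i) = (\<Sum>b\<in>B. (c b)\<^sup>2)"
  unfolding inner_on_sum_left unfolding inner_on_sum_right
  using assms(2) by (intro sum.cong refl) (auto simp: orthonormal_inner_sum[OF assms]
    power2_eq_square subset_iff)

text \<open>Completing the square in the coefficients. Inner products as coefficients give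
  \<open>bessel\<close>; for arbitrary \<open>c\<close> the identity bounds from below the distance
  of \<open>v\<close> to any vector of the span.\<close>

lemma norm_diff_orthonormal_comb:
  assumes "orthonormal p d q"
  shows "inner_on p (\<lambda>i. v i - (\<Sum>b<d. c b * q b i)) (\<lambda>i. v i - (\<Sum>b<d. c b * q b i)) =
    inner_on p v v - (\<Sum>b<d. (inner_on p (q b) v)\<^sup>2) + (\<Sum>b<d. (c b - inner_on p (q b) v)\<^sup>2)"
proof -
  have "inner_on p (\<lambda>i. v i - (\<Sum>b<d. c b * q b i)) (\<lambda>i. v i - (\<Sum>b<d. c b * q b i)) =
    inner_on p v v - 2 * (\<Sum>b<d. c b * inner_on p (q b) v) + (\<Sum>b<d. (c b)\<^sup>2)"
    using inner_on_orthonormal_comb[OF assms, of "{..<d}" c]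
    by (simp add: inner_on_diff_left inner_on_diff_right)
      (simp add: inner_on_sum_left inner_on_sum_right inner_on_commute)
  then show ?thesis
    by (simp add: power2_diff sum.distrib sum_subtractf sum_distrib_left mult.assoc)
qed

lemma bessel:
  assumes "orthonormal p d q"
  shows "(\<Sum>b<d. (inner_on p (q b) v)\<^sup>2) \<le> inner_on p v v"
proof -
  have "0 \<le> inner_on p (\<lambda>i. v i - (\<Sum>b<d. inner_on p (q b) v * q b i)) (\<lambda>i. v i - (\<Sum>b<d. inner_on p
    (q b) v * q b i))"
    by (simp add: inner_on_self sum_nonneg)
  then show ?thesis by (subst (asm) norm_diff_orthonormal_comb[OF assms]) simp
qed

text \<open>Gram-Schmidt. The residual \<open>e\<close> of the new vector, of squared length
  \<open>N\<close>, is normalized and appended unless it is zero; in that case the basis does not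
  grow, which is why \<open>d\<close> is only bounded by \<open>card P\<close>.\<close>

lemma orthonormal_span:
  assumes "finite P"
  shows "\<exists>d\<le>card P. \<exists>q. orthonormal p d q \<and> (\<forall>a\<in>P. \<exists>c. \<forall>i<p. x a i = (\<Sum>b<d. c b * q b i))"
  using assms
proof (induction P)
  case empty
  show ?case by (auto simp: orthonormal_def)
next
  case (insert a P)
  then obtain d q where d: "d \<le> card P" and q: "orthonormal p d q"
    and span: "\<forall>a\<in>P. \<exists>c. \<forall>i<p. x a i = (\<Sum>b<d. c b * q b i)" by blast
  define e where "e i = x a i - (\<Sum>b<d. inner_on p (q b) (x a) * q b i)" for i
  define N where "N = inner_on p e e"
  show ?case
  proof (cases "N = 0")
    case True
    then have "\<forall>i<p. e i = 0"
      by (auto simp: N_def inner_on_self sum_nonneg_eq_0_iff)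
    then have "\<forall>i<p. x a i = (\<Sum>b<d. inner_on p (q b) (x a) * q b i)"
      by (simp add: e_def)
    then have "\<exists>c. \<forall>i<p. x a i = (\<Sum>b<d. c b * q b i)" by - (rule exI)
    then have "\<forall>a'\<in>insert a P. \<exists>c. \<forall>i<p. x a' i = (\<Sum>b<d. c b * q b i)"
      unfolding ball_simps(7) using span by (rule conjI)
    moreover have "d \<le> card (insert a P)" using d insert by simp
    ultimately show ?thesis using q by (intro exI[of _ d] exI[of _ q] conjI)
  next
    case False
    then have N: "N > 0" using sum_nonneg[of "{..<p}" "\<lambda>i. (e i)\<^sup>2"]
      by (simp add: N_def inner_on_self less_le)
    define q' where "q' b i = (if b < d then q b i else e i / sqrt N)" for b i
    have orth: "inner_on p (q b) e = 0" if "b < d" for b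
      using that orthonormal_inner_sum[OF q, of "{..<d}" b]
      by (simp add: e_def[abs_def] inner_on_diff_right inner_on_sum_right)
    have qe: "inner_on p (q b) (\<lambda>i. e i / sqrt N) = 0" if "b < d" for b
      using orth[OF that] by (simp add: inner_on_def sum_divide_distrib[symmetric])
    have ee: "inner_on p (\<lambda>i. e i / sqrt N) (\<lambda>i. e i / sqrt N) = 1"
      using N by (simp add: inner_on_def N_def[unfolded inner_on_def, symmetric]
        sum_divide_distrib[symmetric])
    have q'_lt: "q' b = q b" if "b < d" for b using that by (auto simp: q'_def)
    have q'_d: "q' d = (\<lambda>i. e i / sqrt N)" by (auto simp: q'_def)
    have "orthonormal p (Suc d) q'"
      using q qe ee unfolding orthonormal_def
      by (auto simp: less_Suc_eq q'_lt q'_d inner_on_commute[of p "\<lambda>i. e i / sqrt N" "q _"])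
    moreover have "\<exists>c. \<forall>i<p. x a' i = (\<Sum>b<Suc d. c b * q' b i)" if a': "a' \<in> insert a P" for a'
    proof (cases "a' = a")
      case True
      have "\<forall>i<p. x a' i = (\<Sum>b<Suc d. (if b < d then inner_on p (q b) (x a) else sqrt N) * q' b i)"
        using N by (simp add: q'_def True e_def)
      then show ?thesis by - (rule exI)
    next
      case False
      then have "a' \<in> P" using a' by simp
      with span have "\<exists>c. \<forall>i<p. x a' i = (\<Sum>b<d. c b * q b i)" by (rule bspec)
      then obtain c where "\<forall>i<p. x a' i = (\<Sum>b<d. c b * q b i)" by (rule exE)
      then have "\<forall>i<p. x a' i = (\<Sum>b<Suc d. (if b < d then c b else 0) * q' b i)"
        by (simp add: q'_def)
      then show ?thesis by - (rule exI)
    qed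
    moreover have "Suc d \<le> card (insert a P)" using d insert by simp
    ultimately show ?thesis by (intro exI[of _ "Suc d"] exI[of _ q'] conjI ballI)
  qed
qed

text \<open>Subtract the threshold \<open>s d\<close>, by zero-based indexing the largest value not
  among the first \<open>d\<close>. Then \<open>(s l - s d) * w l\<close> is at most
  \<open>s l - s d\<close> for \<open>l < d\<close> and at most 0 beyond, while the subtracted part
  is at most \<open>s d * d\<close> because the weights sum to at most \<open>d\<close>.\<close>

lemma weighted_sum_le_largest:
  fixes s w :: "nat \<Rightarrow> real"
  assumes "\<And>l. l < k \<Longrightarrow> 0 \<le> s l" "\<And>l l'. l < k \<Longrightarrow> l' < k \<Longrightarrow> l \<le> l' \<Longrightarrow> s l' \<le> s l"
    and "\<And>l. l < k \<Longrightarrow> 0 \<le> w l" "\<And>l. l < k \<Longrightarrow> w l \<le> 1" and "(\<Sum>l<k. w l) \<le> real d"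
  shows "(\<Sum>l<k. s l * w l) \<le> (\<Sum>l<min d k. s l)"
proof (cases "k \<le> d")
  case True
  then have "(\<Sum>l<k. s l * w l) \<le> (\<Sum>l<k. s l)"
    using assms by (intro sum_mono) (auto simp: mult_left_le)
  then show ?thesis using True by simp
next
  case False
  let ?\<theta> = "s d"
  have "(\<Sum>l<k. (s l - ?\<theta>) * w l) \<le> (\<Sum>l<k. if l < d then s l - ?\<theta> else 0)"
  proof (rule sum_mono)
    fix l assume "l \<in> {..<k}"
    then have l: "l < k" by simp
    show "(s l - ?\<theta>) * w l \<le> (if l < d then s l - ?\<theta> else 0)"
    proof (cases "l < d")
      case True
      then have "0 \<le> s l - ?\<theta>" using assms(2)[of l d] l False by simp
      then show ?thesis using True assms(4)[OF l] by (simp add: mult_left_le)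
    next
      case f: False
      then have "s l - ?\<theta> \<le> 0" using assms(2)[of d l] l False by simp
      then show ?thesis using f assms(3)[OF l] by (simp add: mult_nonpos_nonneg)
    qed
  qed
  also have "\<dots> = (\<Sum>l<d. s l - ?\<theta>)"
    using False by (intro sum.mono_neutral_cong_right) auto
  finally have "(\<Sum>l<k. s l * w l) - ?\<theta> * (\<Sum>l<k. w l) \<le> (\<Sum>l<d. s l) - ?\<theta> * d"
    by (simp add: algebra_simps sum_subtractf sum_distrib_left)
  moreover have "?\<theta> * (\<Sum>l<k. w l) \<le> ?\<theta> * d"
    using False assms(1)[of d] assms(5) by (intro mult_left_mono) auto
  ultimately show ?thesis using False by simp
qed

text \<open>Pythagoras along each row, by orthonormality of \<open>v\<close>, and then unit length
  of each \<open>u l\<close>. The index set \<open>L\<close> is left open to cover both the whole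
  matrix and the tail cut off by truncation.\<close>

lemma frobenius_svd:
  assumes "orthonormal p k u" "orthonormal q k v" "L \<subseteq> {..<k}"
  shows "(\<Sum>i<p. \<Sum>j<q. (\<Sum>l\<in>L. \<sigma> l * u l i * v l j)\<^sup>2) = (\<Sum>l\<in>L. (\<sigma> l)\<^sup>2)"
proof -
  have "(\<Sum>i<p. \<Sum>j<q. (\<Sum>l\<in>L. \<sigma> l * u l i * v l j)\<^sup>2) = (\<Sum>i<p. \<Sum>l\<in>L. (\<sigma> l * u l i)\<^sup>2)"
    using inner_on_orthonormal_comb[OF assms(2,3)] by (simp add: inner_on_self)
  also have "\<dots> = (\<Sum>l\<in>L. (\<sigma> l)\<^sup>2 * inner_on p (u l) (u l))"
    by (subst sum.swap) (simp add: inner_on_self sum_distrib_left power_mult_distrib)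
  also have "\<dots> = (\<Sum>l\<in>L. (\<sigma> l)\<^sup>2)"
    using assms(1,3) by (intro sum.cong) (auto simp: orthonormal_def)
  finally show ?thesis .
qed

text \<open>Eckart and Young. The columns of a competitor lie in the span of at most \<open>card P\<close> orthonormal
  vectors; projecting onto that span keeps of each \<open>\<sigma> l\<^sup>2\<close> a fraction \<open>w l \<le> 1\<close>, and by Bessel's
  inequality these fractions add up to at most \<open>card P\<close>.\<close>

lemma eckart_young:
  assumes u: "orthonormal p k u" and v: "orthonormal q k v"
    and nonneg: "\<And>l. l < k \<Longrightarrow> 0 \<le> \<sigma> l"
    and dec: "\<And>l l'. l < k \<Longrightarrow> l' < k \<Longrightarrow> l \<le> l' \<Longrightarrow> \<sigma> l' \<le> \<sigma> l"
    and M: "\<And>i j. i < p \<Longrightarrow> j < q \<Longrightarrow> M i j = (\<Sum>l<k. \<sigma> l * u l i * v l j)"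
    and P: "finite P"
  shows "(\<Sum>i<p. \<Sum>j<q. (M i j - (\<Sum>l<min (card P) k. \<sigma> l * u l i * v l j))\<^sup>2)
       \<le> (\<Sum>i<p. \<Sum>j<q. (M i j - (\<Sum>a\<in>P. x a i * y a j))\<^sup>2)"
proof -
  obtain d e where d: "d \<le> card P" and e: "orthonormal p d e"
    and "\<forall>a\<in>P. \<exists>c. \<forall>i<p. x a i = (\<Sum>b<d. c b * e b i)"
    using orthonormal_span[OF P] by blast
  then obtain c where c: "\<And>a i. a \<in> P \<Longrightarrow> i < p \<Longrightarrow> x a i = (\<Sum>b<d. c a b * e b i)" by metis
  define w where "w l = (\<Sum>b<d. (inner_on p (e b) (u l))\<^sup>2)" for l
  let ?h = "min (card P) k"
  have w1: "w l \<le> 1" if "l < k" for l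
    using bessel[OF e, of "u l"] u that by (simp add: w_def orthonormal_def)
  \<comment> \<open>Bessel with the roles exchanged: \<open>w1\<close> projects \<open>u l\<close>
    onto the \<open>e b\<close>, whereas here each \<open>e b\<close> is projected onto the
    \<open>u l\<close>.\<close>
  have "(\<Sum>l<k. w l) = (\<Sum>b<d. \<Sum>l<k. (inner_on p (u l) (e b))\<^sup>2)"
    unfolding w_def by (subst sum.swap) (simp add: inner_on_commute)
  also have "\<dots> \<le> (\<Sum>b<d. inner_on p (e b) (e b))"
    by (intro sum_mono bessel u)
  also have "\<dots> = real d" using e by (simp add: orthonormal_def)
  finally have w2: "(\<Sum>l<k. w l) \<le> real (card P)" using d by simp
  have "(\<Sum>l<k. (\<sigma> l)\<^sup>2 * w l) \<le> (\<Sum>l<?h. (\<sigma> l)\<^sup>2)"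
    using nonneg dec w1 w2 by (intro weighted_sum_le_largest) (auto simp: w_def sum_nonneg
      intro!: power_mono)
  moreover have "(\<Sum>l<k. (\<sigma> l)\<^sup>2) = (\<Sum>l<?h. (\<sigma> l)\<^sup>2) + (\<Sum>l\<in>{?h..<k}. (\<sigma> l)\<^sup>2)"
    by (metis (no_types) atLeast0LessThan min.cobounded2 sum.atLeastLessThan_concat zero_le)
  ultimately have key: "(\<Sum>l\<in>{?h..<k}. (\<sigma> l)\<^sup>2) \<le> (\<Sum>l<k. (\<sigma> l)\<^sup>2) - (\<Sum>l<k. (\<sigma> l)\<^sup>2 * w l)"
    by simp
  have sub: "{?h..<k} \<subseteq> {..<k}" by auto
  have trunc: "M i j - (\<Sum>l<?h. \<sigma> l * u l i * v l j) = (\<Sum>l\<in>{?h..<k}. \<sigma> l * u l i * v l j)"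
    if "i < p" "j < q" for i j
    using M[OF that] sum.atLeastLessThan_concat[of 0 ?h k "\<lambda>l. \<sigma> l * u l i * v l j"]
    by (simp add: atLeast0LessThan)
  \<comment> \<open>The truncation error is the tail of the squared singular values. By
    \<open>key\<close> it is at most the squared norm of \<open>M\<close> minus the part captured by
    the span of the \<open>e b\<close>, that is, the sum over the columns of \<open>M\<close> of
    their squared distances to the span; the columns of the competitor lie in that span.\<close>
  have "(\<Sum>i<p. \<Sum>j<q. (M i j - (\<Sum>l<?h. \<sigma> l * u l i * v l j))\<^sup>2) = (\<Sum>l\<in>{?h..<k}. (\<sigma> l)\<^sup>2)"
    using frobenius_svd[OF u v, of "{?h..<k}" \<sigma>] sub by (simp add: trunc)
  also note key
  also have "(\<Sum>l<k. (\<sigma> l)\<^sup>2) = (\<Sum>j<q. inner_on p (\<lambda>i. M i j) (\<lambda>i. M i j))"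
  proof -
    have "(\<Sum>j<q. inner_on p (\<lambda>i. M i j) (\<lambda>i. M i j)) = (\<Sum>i<p. \<Sum>j<q. (M i j)\<^sup>2)"
      unfolding inner_on_self by (rule sum.swap)
    then show ?thesis using frobenius_svd[OF u v, of "{..<k}" \<sigma>] by (simp add: M)
  qed
  also have "(\<Sum>l<k. (\<sigma> l)\<^sup>2 * w l) = (\<Sum>j<q. \<Sum>b<d. (inner_on p (e b) (\<lambda>i. M i j))\<^sup>2)"
  proof -
    have ip: "inner_on p (e b) (\<lambda>i. M i j) = (\<Sum>l<k. (\<sigma> l * inner_on p (e b) (u l)) * v l j)"
      if "j < q" for b j
      using inner_on_sum_right[of p "e b" "\<lambda>l. \<sigma> l * v l j" u "{..<k}"] that
      by (simp add: inner_on_def M mult_ac)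
    have "(\<Sum>j<q. (inner_on p (e b) (\<lambda>i. M i j))\<^sup>2) = (\<Sum>l<k. (\<sigma> l * inner_on p (e b) (u l))\<^sup>2)" for b
      using inner_on_orthonormal_comb[OF v, of "{..<k}" "\<lambda>l. \<sigma> l * inner_on p (e b) (u l)"]
      by (simp add: inner_on_self ip)
    then have "(\<Sum>b<d. \<Sum>j<q. (inner_on p (e b) (\<lambda>i. M i j))\<^sup>2) = (\<Sum>b<d. \<Sum>l<k. (\<sigma> l)\<^sup>2 * (inner_on
      p (e b) (u l))\<^sup>2)"
      by (simp add: power_mult_distrib)
    also have "\<dots> = (\<Sum>l<k. (\<sigma> l)\<^sup>2 * w l)"
      unfolding w_def sum_distrib_left by (rule sum.swap)
    also have "(\<Sum>b<d. \<Sum>j<q. (inner_on p (e b) (\<lambda>i. M i j))\<^sup>2) = (\<Sum>j<q. \<Sum>b<d. (inner_on p (e b)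
      (\<lambda>i. M i j))\<^sup>2)"
      by (rule sum.swap)
    finally show ?thesis by (rule sym)
  qed
  also have "(\<Sum>j<q. inner_on p (\<lambda>i. M i j) (\<lambda>i. M i j)) - (\<Sum>j<q. \<Sum>b<d. (inner_on p (e b) (\<lambda>i. M i j))\<^sup>2)
     \<le> (\<Sum>j<q. \<Sum>i<p. (M i j - (\<Sum>a\<in>P. x a i * y a j))\<^sup>2)"
    unfolding sum_subtractf[symmetric]
  proof (rule sum_mono)
    fix j
    \<comment> \<open>Coefficients, with respect to \<open>e\<close>, of column \<open>j\<close> of
      the competitor.\<close>
    define g where "g b = (\<Sum>a\<in>P. y a j * c a b)" for b
    have xy: "(\<Sum>a\<in>P. x a i * y a j) = (\<Sum>b<d. g b * e b i)" if "i < p" for i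
      unfolding g_def sum_distrib_right
      by (subst sum.swap) (simp add: c that sum_distrib_left sum_distrib_right mult_ac)
    have "(\<Sum>i<p. (M i j - (\<Sum>a\<in>P. x a i * y a j))\<^sup>2)
        = inner_on p (\<lambda>i. M i j - (\<Sum>b<d. g b * e b i)) (\<lambda>i. M i j - (\<Sum>b<d. g b * e b i))"
      by (simp add: inner_on_self xy)
    then show "inner_on p (\<lambda>i. M i j) (\<lambda>i. M i j) - (\<Sum>b<d. (inner_on p (e b) (\<lambda>i. M i j))\<^sup>2)
      \<le> (\<Sum>i<p. (M i j - (\<Sum>a\<in>P. x a i * y a j))\<^sup>2)"
      by (simp add: norm_diff_orthonormal_comb[OF e] sum_nonneg)
  qed
  also have "\<dots> = (\<Sum>i<p. \<Sum>j<q. (M i j - (\<Sum>a\<in>P. x a i * y a j))\<^sup>2)"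
    by (rule sum.swap)
  finally show ?thesis by simp
qed

lemma svd_orthonormal:
  assumes "is_svd M (U, \<sigma>, V)" and "M \<in> carrier_mat p q"
  defines "k \<equiv> min p q"
  shows "orthonormal p k (\<lambda>l i. U $$ (i, l))" "orthonormal q k (\<lambda>l j. V $$ (j, l))"
    and "\<And>l. l < k \<Longrightarrow> 0 \<le> \<sigma> $ l"
    and "\<And>l l'. l < k \<Longrightarrow> l' < k \<Longrightarrow> l \<le> l' \<Longrightarrow> \<sigma> $ l' \<le> \<sigma> $ l"
    and "\<And>i j. i < p \<Longrightarrow> j < q \<Longrightarrow> M $$ (i, j) = (\<Sum>l<k. \<sigma> $ l * U $$ (i, l) * V $$ (j, l))"
proof -
  have U: "U \<in> carrier_mat p k" and V: "V \<in> carrier_mat q k"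
    and UU: "transpose_mat U * U = 1\<^sub>m k" and VV: "transpose_mat V * V = 1\<^sub>m k"
    and M: "M = U * mat_diag k (\<lambda>l. \<sigma> $ l) * transpose_mat V"
    and *: "\<And>l. l < k \<Longrightarrow> 0 \<le> \<sigma> $ l"
      "\<And>l l'. l < k \<Longrightarrow> l' < k \<Longrightarrow> l \<le> l' \<Longrightarrow> \<sigma> $ l' \<le> \<sigma> $ l"
    using assms by (auto simp: is_svd_def Let_def)
  have orth: "orthonormal d k (\<lambda>l i. W $$ (i, l))"
    if W: "W \<in> carrier_mat d k" and WW: "transpose_mat W * W = 1\<^sub>m k" for W :: "real mat" and d
    unfolding orthonormal_def inner_on_def
  proof (intro allI impI)
    fix a b assume "a < k" "b < k"
    then have "(\<Sum>i<d. W $$ (i, a) * W $$ (i, b)) = (transpose_mat W * W) $$ (a, b)"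
      using W by (simp add: scalar_prod_def atLeast0LessThan)
    then show "(\<Sum>i<d. W $$ (i, a) * W $$ (i, b)) = of_bool (a = b)"
      using \<open>a < k\<close> \<open>b < k\<close> by (simp add: WW)
  qed
  show "orthonormal p k (\<lambda>l i. U $$ (i, l))" "orthonormal q k (\<lambda>l j. V $$ (j, l))"
    using orth U V UU VV by auto
  show "M $$ (i, j) = (\<Sum>l<k. \<sigma> $ l * U $$ (i, l) * V $$ (j, l))" if "i < p" "j < q" for i j
    using that U V unfolding M
    by (simp add: mat_diag_mult_right[OF U] scalar_prod_def atLeast0LessThan mult_ac)
  show "\<And>l. l < k \<Longrightarrow> 0 \<le> \<sigma> $ l"
    and "\<And>l l'. l < k \<Longrightarrow> l' < k \<Longrightarrow> l \<le> l' \<Longrightarrow> \<sigma> $ l' \<le> \<sigma> $ l"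
    by (fact *)+
qed

section \<open>Passing between the two instances\<close>

text \<open>Zero-based position of \<open>x\<close> in the increasing enumeration of
  \<open>B\<close>, expressed by counting so that a program obtains it as a guarded sum.\<close>

definition rk :: "nat set \<Rightarrow> nat \<Rightarrow> nat" where
  "rk B x = card {y \<in> B. y < x}"

lemma rk_bij:
  assumes "finite B"
  shows "bij_betw (rk B) B {..<card B}"
proof -
  have lt: "rk B x < rk B y" if "x \<in> B" "x < y" for x y
    unfolding rk_def using that assms by (intro psubset_card_mono) auto
  have inj: "inj_on (rk B) B"
    by (rule linorder_inj_onI) (auto dest: lt)
  have "rk B x < card B" if "x \<in> B" for x
    unfolding rk_def using that assms by (intro psubset_card_mono) auto
  then have "rk B ` B = {..<card B}"
    by (intro card_subset_eq) (auto simp: card_image[OF inj])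
  with inj show ?thesis by (simp add: bij_betw_def)
qed

lemma rk_less: "finite B \<Longrightarrow> x \<in> B \<Longrightarrow> rk B x < card B"
  using rk_bij[of B] by (auto simp: bij_betw_def)

lemma rk_eq_iff: "finite B \<Longrightarrow> x \<in> B \<Longrightarrow> y \<in> B \<Longrightarrow> rk B x = rk B y \<longleftrightarrow> x = y"
  using rk_bij[of B] by (auto simp: bij_betw_def inj_on_def)

lemma card_rk_eq:
  assumes "finite B" "t < card B"
  shows "card {x \<in> B. rk B x = t} = 1"
proof -
  from assms obtain x where "x \<in> B" "rk B x = t"
    using bij_betw_imp_surj_on[OF rk_bij[OF assms(1)]] by (metis imageE lessThan_iff)
  then have "{x \<in> B. rk B x = t} = {x}" using rk_eq_iff[OF assms(1)] by auto
  then show ?thesis by simp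
qed

definition prod_entry :: "nat \<Rightarrow> (nat \<Rightarrow> nat \<Rightarrow> real) \<Rightarrow> (nat \<Rightarrow> nat \<Rightarrow> real) \<Rightarrow> nat \<Rightarrow> nat \<Rightarrow> real" where
  "prod_entry r X Y i j = (\<Sum>k<r. X i k * Y j k)"

definition sq_err ::
  "nat \<Rightarrow> nat \<Rightarrow> nat \<Rightarrow> (nat \<Rightarrow> nat \<Rightarrow> real) \<Rightarrow> (nat \<Rightarrow> nat \<Rightarrow> real) \<Rightarrow> (nat \<Rightarrow> nat \<Rightarrow> real) \<Rightarrow> real" where
  "sq_err m n r A X Y = (\<Sum>i<m. \<Sum>j<n. (A i j - prod_entry r X Y i j)\<^sup>2)"

definition supported :: "nat \<Rightarrow> nat \<Rightarrow> (nat \<times> nat) set \<Rightarrow> (nat \<Rightarrow> nat \<Rightarrow> real) \<Rightarrow> bool" where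
  "supported p r K X \<longleftrightarrow> (\<forall>i<p. \<forall>k<r. X i k \<noteq> 0 \<longrightarrow> (i, k) \<in> K)"

lemma supportedD: "supported p r K X \<Longrightarrow> i < p \<Longrightarrow> k < r \<Longrightarrow> X i k \<noteq> 0 \<Longrightarrow> (i, k) \<in> K"
  by (simp add: supported_def)

lemma in_column [simp]: "i \<in> column K k \<longleftrightarrow> (i, k) \<in> K"
  by (simp add: column_def)

lemma in_rank1_supp [simp]: "(i, j) \<in> rank1_supp K L k \<longleftrightarrow> (i, k) \<in> K \<and> (j, k) \<in> L"
  by (simp add: rank1_supp_def)

locale reducible_instance =
  fixes m n r :: nat and I J :: "(nat \<times> nat) set" and R C :: "nat \<Rightarrow> nat set"
  assumes reducible: "reducible m n r I J R C"
begin

abbreviation S where "S \<equiv> rank1_supp I J"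
abbreviation T where "T \<equiv> T_set r I J"
abbreviation Tb where "Tb \<equiv> Tbar r I J"
abbreviation ST where "ST \<equiv> S_T r I J"
abbreviation Sp where "Sp \<equiv> S' r I J"
abbreviation IR where "IR \<equiv> I1 r I J R"
abbreviation JC where "JC \<equiv> J1 r I J C"

definition cl :: "nat \<Rightarrow> nat set" where
  "cl k = {l. l < r \<and> S l = S k}"

lemma I_bounds: "(i, k) \<in> I \<Longrightarrow> i < m \<and> k < r"
  and J_bounds: "(j, k) \<in> J \<Longrightarrow> j < n \<and> k < r"
  using reducible by (auto simp: reducible_def)

lemma finite_column [simp]: "finite (column I k)" "finite (column J k)"
  by (rule finite_subset[of _ "{..<m}"]; auto dest: I_bounds)
    (rule finite_subset[of _ "{..<n}"]; auto dest: J_bounds)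

lemma finite_cl [simp]: "finite (cl k)"
  by (simp add: cl_def)

lemma cl_eq: "l \<in> cl k \<Longrightarrow> cl l = cl k"
  by (auto simp: cl_def)

text \<open>A nonempty product determines both factors; the point \<open>(i, j)\<close> supplies the
  nonemptiness.\<close>

lemma columns_eq:
  assumes "l \<in> cl k" "(i, j) \<in> S k"
  shows "column I l = column I k" "column J l = column J k"
proof -
  have "column I l \<times> column J l = column I k \<times> column J k"
    using assms(1) by (simp add: cl_def rank1_supp_def)
  then show "column I l = column I k" "column J l = column J k"
    using assms(2) by (auto simp: times_eq_iff)
qed

lemma supp_classes_eq: "supp_classes r I J = cl ` {..<r}"
  by (auto simp: supp_classes_def quotient_def cl_def)

lemma min_columns_cong:
  assumes "l \<in> cl k"
  shows "min (card (column I l)) (card (column J l)) = min (card (column I k)) (card (column J k))"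
proof (cases "S k = {}")
  case True
  then have "S l = {}" using assms by (simp add: cl_def)
  with True have "column I k = {} \<or> column J k = {}" "column I l = {} \<or> column J l = {}"
    by (simp_all add: rank1_supp_def)
  then show ?thesis by auto
next
  case False
  then obtain i j where "(i, j) \<in> S k" by (metis ex_in_conv surj_pair)
  with assms show ?thesis by (simp add: columns_eq)
qed

text \<open>Membership in \<open>T\<close> becomes a test on the single column \<open>k\<close>, the
  form evaluated by \<open>tab_in_T\<close>. By \<open>min_columns_cong\<close> all members of a
  class give the same answer.\<close>

lemma T_iff: "k \<in> T \<longleftrightarrow> k < r \<and> min (card (column I k)) (card (column J k)) \<le> card (cl k)"
proof -
  have CEC: "is_CEC I J (cl l) \<longleftrightarrow> min (card (column I k)) (card (column J k)) \<le> card (cl k)"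
    if "k \<in> cl l" for l
  proof -
    have cl: "cl k = cl l" using that by (rule cl_eq)
    have *: "min (card (column I k')) (card (column J k')) = min (card (column I k)) (card (column J k))"
      if "k' \<in> cl l" for k'
      using that unfolding cl[symmetric] by (rule min_columns_cong)
    show ?thesis
      unfolding is_CEC_def cl
    proof
      assume "\<forall>k\<in>cl l. min (card (column I k)) (card (column J k)) \<le> card (cl l)"
      then show "min (card (column I k)) (card (column J k)) \<le> card (cl l)" using that by (rule bspec)
    next
      assume "min (card (column I k)) (card (column J k)) \<le> card (cl l)"
      then show "\<forall>k\<in>cl l. min (card (column I k)) (card (column J k)) \<le> card (cl l)"
        using * by (metis le_trans order_refl)
    qed
  qed
  show ?thesis
  proof
    assume "k \<in> T"
    then obtain l where "k \<in> cl l" "is_CEC I J (cl l)"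
      by (auto simp: T_set_def CECs_def supp_classes_eq)
    then show "k < r \<and> min (card (column I k)) (card (column J k)) \<le> card (cl k)"
      using CEC by (auto simp: cl_def)
  next
    assume *: "k < r \<and> min (card (column I k)) (card (column J k)) \<le> card (cl k)"
    then have "k \<in> cl k" by (simp add: cl_def)
    with * CEC show "k \<in> T" by (auto simp: T_set_def CECs_def supp_classes_eq)
  qed
qed

lemma T_less: "k \<in> T \<Longrightarrow> k < r"
  by (simp add: T_iff)

lemma T_cl: "k \<in> T \<Longrightarrow> l \<in> cl k \<Longrightarrow> l \<in> T"
  using cl_eq[of l k] min_columns_cong[of l k] by (simp add: T_iff) (simp add: cl_def)

lemma Tb_iff: "k \<in> Tb \<longleftrightarrow> k < r \<and> k \<notin> T"
  by (auto simp: Tbar_def)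

lemma ST_iff: "(i, j) \<in> ST \<longleftrightarrow> (\<exists>k\<in>T. (i, j) \<in> S k)"
  by (auto simp: S_T_def T_set_def class_supp_def)

lemma Sp_eq: "k \<in> Tb \<Longrightarrow> Sp k = R k \<times> C k"
  using reducible unfolding reducible_def by blast

lemma Sp_iff: "(i, j) \<in> Sp k \<longleftrightarrow> (i, k) \<in> I \<and> (j, k) \<in> J \<and> (i, j) \<notin> ST"
  by (simp add: S'_def)

lemma Sp_disjoint: "k \<in> Tb \<Longrightarrow> l \<in> Tb \<Longrightarrow> Sp k = Sp l \<or> Sp k \<inter> Sp l = {}"
  using reducible unfolding reducible_def by blast

text \<open>Cutting the two columns to \<open>R k\<close> and \<open>C k\<close> leaves
  \<open>S k \<inter> (R k \<times> C k)\<close>, which is \<open>Sp k\<close> because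
  \<open>Sp k\<close> is contained in \<open>S k\<close>. This also covers an empty
  \<open>Sp k\<close>, where \<open>R k\<close> and \<open>C k\<close> are not determined.\<close>

lemma rank1_supp_reduced: "rank1_supp IR JC k = (if k \<in> Tb then Sp k else {})"
proof (cases "k \<in> Tb")
  case True
  have "(i, j) \<in> rank1_supp IR JC k \<longleftrightarrow> (i, j) \<in> Sp k" for i j
    using True Sp_eq[OF True] Sp_iff[of i j k] by (auto simp: I1_def J1_def Tb_iff)
  then show ?thesis using True by auto
next
  case False
  then have "rank1_supp IR JC k = {}"
    by (auto simp: rank1_supp_def column_def I1_def J1_def Tb_iff dest: I_bounds)
  with False show ?thesis by simp
qed

text \<open>A common point of two class supports lies in some \<open>Sp k\<close> and some
  \<open>Sp l\<close>; sets that meet are equal by hypothesis, so \<open>k\<close> and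
  \<open>l\<close> are equivalent. Columns in \<open>T\<close> now have empty support and cannot
  meet anything.\<close>

lemma disjoint_reduced_classes:
  "disjoint_family_on (class_supp IR JC) (supp_classes r IR JC)"
proof -
  have cls: "P = {l. l < r \<and> rank1_supp IR JC l = rank1_supp IR JC k}"
    if P: "P \<in> supp_classes r IR JC" and k: "k \<in> P" for P k
    using P k unfolding supp_classes_def quotient_def by auto
  show ?thesis
    unfolding disjoint_family_on_def
  proof (intro ballI impI, rule ccontr)
    fix P Q assume P: "P \<in> supp_classes r IR JC" and Q: "Q \<in> supp_classes r IR JC"
      and "P \<noteq> Q" and "class_supp IR JC P \<inter> class_supp IR JC Q \<noteq> {}"
    then obtain x k l where x: "k \<in> P" "l \<in> Q" "x \<in> rank1_supp IR JC k" "x \<in> rank1_supp IR JC l"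
      unfolding class_supp_def by blast
    then have "k \<in> Tb" "l \<in> Tb" "x \<in> Sp k" "x \<in> Sp l"
      by (auto simp: rank1_supp_reduced split: if_splits)
    then have "rank1_supp IR JC k = rank1_supp IR JC l"
      using Sp_disjoint[of k l] by (auto simp: rank1_supp_reduced)
    then have "P = Q" using cls[OF P x(1)] cls[OF Q x(2)] by simp
    with \<open>P \<noteq> Q\<close> show False ..
  qed
qed

section \<open>Masking: from the full to the reduced instance\<close>

definition row_in :: "nat \<Rightarrow> nat \<Rightarrow> bool" where
  "row_in i k \<longleftrightarrow> k \<in> Tb \<and> (\<exists>j. (i, j) \<in> Sp k)"

definition col_in :: "nat \<Rightarrow> nat \<Rightarrow> bool" where
  "col_in j k \<longleftrightarrow> k \<in> Tb \<and> (\<exists>i. (i, j) \<in> Sp k)"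

text \<open>Rectangularity recovers \<open>Sp k\<close> from its two projections. These depend on
  \<open>I\<close> and \<open>J\<close> alone, so a program can compute them, unlike the witnesses
  \<open>R\<close> and \<open>C\<close>, which are not part of its input.\<close>

lemma row_col_in: "row_in i k \<and> col_in j k \<longleftrightarrow> k \<in> Tb \<and> (i, j) \<in> Sp k"
  using Sp_eq[of k] by (auto simp: row_in_def col_in_def)

lemma row_in_IR: "row_in i k \<Longrightarrow> (i, k) \<in> IR"
  using Sp_eq[of k] by (auto simp: row_in_def I1_def Sp_iff Tb_iff)

lemma col_in_JC: "col_in j k \<Longrightarrow> (j, k) \<in> JC"
  using Sp_eq[of k] by (auto simp: col_in_def J1_def Sp_iff Tb_iff)

definition off_ST :: "(nat \<Rightarrow> nat \<Rightarrow> real) \<Rightarrow> nat \<Rightarrow> nat \<Rightarrow> real" where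
  "off_ST A i j = (if (i, j) \<in> ST then 0 else A i j)"

lemma reduced_product_supp:
  assumes "supported m r IR X" "supported n r JC Y" "i < m" "j < n" "k < r" "X i k * Y j k \<noteq> 0"
  shows "k \<in> Tb \<and> (i, j) \<in> Sp k"
proof -
  have "(i, j) \<in> rank1_supp IR JC k" using assms by (auto dest: supportedD)
  then show ?thesis by (simp add: rank1_supp_reduced split: if_splits)
qed

lemma reduced_prod_entry_ST:
  assumes "supported m r IR X" "supported n r JC Y" "i < m" "j < n" "(i, j) \<in> ST"
  shows "prod_entry r X Y i j = 0"
  unfolding prod_entry_def
proof (rule sum.neutral, rule ballI)
  fix k assume "k \<in> {..<r}"
  then show "X i k * Y j k = 0"
    using reduced_product_supp[OF assms(1-4), of k] assms(5) by (auto simp: Sp_iff)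
qed

definition red_rows :: "(nat \<Rightarrow> nat \<Rightarrow> real) \<Rightarrow> nat \<Rightarrow> nat \<Rightarrow> real" where
  "red_rows X i k = (if row_in i k then X i k else 0)"

definition red_cols :: "(nat \<Rightarrow> nat \<Rightarrow> real) \<Rightarrow> nat \<Rightarrow> nat \<Rightarrow> real" where
  "red_cols Y j k = (if col_in j k then Y j k else 0)"

lemma supported_red: "supported m r IR (red_rows X)" "supported n r JC (red_cols Y)"
  by (auto simp: supported_def red_rows_def red_cols_def row_in_IR col_in_JC)

text \<open>Outside \<open>ST\<close> a nonzero summand cannot come from a column in
  \<open>T\<close>; for any other column \<open>(i, j)\<close> lies in \<open>Sp k\<close>, so
  neither factor is masked.\<close>

lemma prod_entry_red:
  assumes "supported m r I X" "supported n r J Y" "i < m" "j < n" "(i, j) \<notin> ST"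
  shows "prod_entry r (red_rows X) (red_cols Y) i j = prod_entry r X Y i j"
  unfolding prod_entry_def
proof (rule sum.cong)
  fix k assume k: "k \<in> {..<r}"
  show "red_rows X i k * red_cols Y j k = X i k * Y j k"
  proof (cases "X i k * Y j k = 0")
    case True
    then show ?thesis by (auto simp: red_rows_def red_cols_def)
  next
    case False
    then have S: "(i, j) \<in> S k" using assms k by (auto dest: supportedD)
    then have "k \<in> Tb" using k assms(5) by (auto simp: Tb_iff ST_iff)
    then have "row_in i k \<and> col_in j k" using S assms(5) by (simp add: row_col_in Sp_iff)
    then show ?thesis by (simp add: red_rows_def red_cols_def)
  qed
qed simp

text \<open>Entries outside \<open>ST\<close> contribute equally to both sides; on \<open>ST\<close>
  the left side contributes nothing, since data and product are both zero there.\<close>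

lemma sq_err_red:
  assumes "supported m r I X" "supported n r J Y"
  shows "sq_err m n r (off_ST A) (red_rows X) (red_cols Y) \<le> sq_err m n r A X Y"
  unfolding sq_err_def
proof (intro sum_mono)
  fix i j assume "i \<in> {..<m}" "j \<in> {..<n}"
  then show "(off_ST A i j - prod_entry r (red_rows X) (red_cols Y) i j)\<^sup>2 \<le> (A i j - prod_entry r
    X Y i j)\<^sup>2"
    using assms by (cases "(i, j) \<in> ST")
      (auto simp: off_ST_def reduced_prod_entry_ST[OF supported_red] prod_entry_red)
qed

section \<open>Reconstruction: exact fit on the complete classes\<close>

definition row_mode :: "nat \<Rightarrow> bool" where
  "row_mode l \<longleftrightarrow> card (column I l) \<le> card (cl l)"

text \<open>In row mode the class has at least as many columns as its support has rows, so its
  \<open>t\<close>-th column can carry the unit vector of the \<open>t\<close>-th row. Surplus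
  columns stay zero.\<close>

definition unit_rows :: "nat \<Rightarrow> nat \<Rightarrow> real" where
  "unit_rows i l = of_bool (l \<in> T \<and> (i, l) \<in> I \<and> row_mode l \<and> rk (column I l) i = rk (cl l) l)"

definition unit_cols :: "nat \<Rightarrow> nat \<Rightarrow> real" where
  "unit_cols j l = of_bool (l \<in> T \<and> (j, l) \<in> J \<and> \<not> row_mode l \<and> rk (column J l) j = rk (cl l) l)"

definition cover :: "nat \<Rightarrow> nat \<Rightarrow> real" where
  "cover i j = (\<Sum>k<r. of_bool (k \<in> T) * (of_bool ((i, k) \<in> I) * of_bool ((j, k) \<in> J)))"

text \<open>An entry covered by several complete classes is divided among them. The weight of a class is its
  number of columns, because \<open>cover\<close> counts columns rather than classes.\<close>

definition share :: "(nat \<Rightarrow> nat \<Rightarrow> real) \<Rightarrow> nat \<Rightarrow> nat \<Rightarrow> nat \<Rightarrow> real" where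
  "share A i j l = A i j * real (card (cl l)) / cover i j"

text \<open>At most one \<open>j\<close> contributes, the one picked by \<open>unit_cols\<close>, so
  this is a column of \<open>share A\<close> cut to \<open>I\<close>. The sum mirrors the table that
  the program computes.\<close>

definition fill_rows :: "(nat \<Rightarrow> nat \<Rightarrow> real) \<Rightarrow> nat \<Rightarrow> nat \<Rightarrow> real" where
  "fill_rows A i l = (\<Sum>j<n. of_bool ((i, l) \<in> I) * (unit_cols j l * share A i j l))"

definition fill_cols :: "(nat \<Rightarrow> nat \<Rightarrow> real) \<Rightarrow> nat \<Rightarrow> nat \<Rightarrow> real" where
  "fill_cols A j l = (\<Sum>i<m. of_bool ((j, l) \<in> J) * (unit_rows i l * share A i j l))"

text \<open>Says that \<open>l\<close> is the column of its class responsible for reproducing the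
  entry \<open>(i, j)\<close>.\<close>

definition matches :: "nat \<Rightarrow> nat \<Rightarrow> nat \<Rightarrow> bool" where
  "matches i j l \<longleftrightarrow> (i, j) \<in> S l \<and>
     (if row_mode l then rk (column I l) i else rk (column J l) j) = rk (cl l) l"

lemma cover_card: "cover i j = card {l \<in> T. (i, j) \<in> S l}"
proof -
  have "cover i j = (\<Sum>k<r. of_bool (k \<in> T \<and> (i, j) \<in> S k))"
    unfolding cover_def by (intro sum.cong) auto
  also have "\<dots> = card ({..<r} \<inter> {k. k \<in> T \<and> (i, j) \<in> S k})"
    by (simp add: sum_of_bool_eq)
  also have "{..<r} \<inter> {k. k \<in> T \<and> (i, j) \<in> S k} = {l \<in> T. (i, j) \<in> S l}"
    using T_less by auto
  finally show ?thesis .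
qed

text \<open>In either mode one summand of each factor vanishes, leaving a unit vector times a fill
  vector; injectivity of \<open>rk\<close> collapses the sum in the latter to one index.\<close>

lemma fill_product:
  assumes l: "l \<in> T" and ij: "i < m" "j < n"
  shows "(unit_rows i l + fill_rows A i l) * (unit_cols j l + fill_cols A j l)
    = of_bool (matches i j l) * share A i j l"
proof (cases "row_mode l")
  case True
  have "fill_rows A i l = 0" "unit_cols j l = 0"
    using True by (auto simp: fill_rows_def unit_cols_def)
  moreover have "unit_rows i l * fill_cols A j l = of_bool (matches i j l) * share A i j l"
  proof (cases "unit_rows i l = 0")
    case True
    then show ?thesis using \<open>row_mode l\<close> l by (auto simp: unit_rows_def matches_def)
  next
    case False
    then have i: "(i, l) \<in> I" "rk (column I l) i = rk (cl l) l" by (auto simp: unit_rows_def)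
    have u: "unit_rows i' l = of_bool (i' = i)" for i'
      using i l True rk_eq_iff[of "column I l" i' i] by (auto simp: unit_rows_def)
    have "fill_cols A j l = (\<Sum>i'<m. if i = i' then of_bool ((j, l) \<in> J) * share A i' j l else 0)"
      unfolding fill_cols_def u by (intro sum.cong) auto
    then have "fill_cols A j l = of_bool ((j, l) \<in> J) * share A i j l" using ij by simp
    then show ?thesis using u i True by (auto simp: matches_def)
  qed
  ultimately show ?thesis by simp
next
  case False
  have "fill_cols A j l = 0" "unit_rows i l = 0"
    using False by (auto simp: fill_cols_def unit_rows_def)
  moreover have "fill_rows A i l * unit_cols j l = of_bool (matches i j l) * share A i j l"
  proof (cases "unit_cols j l = 0")
    case True
    then show ?thesis using False l by (auto simp: unit_cols_def matches_def)
  next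
    case nz: False
    then have j: "(j, l) \<in> J" "rk (column J l) j = rk (cl l) l" by (auto simp: unit_cols_def)
    have u: "unit_cols j' l = of_bool (j' = j)" for j'
      using j l False rk_eq_iff[of "column J l" j' j] by (auto simp: unit_cols_def)
    have "fill_rows A i l = (\<Sum>j'<n. if j = j' then of_bool ((i, l) \<in> I) * share A i j' l else 0)"
      unfolding fill_rows_def u by (intro sum.cong) auto
    then have "fill_rows A i l = of_bool ((i, l) \<in> I) * share A i j l" using ij by simp
    then show ?thesis using u j False by (auto simp: matches_def)
  qed
  ultimately show ?thesis by simp
qed

text \<open>The rank \<open>t\<close> of \<open>i\<close> or \<open>j\<close> is below the number of
  columns in the class: in row mode by definition of the mode, otherwise because completeness must
  then hold through the other column. Exactly one member of the class has rank
  \<open>t\<close>.\<close>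

lemma card_matches:
  assumes l: "l \<in> T" and ij: "(i, j) \<in> S l"
  shows "card {k \<in> cl l. matches i j k} = 1"
proof -
  define t where "t = (if row_mode l then rk (column I l) i else rk (column J l) j)"
  have "t < card (cl l)"
    using ij l rk_less[of "column I l" i] rk_less[of "column J l" j]
    by (auto simp: t_def row_mode_def T_iff)
  moreover have "matches i j k \<longleftrightarrow> rk (cl l) k = t" if k: "k \<in> cl l" for k
  proof -
    have "S k = S l" using k by (simp add: cl_def)
    then show ?thesis
      using ij columns_eq[OF k ij] cl_eq[OF k] by (auto simp: matches_def t_def row_mode_def)
  qed
  then have "{k \<in> cl l. matches i j k} = {k \<in> cl l. rk (cl l) k = t}" by auto
  ultimately show ?thesis using card_rk_eq by simp
qed

text \<open>Double counting. Write each weight \<open>card (cl l)\<close> as a sum over the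
  equivalent columns \<open>k\<close> and swap the sums: each \<open>k\<close> covering
  \<open>(i, j)\<close> meets exactly one matching column in its class, so the weights total
  \<open>cover i j\<close>.\<close>

lemma sum_matches:
  assumes "(i, j) \<in> ST"
  shows "(\<Sum>l\<in>T. of_bool (matches i j l) * share A i j l) = A i j"
proof -
  let ?Q = "{l \<in> T. (i, j) \<in> S l}"
  have finT: "finite T" by (rule finite_subset[of _ "{..<r}"]) (auto dest: T_less)
  then have fin: "finite ?Q" by simp
  \<comment> \<open>Equivalent columns have the same support and are all in \<open>T\<close>, so a
    class meeting \<open>?Q\<close> lies inside it.\<close>
  have clQ: "cl l = {k \<in> ?Q. S k = S l}" if "l \<in> ?Q" for l
  proof (rule equalityI; rule subsetI)
    fix k assume k: "k \<in> cl l"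
    then have Sk: "S k = S l" by (simp add: cl_def)
    have "(i, j) \<in> S l" "l \<in> T" using that by auto
    then have "(i, j) \<in> S k" "k \<in> T" using T_cl k unfolding Sk by blast+
    with Sk show "k \<in> {k \<in> ?Q. S k = S l}" by - (intro CollectI conjI; assumption)
  qed (auto simp: cl_def T_less)
  have "(\<Sum>l\<in>T. of_bool (matches i j l) * real (card (cl l)))
      = (\<Sum>l\<in>?Q. of_bool (matches i j l) * real (card (cl l)))"
    using finT by (intro sum.mono_neutral_right) (auto simp: matches_def)
  also have "\<dots> = (\<Sum>l\<in>?Q. \<Sum>k\<in>?Q. of_bool (matches i j l \<and> S k = S l))"
  proof (rule sum.cong)
    fix l assume l: "l \<in> ?Q"
    have "real (card (cl l)) = (\<Sum>k\<in>?Q. of_bool (S k = S l))"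
      using fin unfolding clQ[OF l] by (simp add: sum_of_bool_eq Int_def)
    then show "of_bool (matches i j l) * real (card (cl l)) = (\<Sum>k\<in>?Q. of_bool (matches i j l \<and> S
      k = S l))"
      by (simp add: of_bool_conj sum_distrib_left)
  qed simp
  also have "\<dots> = (\<Sum>k\<in>?Q. \<Sum>l\<in>?Q. of_bool (matches i j l \<and> S k = S l))"
    by (rule sum.swap)
  also have "\<dots> = (\<Sum>k\<in>?Q. 1)"
  proof (rule sum.cong)
    fix k assume k: "k \<in> ?Q"
    have "(\<Sum>l\<in>?Q. of_bool (matches i j l \<and> S k = S l)) = real (card {l \<in> cl k. matches i j l})"
      using fin unfolding clQ[OF k]
      by (simp add: sum_of_bool_eq) (rule arg_cong[where f = card], auto)
    then show "(\<Sum>l\<in>?Q. of_bool (matches i j l \<and> S k = S l)) = (1 :: real)"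
      using card_matches[of k i j] k by simp
  qed simp
  finally have "(\<Sum>l\<in>T. of_bool (matches i j l) * real (card (cl l))) = cover i j"
    by (simp add: cover_card)
  moreover have "?Q \<noteq> {}" using assms by (auto simp: ST_iff)
  then have "cover i j \<noteq> 0" using fin by (simp add: cover_card card_gt_0_iff)
  moreover have "(\<Sum>l\<in>T. of_bool (matches i j l) * share A i j l)
      = A i j / cover i j * (\<Sum>l\<in>T. of_bool (matches i j l) * real (card (cl l)))"
    unfolding sum_distrib_left by (intro sum.cong) (auto simp: share_def)
  ultimately show ?thesis by simp
qed

definition full_rows :: "(nat \<Rightarrow> nat \<Rightarrow> real) \<Rightarrow> (nat \<Rightarrow> nat \<Rightarrow> real) \<Rightarrow> nat \<Rightarrow> nat \<Rightarrow> real" where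
  "full_rows A X i k = X i k + unit_rows i k + fill_rows A i k"

definition full_cols :: "(nat \<Rightarrow> nat \<Rightarrow> real) \<Rightarrow> (nat \<Rightarrow> nat \<Rightarrow> real) \<Rightarrow> nat \<Rightarrow> nat \<Rightarrow> real" where
  "full_cols A Y j k = Y j k + unit_cols j k + fill_cols A j k"

lemma fill_zero:
  assumes "l \<notin> T"
  shows "unit_rows i l = 0" "unit_cols j l = 0" "fill_rows A i l = 0" "fill_cols A j l = 0"
  using assms by (simp_all add: unit_rows_def unit_cols_def fill_rows_def fill_cols_def)

lemma supported_full:
  assumes "supported m r IR X" "supported n r JC Y"
  shows "supported m r I (full_rows A X)" "supported n r J (full_cols A Y)"
proof -
  have "full_rows A X i k = 0" if "i < m" "k < r" "(i, k) \<notin> I" for i k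
    using assms(1) that by (auto simp: supported_def full_rows_def I1_def unit_rows_def fill_rows_def)
  then show "supported m r I (full_rows A X)" by (auto simp: supported_def)
  have "full_cols A Y j k = 0" if "j < n" "k < r" "(j, k) \<notin> J" for j k
    using assms(2) that by (auto simp: supported_def full_cols_def J1_def unit_cols_def fill_cols_def)
  then show "supported n r J (full_cols A Y)" by (auto simp: supported_def)
qed

lemma prod_entry_full:
  assumes X: "supported m r IR X" and Y: "supported n r JC Y" and ij: "i < m" "j < n"
  shows "prod_entry r (full_rows A X) (full_cols A Y) i j
    = (if (i, j) \<in> ST then A i j else prod_entry r X Y i j)"
proof -
  have r: "{..<r} = T \<union> Tb" "T \<inter> Tb = {}" by (auto simp: Tb_iff T_less)
  have fin: "finite T" "finite Tb"
    using finite_lessThan[of r] unfolding r(1) by auto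
  \<comment> \<open>\<open>IR\<close> and \<open>JC\<close> contain no entries in columns of
    \<open>T\<close>, so a reduced solution leaves these columns free for the fit.\<close>
  have T0: "X i k = 0" "Y j k = 0" if "k \<in> T" for k
    using X Y ij that T_less[OF that] by (auto simp: supported_def I1_def J1_def)
  have "prod_entry r (full_rows A X) (full_cols A Y) i j
     = (\<Sum>k\<in>T. full_rows A X i k * full_cols A Y j k) + (\<Sum>k\<in>Tb. full_rows A X i k * full_cols A Y j k)"
    unfolding prod_entry_def r(1) using fin r(2) by (rule sum.union_disjoint)
  also have "(\<Sum>k\<in>T. full_rows A X i k * full_cols A Y j k) = (\<Sum>k\<in>T. of_bool (matches i j k) *
    share A i j k)"
    by (intro sum.cong refl) (simp add: full_rows_def full_cols_def T0 fill_product ij)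
  also have "\<dots> = (if (i, j) \<in> ST then A i j else 0)"
  proof (cases "(i, j) \<in> ST")
    case True
    then show ?thesis by (simp add: sum_matches)
  next
    case False
    then have "\<not> matches i j k" if "k \<in> T" for k using that by (auto simp: matches_def ST_iff)
    then show ?thesis using False by simp
  qed
  also have "(\<Sum>k\<in>Tb. full_rows A X i k * full_cols A Y j k) = (\<Sum>k\<in>Tb. X i k * Y j k)"
    by (intro sum.cong refl) (simp add: full_rows_def full_cols_def fill_zero Tb_iff)
  also have "\<dots> = prod_entry r X Y i j"
    unfolding prod_entry_def r(1) using fin T0 by (intro sum.mono_neutral_left) auto
  finally show ?thesis using reduced_prod_entry_ST[OF X Y ij] by (cases "(i, j) \<in> ST") simp_all
qed

lemma sq_err_full:
  assumes X: "supported m r IR X" and Y: "supported n r JC Y"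
  shows "sq_err m n r A (full_rows A X) (full_cols A Y) = sq_err m n r (off_ST A) X Y"
  unfolding sq_err_def
proof (intro sum.cong refl)
  fix i j assume "i \<in> {..<m}" "j \<in> {..<n}"
  then show "(A i j - prod_entry r (full_rows A X) (full_cols A Y) i j)\<^sup>2 = (off_ST A i j -
    prod_entry r X Y i j)\<^sup>2"
    by (cases "(i, j) \<in> ST")
      (simp_all add: prod_entry_full[OF X Y] off_ST_def reduced_prod_entry_ST[OF X Y])
qed

section \<open>Blocks of the reduced instance\<close>

definition block :: "nat \<Rightarrow> nat set" where
  "block l = {k \<in> Tb. Sp k = Sp l}"

text \<open>The position of \<open>l\<close> in its block, phrased by overlapping rows and columns so that a program can
  compute it; the two notions differ only on empty blocks.\<close>

definition pos :: "nat \<Rightarrow> nat" where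
  "pos l = card {k. k < r \<and> k < l \<and> (\<exists>i j. row_in i k \<and> row_in i l \<and> col_in j k \<and> col_in j l)}"

definition masked :: "(nat \<Rightarrow> nat \<Rightarrow> real) \<Rightarrow> nat \<Rightarrow> nat \<Rightarrow> nat \<Rightarrow> real" where
  "masked A l i j = (if row_in i l \<and> col_in j l then A i j else 0)"

lemma finite_Tb [simp]: "finite Tb"
  by (simp add: Tbar_def)

text \<open>A common row and a common column of two rectangles give a common point, and supports
  that meet coincide.\<close>

lemma pos_rk:
  assumes l: "l \<in> Tb" and ne: "Sp l \<noteq> {}"
  shows "pos l = rk (block l) l"
proof -
  have "(\<exists>i j. row_in i k \<and> row_in i l \<and> col_in j k \<and> col_in j l) \<longleftrightarrow> k \<in> block l" for k
  proof -
    have "(\<exists>i j. row_in i k \<and> row_in i l \<and> col_in j k \<and> col_in j l) \<longleftrightarrow>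
        (\<exists>i j. (row_in i k \<and> col_in j k) \<and> (row_in i l \<and> col_in j l))"
      by (simp only: conj_ac)
    also have "\<dots> \<longleftrightarrow> k \<in> Tb \<and> Sp k \<inter> Sp l \<noteq> {}"
      unfolding row_col_in using l by auto
    also have "\<dots> \<longleftrightarrow> k \<in> block l"
      using Sp_disjoint[of k l] l ne by (auto simp: block_def)
    finally show ?thesis .
  qed
  then have "{k. k < r \<and> k < l \<and> (\<exists>i j. row_in i k \<and> row_in i l \<and> col_in j k \<and> col_in j l)} = {k \<in>
    block l. k < l}"
    by (auto simp: block_def Tb_iff)
  then show ?thesis by (simp add: pos_def rk_def)
qed

text \<open>The first sum does not depend on the factors, and an entry of a block \<open>B\<close>
  receives contributions only from columns with support \<open>B\<close>, so the blocks can be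
  minimized independently. \<open>\<B>\<close> is an image, hence columns sharing a support count as
  one block.\<close>

lemma sq_err_split:
  assumes X: "supported m r IR X" and Y: "supported n r JC Y"
  defines "\<B> \<equiv> Sp ` Tb"
  shows "sq_err m n r (off_ST A) X Y =
    (\<Sum>(i, j)\<in>{..<m} \<times> {..<n} - \<Union>\<B>. (off_ST A i j)\<^sup>2) +
    (\<Sum>B\<in>\<B>. \<Sum>(i, j)\<in>B. (A i j - (\<Sum>k | k \<in> Tb \<and> Sp k = B. X i k * Y j k))\<^sup>2)"
proof -
  define D where "D i j = (off_ST A i j - prod_entry r X Y i j)\<^sup>2" for i j
  have sub: "\<Union>\<B> \<subseteq> {..<m} \<times> {..<n}"
    by (auto simp: \<B>_def Sp_iff dest: I_bounds J_bounds)
  have fin: "finite B" if "B \<in> \<B>" for B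
    by (rule finite_subset[of _ "{..<m} \<times> {..<n}"]) (use sub that in auto)
  have "sq_err m n r (off_ST A) X Y = (\<Sum>(i, j)\<in>{..<m} \<times> {..<n}. D i j)"
    by (simp add: sq_err_def sum.cartesian_product D_def)
  also have "\<dots> = (\<Sum>(i, j)\<in>{..<m} \<times> {..<n} - \<Union>\<B>. D i j) + (\<Sum>(i, j)\<in>\<Union>\<B>. D i j)"
    using sub by (intro sum.subset_diff) auto
  also have "(\<Sum>(i, j)\<in>\<Union>\<B>. D i j) = (\<Sum>B\<in>\<B>. \<Sum>(i, j)\<in>B. D i j)"
  proof -
    have "B \<inter> B' = {}" if "B \<in> \<B>" "B' \<in> \<B>" "B \<noteq> B'" for B B'
      using that Sp_disjoint unfolding \<B>_def by auto
    then show ?thesis using fin by (simp add: sum.Union_disjoint)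
  qed
  also have "\<dots> = (\<Sum>B\<in>\<B>. \<Sum>(i, j)\<in>B. (A i j - (\<Sum>k | k \<in> Tb \<and> Sp k = B. X i k * Y j k))\<^sup>2)"
  proof (intro sum.cong refl, clarify)
    fix B i j assume B: "B \<in> \<B>" and ij: "(i, j) \<in> B"
    then have b: "i < m" "j < n" "(i, j) \<notin> ST" using sub by (auto simp: \<B>_def Sp_iff)
    have "X i k * Y j k = 0" if k: "k < r" "\<not> (k \<in> Tb \<and> Sp k = B)" for k
    proof (rule ccontr)
      assume "X i k * Y j k \<noteq> 0"
      then have "k \<in> Tb" "(i, j) \<in> Sp k"
        using reduced_product_supp[OF X Y b(1,2) k(1)] by auto
      then show False using k B ij Sp_disjoint[of k] unfolding \<B>_def by blast
    qed
    then have "prod_entry r X Y i j = (\<Sum>k | k \<in> Tb \<and> Sp k = B. X i k * Y j k)"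
      unfolding prod_entry_def by (intro sum.mono_neutral_right) (auto simp: Tb_iff)
    then show "D i j = (A i j - (\<Sum>k | k \<in> Tb \<and> Sp k = B. X i k * Y j k))\<^sup>2"
      using b by (simp add: D_def off_ST_def)
  qed
  also have "(\<Sum>(i, j)\<in>{..<m} \<times> {..<n} - \<Union>\<B>. D i j) = (\<Sum>(i, j)\<in>{..<m} \<times> {..<n} - \<Union>\<B>. (off_ST A i j)\<^sup>2)"
  proof (rule sum.cong[OF refl])
    fix z assume "z \<in> {..<m} \<times> {..<n} - \<Union>\<B>"
    moreover obtain i j where z: "z = (i, j)" by (cases z)
    ultimately have ij: "i \<in> {..<m}" "j \<in> {..<n}" "(i, j) \<notin> \<Union>\<B>" by auto
    have "X i k * Y j k = 0" if "k < r" for k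
      using reduced_product_supp[OF X Y _ _ that, of i j] ij unfolding \<B>_def by blast
    then have "prod_entry r X Y i j = 0" unfolding prod_entry_def by (intro sum.neutral) simp
    then show "(case z of (i, j) \<Rightarrow> D i j) = (case z of (i, j) \<Rightarrow> (off_ST A i j)\<^sup>2)"
      by (simp add: D_def z)
  qed
  finally show ?thesis .
qed

text \<open>The singular value is absorbed into the row factor. The decomposition has only
  \<open>min m n\<close> terms, so the remaining columns of a larger block are set to zero.\<close>

definition svd_rows :: "(nat \<Rightarrow> nat \<Rightarrow> real) \<Rightarrow> (nat \<Rightarrow> nat \<Rightarrow> nat \<Rightarrow> real) \<Rightarrow> nat \<Rightarrow> nat \<Rightarrow> real" where
  "svd_rows s U i l = (if row_in i l \<and> pos l < min m n then s l (pos l) * U l i (pos l) else 0)"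

definition svd_cols :: "(nat \<Rightarrow> nat \<Rightarrow> nat \<Rightarrow> real) \<Rightarrow> nat \<Rightarrow> nat \<Rightarrow> real" where
  "svd_cols V j l = (if col_in j l \<and> pos l < min m n then V l j (pos l) else 0)"

lemma supported_svd: "supported m r IR (svd_rows s U)" "supported n r JC (svd_cols V)"
  by (auto simp: supported_def svd_rows_def svd_cols_def row_in_IR col_in_JC split: if_splits)

text \<open>The comparison takes place on the whole masked matrix. Extending the left sum beyond
  \<open>Sp l\<close> adds only squares, whatever the singular vectors do there; on the right both
  the mask and the competitor vanish outside \<open>Sp l\<close>, so nothing is added.\<close>

lemma svd_block_optimal:
  fixes s :: "nat \<Rightarrow> nat \<Rightarrow> real" and U V :: "nat \<Rightarrow> nat \<Rightarrow> nat \<Rightarrow> real"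
  assumes l: "l \<in> Tb"
    and cong: "\<And>k. k \<in> block l \<Longrightarrow> s k = s l \<and> U k = U l \<and> V k = V l"
    and U: "orthonormal m (min m n) (\<lambda>t i. U l i t)"
    and V: "orthonormal n (min m n) (\<lambda>t j. V l j t)"
    and nonneg: "\<And>t. t < min m n \<Longrightarrow> 0 \<le> s l t"
    and dec: "\<And>t t'. t < min m n \<Longrightarrow> t' < min m n \<Longrightarrow> t \<le> t' \<Longrightarrow> s l t' \<le> s l t"
    and svd: "\<And>i j. i < m \<Longrightarrow> j < n \<Longrightarrow> masked A l i j = (\<Sum>t<min m n. s l t * U l i t * V l j t)"
    and X: "supported m r IR X" and Y: "supported n r JC Y"
  shows "(\<Sum>(i, j)\<in>Sp l. (A i j - (\<Sum>k | k \<in> Tb \<and> Sp k = Sp l. svd_rows s U i k * svd_cols V j k))\<^sup>2)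
    \<le> (\<Sum>(i, j)\<in>Sp l. (A i j - (\<Sum>k | k \<in> Tb \<and> Sp k = Sp l. X i k * Y j k))\<^sup>2)"
proof -
  let ?h = "min (card (block l)) (min m n)"
  let ?G = "\<lambda>i j. \<Sum>t<?h. s l t * U l i t * V l j t"
  have block: "{k. k \<in> Tb \<and> Sp k = Sp l} = block l" by (simp add: block_def)
  have fin: "finite (block l)" by (simp add: block_def)
  have sub: "Sp l \<subseteq> {..<m} \<times> {..<n}" by (auto simp: Sp_iff dest: I_bounds J_bounds)
  have M: "masked A l i j = A i j" if "(i, j) \<in> Sp l" for i j
    using that l row_col_in[of i l j] by (simp add: masked_def)
  have M0: "masked A l i j = 0" if "(i, j) \<notin> Sp l" for i j
    using that row_col_in[of i l j] by (auto simp: masked_def)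
  have G: "(\<Sum>k\<in>block l. svd_rows s U i k * svd_cols V j k) = ?G i j" if ij: "(i, j) \<in> Sp l" for i j
  proof -
    \<comment> \<open>The default 0 lets the sum run over all positions in the block, onto which
      \<open>rk\<close> is a bijection, before it is cut to \<open>?h\<close> terms.\<close>
    let ?g = "\<lambda>t. if t < min m n then s l t * U l i t * V l j t else 0"
    have "(\<Sum>k\<in>block l. svd_rows s U i k * svd_cols V j k) = (\<Sum>k\<in>block l. ?g (rk (block l) k))"
    proof (rule sum.cong)
      fix k assume k: "k \<in> block l"
      then have "block k = block l" "k \<in> Tb" "(i, j) \<in> Sp k" using ij by (auto simp: block_def)
      then have "pos k = rk (block l) k" "row_in i k" "col_in j k"
        using pos_rk[of k] row_col_in[of i k j] by auto
      then show "svd_rows s U i k * svd_cols V j k = ?g (rk (block l) k)"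
        using cong[OF k] by (simp add: svd_rows_def svd_cols_def)
    qed simp
    also have "\<dots> = (\<Sum>t<card (block l). ?g t)"
      using rk_bij[OF fin] by (rule sum.reindex_bij_betw)
    also have "\<dots> = ?G i j"
      by (intro sum.mono_neutral_cong_right) auto
    finally show ?thesis .
  qed
  have "(\<Sum>(i, j)\<in>Sp l. (A i j - (\<Sum>k\<in>block l. svd_rows s U i k * svd_cols V j k))\<^sup>2)
      = (\<Sum>(i, j)\<in>Sp l. (masked A l i j - ?G i j)\<^sup>2)"
    by (intro sum.cong refl) (auto simp: G M)
  also have "\<dots> \<le> (\<Sum>(i, j)\<in>{..<m} \<times> {..<n}. (masked A l i j - ?G i j)\<^sup>2)"
    using sub by (intro sum_mono2) auto
  also have "\<dots> \<le> (\<Sum>(i, j)\<in>{..<m} \<times> {..<n}. (masked A l i j - (\<Sum>k\<in>block l. X i k * Y j k))\<^sup>2)"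
    using eckart_young[OF U V nonneg dec svd fin, of "\<lambda>k i. X i k" "\<lambda>k j. Y j k"]
    by (simp add: sum.cartesian_product)
  also have "\<dots> = (\<Sum>(i, j)\<in>Sp l. (A i j - (\<Sum>k\<in>block l. X i k * Y j k))\<^sup>2)"
  proof (rule sum.mono_neutral_cong_right)
    show "\<forall>z\<in>{..<m} \<times> {..<n} - Sp l. (case z of (i, j) \<Rightarrow> (masked A l i j - (\<Sum>k\<in>block l. X i k *
      Y j k))\<^sup>2) = 0"
    proof (rule ballI)
      fix z assume "z \<in> {..<m} \<times> {..<n} - Sp l"
      moreover obtain i j where z: "z = (i, j)" by (cases z)
      ultimately have ij: "i \<in> {..<m}" "j \<in> {..<n}" "(i, j) \<notin> Sp l" by auto
      have "X i k * Y j k = 0" if k: "k \<in> block l" for k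
        using reduced_product_supp[OF X Y, of i j k] ij k by (auto simp: block_def Tb_iff)
      then have "(\<Sum>k\<in>block l. X i k * Y j k) = 0" by (intro sum.neutral) simp
      then show "(case z of (i, j) \<Rightarrow> (masked A l i j - (\<Sum>k\<in>block l. X i k * Y j k))\<^sup>2) = 0"
        using M0 ij by (simp add: z)
    qed
  qed (use sub M in auto)
  finally show ?thesis unfolding block .
qed

lemma svd_optimal:
  fixes s :: "nat \<Rightarrow> nat \<Rightarrow> real" and U V :: "nat \<Rightarrow> nat \<Rightarrow> nat \<Rightarrow> real"
  assumes cong: "\<And>k l. k \<in> Tb \<Longrightarrow> l \<in> Tb \<Longrightarrow> Sp k = Sp l \<Longrightarrow> s k = s l \<and> U k = U l \<and> V k = V l"
    and U: "\<And>l. l \<in> Tb \<Longrightarrow> orthonormal m (min m n) (\<lambda>t i. U l i t)"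
    and V: "\<And>l. l \<in> Tb \<Longrightarrow> orthonormal n (min m n) (\<lambda>t j. V l j t)"
    and nonneg: "\<And>l t. l \<in> Tb \<Longrightarrow> t < min m n \<Longrightarrow> 0 \<le> s l t"
    and dec: "\<And>l t t'. l \<in> Tb \<Longrightarrow> t < min m n \<Longrightarrow> t' < min m n \<Longrightarrow> t \<le> t' \<Longrightarrow> s l t' \<le> s l t"
    and svd: "\<And>l i j. l \<in> Tb \<Longrightarrow> i < m \<Longrightarrow> j < n \<Longrightarrow>
      masked A l i j = (\<Sum>t<min m n. s l t * U l i t * V l j t)"
    and X: "supported m r IR X" and Y: "supported n r JC Y"
  shows "sq_err m n r (off_ST A) (svd_rows s U) (svd_cols V) \<le> sq_err m n r (off_ST A) X Y"
  unfolding sq_err_split[OF X Y] sq_err_split[OF supported_svd]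
proof (rule add_left_mono, rule sum_mono)
  fix B assume "B \<in> Sp ` Tb"
  then obtain l where l: "l \<in> Tb" and B: "B = Sp l" by blast
  show "(\<Sum>(i, j)\<in>B. (A i j - (\<Sum>k | k \<in> Tb \<and> Sp k = B. svd_rows s U i k * svd_cols V j k))\<^sup>2)
    \<le> (\<Sum>(i, j)\<in>B. (A i j - (\<Sum>k | k \<in> Tb \<and> Sp k = B. X i k * Y j k))\<^sup>2)"
    unfolding B
  proof (rule svd_block_optimal[where A = A])
    show "s k = s l \<and> U k = U l \<and> V k = V l" if "k \<in> block l" for k
      using that l by (intro cong) (simp_all add: block_def)
  qed (rule l U[OF l] V[OF l] nonneg[OF l] dec[OF l] svd[OF l] X Y; assumption)+
qed

end

section \<open>Matrices as functions\<close>

text \<open>Factors are functions here, so that array contents and formulas such as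
  \<open>full_rows\<close> can be compared directly; values outside the index ranges are irrelevant
  (\<open>opt_cong\<close>).\<close>

definition opt ::
  "nat \<Rightarrow> nat \<Rightarrow> nat \<Rightarrow> (nat \<times> nat) set \<Rightarrow> (nat \<times> nat) set \<Rightarrow> (nat \<Rightarrow> nat \<Rightarrow> real) \<Rightarrow>
    (nat \<Rightarrow> nat \<Rightarrow> real) \<Rightarrow> (nat \<Rightarrow> nat \<Rightarrow> real) \<Rightarrow> bool" where
  "opt m n r K L A X Y \<longleftrightarrow> supported m r K X \<and> supported n r L Y \<and>
    (\<forall>X' Y'. supported m r K X' \<longrightarrow> supported n r L Y' \<longrightarrow> sq_err m n r A X Y \<le> sq_err m n r A X' Y')"

lemma sq_err_cong:
  assumes "\<And>i j. i < m \<Longrightarrow> j < n \<Longrightarrow> A i j = A' i j"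
    and "\<And>i k. i < m \<Longrightarrow> k < r \<Longrightarrow> X i k = X' i k" and "\<And>j k. j < n \<Longrightarrow> k < r \<Longrightarrow> Y j k = Y' j k"
  shows "sq_err m n r A X Y = sq_err m n r A' X' Y'"
  unfolding sq_err_def prod_entry_def using assms by simp

lemma supported_cong:
  assumes "\<And>i k. i < p \<Longrightarrow> k < r \<Longrightarrow> X i k = X' i k"
  shows "supported p r K X \<longleftrightarrow> supported p r K X'"
  unfolding supported_def using assms by simp

lemma opt_cong:
  assumes "\<And>i j. i < m \<Longrightarrow> j < n \<Longrightarrow> A i j = A' i j"
    and "\<And>i k. i < m \<Longrightarrow> k < r \<Longrightarrow> X i k = X' i k" and "\<And>j k. j < n \<Longrightarrow> k < r \<Longrightarrow> Y j k = Y' j k"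
  shows "opt m n r K L A X Y \<longleftrightarrow> opt m n r K L A' X' Y'"
proof -
  have "sq_err m n r A X Y = sq_err m n r A' X' Y'" using assms by (rule sq_err_cong)
  moreover have "sq_err m n r A X'' Y'' = sq_err m n r A' X'' Y''" for X'' Y''
    using assms by (intro sq_err_cong) simp_all
  ultimately show ?thesis
    using supported_cong[of m r X X' K] supported_cong[of n r Y Y' L] assms(2,3)
    by (simp add: opt_def)
qed

lemma fsmf_feasible_iff:
  "(X, Y) \<in> fsmf_feasible m n r K L \<longleftrightarrow> X \<in> carrier_mat m r \<and> Y \<in> carrier_mat n r \<and>
    supported m r K (\<lambda>i k. X $$ (i, k)) \<and> supported n r L (\<lambda>j k. Y $$ (j, k))"
  by (auto simp: fsmf_feasible_def supp_def supported_def)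

lemma fsmf_obj_eq:
  assumes "A \<in> carrier_mat m n" "X \<in> carrier_mat m r" "Y \<in> carrier_mat n r"
  shows "fsmf_obj A (X, Y) = sq_err m n r (\<lambda>i j. A $$ (i, j)) (\<lambda>i k. X $$ (i, k)) (\<lambda>j k. Y $$ (j, k))"
proof -
  have "(A - X * transpose_mat Y) $$ (i, j) = A $$ (i, j) - prod_entry r (\<lambda>i k. X $$ (i, k)) (\<lambda>j
    k. Y $$ (j, k)) i j"
    if "i < m" "j < n" for i j
    using assms that by (simp add: prod_entry_def scalar_prod_def atLeast0LessThan)
  moreover have "0 \<le> (\<Sum>i<m. \<Sum>j<n. ((A - X * transpose_mat Y) $$ (i, j))\<^sup>2)"
    by (intro sum_nonneg zero_le_power2)
  ultimately show ?thesis
    using assms by (simp add: fsmf_obj_def frob_norm_def sq_err_def)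
qed

lemma fsmf_optimal_iff:
  assumes A: "A \<in> carrier_mat m n"
  shows "fsmf_optimal m n r A K L (X, Y) \<longleftrightarrow> X \<in> carrier_mat m r \<and> Y \<in> carrier_mat n r \<and>
    opt m n r K L (\<lambda>i j. A $$ (i, j)) (\<lambda>i k. X $$ (i, k)) (\<lambda>j k. Y $$ (j, k))"
proof
  assume L: "fsmf_optimal m n r A K L (X, Y)"
  then have f: "(X, Y) \<in> fsmf_feasible m n r K L" by (simp add: fsmf_optimal_def)
  then have c: "X \<in> carrier_mat m r" "Y \<in> carrier_mat n r" by (simp_all add: fsmf_feasible_iff)
  have "sq_err m n r (\<lambda>i j. A $$ (i, j)) (\<lambda>i k. X $$ (i, k)) (\<lambda>j k. Y $$ (j, k))
      \<le> sq_err m n r (\<lambda>i j. A $$ (i, j)) X' Y'"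
    if s: "supported m r K X'" "supported n r L Y'" for X' Y'
  proof -
    let ?X = "mat m r (\<lambda>(i, k). X' i k)" and ?Y = "mat n r (\<lambda>(i, k). Y' i k)"
    have "supported m r K (\<lambda>i k. ?X $$ (i, k))" "supported n r L (\<lambda>i k. ?Y $$ (i, k))"
      using s by (simp_all add: supported_def)
    then have "(?X, ?Y) \<in> fsmf_feasible m n r K L" by (simp add: fsmf_feasible_iff)
    then have "fsmf_obj A (X, Y) \<le> fsmf_obj A (?X, ?Y)"
      using L unfolding fsmf_optimal_def by blast
    also have "fsmf_obj A (?X, ?Y) = sq_err m n r (\<lambda>i j. A $$ (i, j)) X' Y'"
      unfolding fsmf_obj_eq[OF A mat_carrier mat_carrier] by (rule sq_err_cong) simp_all
    finally show ?thesis by (simp add: fsmf_obj_eq[OF A c])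
  qed
  then show "X \<in> carrier_mat m r \<and> Y \<in> carrier_mat n r \<and>
      opt m n r K L (\<lambda>i j. A $$ (i, j)) (\<lambda>i k. X $$ (i, k)) (\<lambda>j k. Y $$ (j, k))"
    using f by (simp add: fsmf_feasible_iff opt_def)
next
  assume R: "X \<in> carrier_mat m r \<and> Y \<in> carrier_mat n r \<and>
    opt m n r K L (\<lambda>i j. A $$ (i, j)) (\<lambda>i k. X $$ (i, k)) (\<lambda>j k. Y $$ (j, k))"
  show "fsmf_optimal m n r A K L (X, Y)"
    unfolding fsmf_optimal_def
  proof (intro conjI ballI)
    show "(X, Y) \<in> fsmf_feasible m n r K L" using R by (simp add: fsmf_feasible_iff opt_def)
    fix XY assume XY: "XY \<in> fsmf_feasible m n r K L"
    obtain X' Y' where XY': "XY = (X', Y')" by (cases XY)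
    show "fsmf_obj A (X, Y) \<le> fsmf_obj A XY"
      using R XY by (simp add: XY' fsmf_feasible_iff opt_def fsmf_obj_eq[OF A, where r = r])
  qed
qed

abbreviation input_facts ::
  "nat \<Rightarrow> nat \<Rightarrow> nat \<Rightarrow> (nat \<times> nat) set \<Rightarrow> (nat \<times> nat) set \<Rightarrow> (nat \<Rightarrow> nat \<Rightarrow> real) \<Rightarrow> array_facts" where
  "input_facts m n r I J A \<equiv> [(''A'', m, n, A), (''I'', m, r, \<lambda>i k. of_bool ((i, k) \<in> I)),
    (''J'', n, r, \<lambda>j k. of_bool ((j, k) \<in> J))]"

abbreviation solution_facts ::
  "nat \<Rightarrow> nat \<Rightarrow> nat \<Rightarrow> (nat \<Rightarrow> nat \<Rightarrow> real) \<Rightarrow> (nat \<Rightarrow> nat \<Rightarrow> real) \<Rightarrow> array_facts" where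
  "solution_facts m n r X Y \<equiv> [(''X'', m, r, X), (''Y'', n, r, Y)]"

abbreviation dims :: "nat \<Rightarrow> nat \<Rightarrow> nat \<Rightarrow> (name \<times> nat) list" where
  "dims m n r \<equiv> [(''m'', m), (''n'', n), (''r'', r)]"

lemma input_ok:
  assumes "A \<in> carrier_mat m n" "X \<in> carrier_mat m r" "Y \<in> carrier_mat n r"
  shows "ok (dims m n r) (solution_facts m n r (\<lambda>i k. X $$ (i, k)) (\<lambda>j k. Y $$ (j, k)) @
    input_facts m n r I J (\<lambda>i j. A $$ (i, j))) (input_of m n r A I J (X, Y))"
  using assms by (simp add: input_of_def write_mat_def)

lemma size_of_input: "size_of (input_of m n r A I J XY) = m + n + r"
  by (simp add: size_of_def input_of_def)

lemma output_optimal: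
  assumes "A \<in> carrier_mat m n" and "ok (dims m n r) (solution_facts m n r X Y) s"
    and "opt m n r K L (\<lambda>i j. A $$ (i, j)) X Y"
  shows "fsmf_optimal m n r A K L (output_of m n r s)"
proof -
  have "opt m n r K L (\<lambda>i j. A $$ (i, j)) (\<lambda>i k. read_mat ''X'' m r s $$ (i, k)) (\<lambda>j k. read_mat
    ''Y'' n r s $$ (j, k))"
  proof (rule iffD1[OF opt_cong assms(3)])
    show "X i k = read_mat ''X'' m r s $$ (i, k)" if "i < m" "k < r" for i k
      using assms(2) that by (simp add: read_mat_def)
    show "Y j k = read_mat ''Y'' n r s $$ (j, k)" if "j < n" "k < r" for j k
      using assms(2) that by (simp add: read_mat_def)
  qed simp
  then show ?thesis
    by (simp add: output_of_def fsmf_optimal_iff[OF assms(1)] read_mat_def)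
qed

text \<open>Separates a claim about a program into a syntactic check of its loop bounds, a
  description of the final arrays, and an optimality statement free of machine states.\<close>

lemma computes_withinI:
  assumes "size_bounded c" "A' \<in> carrier_mat m n"
    and "ok (dims m n r) (solution_facts m n r X Y) (exec \<O> c (input_of m n r A I J XY))"
    and "opt m n r K L (\<lambda>i j. A' $$ (i, j)) X Y"
  shows "computes_within \<O> c m n r (input_of m n r A I J XY) (poly (cost c) (m + n + r))
    (fsmf_optimal m n r A' K L)"
  using run_cost[OF assms(1), of \<O> "input_of m n r A I J XY"]
    output_optimal[OF assms(2-4)]
  by (simp add: computes_within_def size_of_input exec_def)

context reducible_instance begin

lemma restrict_mat_off_ST:
  assumes "A \<in> carrier_mat m n"
  shows "restrict_mat A (S_Tbar m n r I J) \<in> carrier_mat m n"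
    and "i < m \<Longrightarrow> j < n \<Longrightarrow> restrict_mat A (S_Tbar m n r I J) $$ (i, j) = off_ST (\<lambda>i j. A $$ (i, j)) i j"
  using assms by (auto simp: restrict_mat_def S_Tbar_def off_ST_def)

lemma opt_restrict_mat:
  assumes "A \<in> carrier_mat m n"
  shows "opt m n r K L (\<lambda>i j. restrict_mat A (S_Tbar m n r I J) $$ (i, j)) X Y \<longleftrightarrow>
    opt m n r K L (off_ST (\<lambda>i j. A $$ (i, j))) X Y"
  by (rule opt_cong) (simp_all add: restrict_mat_off_ST[OF assms])

text \<open>A reduced competitor lifts to a full one with the same error, so it cannot beat the full
  optimum, and masking that optimum does not increase its error. \<open>opt_full\<close> runs the
  same argument backwards.\<close>

lemma opt_red:
  assumes "opt m n r I J A X Y"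
  shows "opt m n r IR JC (off_ST A) (red_rows X) (red_cols Y)"
proof -
  have X: "supported m r I X" and Y: "supported n r J Y"
    and le: "\<And>X' Y'. supported m r I X' \<Longrightarrow> supported n r J Y' \<Longrightarrow> sq_err m n r A X Y \<le> sq_err m n r A X' Y'"
    using assms by (auto simp: opt_def)
  have "sq_err m n r (off_ST A) (red_rows X) (red_cols Y) \<le> sq_err m n r (off_ST A) X' Y'"
    if XY: "supported m r IR X'" "supported n r JC Y'" for X' Y'
    using sq_err_red[OF X Y, of A] le[OF supported_full[OF XY, of A]] sq_err_full[OF XY, of A] by simp
  then show ?thesis by (simp add: opt_def supported_red)
qed

lemma opt_full:
  assumes "opt m n r IR JC (off_ST A) X Y"
  shows "opt m n r I J A (full_rows A X) (full_cols A Y)"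
proof -
  have X: "supported m r IR X" and Y: "supported n r JC Y"
    and le: "\<And>X' Y'. supported m r IR X' \<Longrightarrow> supported n r JC Y' \<Longrightarrow>
      sq_err m n r (off_ST A) X Y \<le> sq_err m n r (off_ST A) X' Y'"
    using assms by (auto simp: opt_def)
  have "sq_err m n r A (full_rows A X) (full_cols A Y) \<le> sq_err m n r A X' Y'"
    if XY: "supported m r I X'" "supported n r J Y'" for X' Y'
    using sq_err_full[OF X Y, of A] le[OF supported_red(1)[of X'] supported_red(2)[of Y']]
      sq_err_red[OF XY, of A] by simp
  then show ?thesis by (simp add: opt_def supported_full[OF X Y])
qed

text \<open>Feasible pairs, not optimal ones, are carried over in both directions, so the argument
  does not rely on the infimum being attained.\<close>

lemma fsmf_inf_eq:
  assumes A: "A \<in> carrier_mat m n"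
  shows "fsmf_inf m n r A I J = fsmf_inf m n r (restrict_mat A (S_Tbar m n r I J)) IR JC"
proof -
  let ?A = "restrict_mat A (S_Tbar m n r I J)"
  have A': "?A \<in> carrier_mat m n" using A by (rule restrict_mat_off_ST)
  have obj': "fsmf_obj ?A (X, Y) = sq_err m n r (off_ST (\<lambda>i j. A $$ (i, j))) (\<lambda>i k. X $$ (i, k))
    (\<lambda>j k. Y $$ (j, k))"
    if "X \<in> carrier_mat m r" "Y \<in> carrier_mat n r" for X Y
    unfolding fsmf_obj_eq[OF A' that] by (rule sq_err_cong) (simp_all add: restrict_mat_off_ST[OF A])
  \<comment> \<open>\<open>INF\<close> on reals is meaningful only for nonempty sets bounded below,
    hence the bound 0 and, next, the feasible zero pair.\<close>
  have bdd: "bdd_below (fsmf_obj B ` Z)" for B Z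
    by (rule bdd_belowI[of _ 0]) (auto simp: fsmf_obj_def)
  have ne: "fsmf_feasible m n r K L \<noteq> {}" for K L
  proof -
    have "(0\<^sub>m m r, 0\<^sub>m n r) \<in> fsmf_feasible m n r K L"
      by (simp add: fsmf_feasible_iff supported_def)
    then show ?thesis by (metis empty_iff)
  qed
  have "fsmf_inf m n r A I J \<le> fsmf_inf m n r ?A IR JC"
    unfolding fsmf_inf_def
  proof (rule cINF_mono[OF ne bdd])
    fix XY assume XY: "XY \<in> fsmf_feasible m n r IR JC"
    obtain X Y where [simp]: "XY = (X, Y)" by (cases XY)
    let ?a = "\<lambda>i j. A $$ (i, j)"
    let ?x = "full_rows ?a (\<lambda>i k. X $$ (i, k))" and ?y = "full_cols ?a (\<lambda>j k. Y $$ (j, k))"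
    let ?X = "mat m r (\<lambda>(i, k). ?x i k)" and ?Y = "mat n r (\<lambda>(j, k). ?y j k)"
    have c: "X \<in> carrier_mat m r" "Y \<in> carrier_mat n r"
      and s: "supported m r IR (\<lambda>i k. X $$ (i, k))" "supported n r JC (\<lambda>j k. Y $$ (j, k))"
      using XY by (simp_all add: fsmf_feasible_iff)
    have "supported m r I (\<lambda>i k. ?X $$ (i, k))" "supported n r J (\<lambda>j k. ?Y $$ (j, k))"
      using supported_full[OF s, of ?a] by (simp_all add: supported_def)
    then have "(?X, ?Y) \<in> fsmf_feasible m n r I J" by (simp add: fsmf_feasible_iff)
    moreover have "fsmf_obj A (?X, ?Y) = sq_err m n r ?a ?x ?y"
      unfolding fsmf_obj_eq[OF A mat_carrier mat_carrier] by (rule sq_err_cong) simp_all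
    then have "fsmf_obj A (?X, ?Y) \<le> fsmf_obj ?A XY"
      using sq_err_full[OF s] obj'[OF c] by simp
    ultimately show "\<exists>XY'\<in>fsmf_feasible m n r I J. fsmf_obj A XY' \<le> fsmf_obj ?A XY" by (rule
      bexI[rotated])
  qed
  moreover have "fsmf_inf m n r ?A IR JC \<le> fsmf_inf m n r A I J"
    unfolding fsmf_inf_def
  proof (rule cINF_mono[OF ne bdd])
    fix XY assume XY: "XY \<in> fsmf_feasible m n r I J"
    obtain X Y where [simp]: "XY = (X, Y)" by (cases XY)
    let ?a = "\<lambda>i j. A $$ (i, j)"
    let ?x = "red_rows (\<lambda>i k. X $$ (i, k))" and ?y = "red_cols (\<lambda>j k. Y $$ (j, k))"
    let ?X = "mat m r (\<lambda>(i, k). ?x i k)" and ?Y = "mat n r (\<lambda>(j, k). ?y j k)"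
    have c: "X \<in> carrier_mat m r" "Y \<in> carrier_mat n r"
      and s: "supported m r I (\<lambda>i k. X $$ (i, k))" "supported n r J (\<lambda>j k. Y $$ (j, k))"
      using XY by (simp_all add: fsmf_feasible_iff)
    have "supported m r IR (\<lambda>i k. ?X $$ (i, k))" "supported n r JC (\<lambda>j k. ?Y $$ (j, k))"
      using supported_red by (simp_all add: supported_def)
    then have "(?X, ?Y) \<in> fsmf_feasible m n r IR JC" by (simp add: fsmf_feasible_iff)
    moreover have "fsmf_obj ?A (?X, ?Y) = sq_err m n r (off_ST ?a) ?x ?y"
      unfolding obj'[OF mat_carrier mat_carrier] by (rule sq_err_cong) simp_all
    then have "fsmf_obj ?A (?X, ?Y) \<le> fsmf_obj A XY"
      using sq_err_red[OF s] fsmf_obj_eq[OF A c] by simp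
    ultimately show "\<exists>XY'\<in>fsmf_feasible m n r IR JC. fsmf_obj ?A XY' \<le> fsmf_obj A XY" by (rule
      bexI[rotated])
  qed
  ultimately show ?thesis by (rule antisym)
qed

end

section \<open>Tables computed by the programs\<close>

abbreviation (input) cell :: "name \<Rightarrow> name \<Rightarrow> name \<Rightarrow> rexp" where
  "cell a x y \<equiv> Entry a (IVar x) (IVar y)"

abbreviation (input) cell0 :: "name \<Rightarrow> name \<Rightarrow> rexp" where
  "cell0 a x \<equiv> Entry a (IVar x) (IConst 0)"

definition always :: bexp where
  "always = BNot (ILess (IConst 0) (IConst 0))"

definition real_eq :: "rexp \<Rightarrow> rexp \<Rightarrow> bexp" where
  "real_eq e f = BAnd (BNot (RLess e f)) (BNot (RLess f e))"

definition pos_exp :: "rexp \<Rightarrow> bexp" where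
  "pos_exp e = RLess (RConst 0) e"

lemma bval_derived [simp]:
  "bval always s" "bval (real_eq e f) s \<longleftrightarrow> rval e s = rval f s" "bval (pos_exp e) s \<longleftrightarrow> 0 < rval e s"
  by (auto simp: always_def real_eq_def pos_exp_def)

primrec seqs :: "com list \<Rightarrow> com" where
  "seqs [] = Skip"
| "seqs (c # cs) = Seq c (seqs cs)"

lemma exec_seqs_append: "exec \<O> (seqs (cs @ ds)) s = exec \<O> (seqs ds) (exec \<O> (seqs cs) s)"
  by (induction cs arbitrary: s) auto

lemma size_bounded_seqs: "size_bounded (seqs cs) \<longleftrightarrow> list_all size_bounded cs"
  and svd_free_seqs: "svd_free (seqs cs) \<longleftrightarrow> list_all svd_free cs"
  by (induction cs) auto

lemma sum_of_bool_card:
  fixes p :: nat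
  assumes "\<And>k. Q k \<Longrightarrow> k < p"
  shows "(\<Sum>k<p. of_bool (Q k)) = real (card {k. Q k})"
proof -
  have "(\<Sum>k<p. of_bool (Q k)) = (\<Sum>k | Q k. 1 :: real)"
    by (rule sum.mono_neutral_cong_right) (use assms in auto)
  then show ?thesis by simp
qed

lemma sum_lessThan_one: "(\<Sum>k<1::nat. f k) = f 0"
  by (simp add: lessThan_Suc One_nat_def)

abbreviation (input) "vm \<equiv> IVar ''m''"
abbreviation (input) "vn \<equiv> IVar ''n''"
abbreviation (input) "vr \<equiv> IVar ''r''"
abbreviation (input) "vone \<equiv> IConst 1"

text \<open>The diagonal entries are the column sizes, which later tables read from here.\<close>

definition tab_row_inter :: com where
  "tab_row_inter = tab ''cI'' vr vr vm (always)
    (RMul (cell ''I'' ''k'' ''i'') (cell ''I'' ''k'' ''j''))"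

definition tab_col_inter :: com where
  "tab_col_inter = tab ''cJ'' vr vr vn (always)
    (RMul (cell ''J'' ''k'' ''i'') (cell ''J'' ''k'' ''j''))"

text \<open>Equality of supports is decided by comparing the sizes of \<open>\<S>\<^sub>i\<close> and \<open>\<S>\<^sub>j\<close> with that of their
  intersection.\<close>

definition tab_same_class :: com where
  "tab_same_class = tab ''E'' vr vr vone (BAnd (BNot (RLess (RMul (cell ''cI'' ''i'' ''j'') (cell
    ''cJ'' ''i'' ''j'')) (RMul (cell ''cI'' ''i'' ''i'') (cell ''cJ'' ''i'' ''i'')))) (BNot (RLess
    (RMul (cell ''cI'' ''i'' ''j'') (cell ''cJ'' ''i'' ''j'')) (RMul (cell ''cI'' ''j'' ''j'')
    (cell ''cJ'' ''j'' ''j'')))))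
    (RConst 1)"

definition tab_class_size :: com where
  "tab_class_size = tab ''P'' vr vone vr (always)
    (cell ''E'' ''i'' ''k'')"

definition tab_in_T :: com where
  "tab_in_T = tab ''T'' vr vone vone (BNot (BAnd (RLess (cell0 ''P'' ''i'') (cell ''cI'' ''i''
    ''i'')) (RLess (cell0 ''P'' ''i'') (cell ''cJ'' ''i'' ''i''))))
    (RConst 1)"

definition tab_cover :: com where
  "tab_cover = tab ''N'' vm vn vr (always)
    (RMul (cell0 ''T'' ''k'') (RMul (cell ''I'' ''i'' ''k'') (cell ''J'' ''j'' ''k'')))"

text \<open>\<open>tab\<close> reserves \<open>i\<close> and \<open>j\<close> for the table indices
  and \<open>k\<close> for the sum, so here \<open>j\<close> is the factor column and
  \<open>k\<close> the matrix column.\<close>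

definition tab_row_count :: com where
  "tab_row_count = tab ''RR'' vm vr vn (BNot (pos_exp (cell ''N'' ''i'' ''k'')))
    (RMul (RSub (RConst 1) (cell0 ''T'' ''j'')) (RMul (cell ''I'' ''i'' ''j'') (cell ''J'' ''k''
      ''j'')))"

definition tab_col_count :: com where
  "tab_col_count = tab ''CC'' vn vr vm (BNot (pos_exp (cell ''N'' ''k'' ''i'')))
    (RMul (RSub (RConst 1) (cell0 ''T'' ''j'')) (RMul (cell ''I'' ''k'' ''j'') (cell ''J'' ''i''
      ''j'')))"

definition tab_red_rows :: com where
  "tab_red_rows = tab ''W'' vm vr vone (pos_exp (cell ''RR'' ''i'' ''j''))
    (cell ''X'' ''i'' ''j'')"

definition tab_red_cols :: com where
  "tab_red_cols = tab ''Z'' vn vr vone (pos_exp (cell ''CC'' ''i'' ''j''))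
    (cell ''Y'' ''i'' ''j'')"

definition tab_row_rank :: com where
  "tab_row_rank = tab ''rI'' vm vr vm (ILess (IVar ''k'') (IVar ''i''))
    (cell ''I'' ''k'' ''j'')"

definition tab_col_rank :: com where
  "tab_col_rank = tab ''rJ'' vn vr vn (ILess (IVar ''k'') (IVar ''i''))
    (cell ''J'' ''k'' ''j'')"

definition tab_class_rank :: com where
  "tab_class_rank = tab ''Q'' vr vone vr (ILess (IVar ''k'') (IVar ''i''))
    (cell ''E'' ''i'' ''k'')"

definition tab_unit_rows :: com where
  "tab_unit_rows = tab ''UX'' vm vr vone (BAnd (BNot (RLess (cell0 ''P'' ''j'') (cell ''cI'' ''j''
    ''j''))) (real_eq (cell ''rI'' ''i'' ''j'') (cell0 ''Q'' ''j'')))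
    (RMul (cell0 ''T'' ''j'') (cell ''I'' ''i'' ''j''))"

definition tab_unit_cols :: com where
  "tab_unit_cols = tab ''UY'' vn vr vone (BAnd (RLess (cell0 ''P'' ''j'') (cell ''cI'' ''j''
    ''j'')) (real_eq (cell ''rJ'' ''i'' ''j'') (cell0 ''Q'' ''j'')))
    (RMul (cell0 ''T'' ''j'') (cell ''J'' ''i'' ''j''))"

definition tab_fill_rows :: com where
  "tab_fill_rows = tab ''FX'' vm vr vn (always)
    (RMul (cell ''I'' ''i'' ''j'') (RMul (cell ''UY'' ''k'' ''j'') (RDiv (RMul (cell ''A'' ''i''
      ''k'') (cell0 ''P'' ''j'')) (cell ''N'' ''i'' ''k''))))"

definition tab_fill_cols :: com where
  "tab_fill_cols = tab ''FY'' vn vr vm (always)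
    (RMul (cell ''J'' ''i'' ''j'') (RMul (cell ''UX'' ''k'' ''j'') (RDiv (RMul (cell ''A'' ''k''
      ''i'') (cell0 ''P'' ''j'')) (cell ''N'' ''k'' ''i''))))"

definition tab_full_rows :: com where
  "tab_full_rows = tab ''W'' vm vr vone (always)
    (RAdd (RAdd (cell ''X'' ''i'' ''j'') (cell ''UX'' ''i'' ''j'')) (cell ''FX'' ''i'' ''j''))"

definition tab_full_cols :: com where
  "tab_full_cols = tab ''Z'' vn vr vone (always)
    (RAdd (RAdd (cell ''Y'' ''i'' ''j'') (cell ''UY'' ''i'' ''j'')) (cell ''FY'' ''i'' ''j''))"

definition tab_row_overlap :: com where
  "tab_row_overlap = tab ''EI'' vr vr vm (always)
    (RMul (cell ''RR'' ''k'' ''i'') (cell ''RR'' ''k'' ''j''))"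

definition tab_col_overlap :: com where
  "tab_col_overlap = tab ''EJ'' vr vr vn (always)
    (RMul (cell ''CC'' ''k'' ''i'') (cell ''CC'' ''k'' ''j''))"

definition tab_pos :: com where
  "tab_pos = tab ''B'' vr vone vr (BAnd (ILess (IVar ''k'') (IVar ''i'')) (BAnd (pos_exp (cell
    ''EI'' ''k'' ''i'')) (pos_exp (cell ''EJ'' ''k'' ''i''))))
    (RConst 1)"

text \<open>Registers cannot be compared with array entries, so the indices are also stored as reals.\<close>

definition tab_index :: com where
  "tab_index = tab ''D'' vr vone vr (ILess (IVar ''k'') (IVar ''i''))
    (RConst 1)"

definition copy_rows :: "name \<Rightarrow> name \<Rightarrow> com" where
  "copy_rows a b = tab a vm vr vone always (cell b ''i'' ''j'')"

definition copy_cols :: "name \<Rightarrow> name \<Rightarrow> com" where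
  "copy_cols a b = tab a vn vr vone always (cell b ''i'' ''j'')"

lemmas table_defs = tab_row_inter_def tab_col_inter_def tab_same_class_def tab_class_size_def
  tab_in_T_def
  tab_cover_def tab_row_count_def tab_col_count_def tab_red_rows_def tab_red_cols_def
  tab_row_rank_def tab_col_rank_def tab_class_rank_def tab_unit_rows_def tab_unit_cols_def
  tab_fill_rows_def tab_fill_cols_def tab_full_rows_def tab_full_cols_def tab_row_overlap_def
  tab_col_overlap_def tab_pos_def tab_index_def copy_rows_def copy_cols_def

context reducible_instance begin

section \<open>Counts behind the tables\<close>

definition row_count :: "nat \<Rightarrow> nat \<Rightarrow> real" where
  "row_count i k = real (card {j. k \<in> Tb \<and> (i, j) \<in> Sp k})"

definition col_count :: "nat \<Rightarrow> nat \<Rightarrow> real" where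
  "col_count j k = real (card {i. k \<in> Tb \<and> (i, j) \<in> Sp k})"

definition row_overlap :: "nat \<Rightarrow> nat \<Rightarrow> real" where
  "row_overlap k l = (\<Sum>i<m. row_count i k * row_count i l)"

definition col_overlap :: "nat \<Rightarrow> nat \<Rightarrow> real" where
  "col_overlap k l = (\<Sum>j<n. col_count j k * col_count j l)"

text \<open>A guarded sum delivers an existential as a count; the programs use only its
  sign.\<close>

lemma row_count_pos: "0 < row_count i k \<longleftrightarrow> row_in i k"
proof -
  have "finite {j. k \<in> Tb \<and> (i, j) \<in> Sp k}"
    by (rule finite_subset[of _ "{..<n}"]) (auto simp: Sp_iff dest: J_bounds)
  then show ?thesis by (auto simp: row_count_def row_in_def card_gt_0_iff)
qed

lemma col_count_pos: "0 < col_count j k \<longleftrightarrow> col_in j k"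
proof -
  have "finite {i. k \<in> Tb \<and> (i, j) \<in> Sp k}"
    by (rule finite_subset[of _ "{..<m}"]) (auto simp: Sp_iff dest: I_bounds)
  then show ?thesis by (auto simp: col_count_def col_in_def card_gt_0_iff)
qed

lemma sum_prod_pos:
  fixes f g :: "nat \<Rightarrow> real"
  assumes "\<And>i. 0 \<le> f i" "\<And>i. 0 \<le> g i"
  shows "0 < (\<Sum>i<p. f i * g i) \<longleftrightarrow> (\<exists>i<p. 0 < f i \<and> 0 < g i)"
proof -
  have "(\<Sum>i<p. f i * g i) = 0 \<longleftrightarrow> (\<forall>i<p. f i * g i = 0)"
    using assms by (subst sum_nonneg_eq_0_iff) auto
  moreover have "0 \<le> (\<Sum>i<p. f i * g i)" using assms by (simp add: sum_nonneg)
  ultimately have "0 < (\<Sum>i<p. f i * g i) \<longleftrightarrow> \<not> (\<forall>i<p. f i * g i = 0)"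
    by (metis order_le_less order_less_irrefl)
  moreover have "f i * g i = 0 \<longleftrightarrow> \<not> (0 < f i \<and> 0 < g i)" for i
    using assms(1)[of i] assms(2)[of i] by auto
  ultimately show ?thesis by blast
qed

lemma overlap_pos:
  "0 < row_overlap k l \<longleftrightarrow> (\<exists>i. row_in i k \<and> row_in i l)"
  "0 < col_overlap k l \<longleftrightarrow> (\<exists>j. col_in j k \<and> col_in j l)"
proof -
  have "row_in i k \<Longrightarrow> i < m" "col_in j k \<Longrightarrow> j < n" for i j
    by (auto simp: row_in_def col_in_def Sp_iff dest: I_bounds J_bounds)
  moreover have "0 \<le> row_count i k" "0 \<le> col_count i k" for i k
    by (simp_all add: row_count_def col_count_def)
  ultimately show "0 < row_overlap k l \<longleftrightarrow> (\<exists>i. row_in i k \<and> row_in i l)"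
    "0 < col_overlap k l \<longleftrightarrow> (\<exists>j. col_in j k \<and> col_in j l)"
    by (auto simp: row_overlap_def col_overlap_def sum_prod_pos row_count_pos col_count_pos)
qed

lemma cover_pos: "0 < cover i j \<longleftrightarrow> (i, j) \<in> ST"
proof -
  have "finite {l \<in> T. (i, j) \<in> S l}"
    by (rule finite_subset[of _ "{..<r}"]) (auto dest: T_less)
  then show ?thesis by (auto simp: cover_card card_gt_0_iff ST_iff)
qed

text \<open>An intersection as large as two finite sets equals both. Comparing \<open>I\<close>- and
  \<open>J\<close>-columns separately would wrongly distinguish empty supports with different
  columns; the products of sizes do not.\<close>

lemma S_eq_iff:
  "S i = S j \<longleftrightarrow>
    \<not> real (card (column I i \<inter> column I j)) * real (card (column J i \<inter> column J j))
        < real (card (column I i)) * real (card (column J i)) \<and>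
    \<not> real (card (column I i \<inter> column I j)) * real (card (column J i \<inter> column J j))
        < real (card (column I j)) * real (card (column J j))"
proof -
  have card_S: "card (S k) = card (column I k) * card (column J k)" for k
    by (simp add: rank1_supp_def card_cartesian_product)
  have card_Int: "card (S i \<inter> S j) = card (column I i \<inter> column I j) * card (column J i \<inter> column J j)"
    by (simp add: rank1_supp_def Times_Int_Times card_cartesian_product)
  have fin: "finite (S k)" for k by (simp add: rank1_supp_def)
  have "S i = S j \<longleftrightarrow> card (S i) \<le> card (S i \<inter> S j) \<and> card (S j) \<le> card (S i \<inter> S j)"
  proof
    assume "card (S i) \<le> card (S i \<inter> S j) \<and> card (S j) \<le> card (S i \<inter> S j)"
    then have "S i \<inter> S j = S i" "S i \<inter> S j = S j"
      using card_seteq[OF fin Int_lower1] card_seteq[OF fin Int_lower2] by auto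
    then show "S i = S j" by simp
  qed simp
  then show ?thesis unfolding card_S card_Int not_less of_nat_mult[symmetric] of_nat_le_iff .
qed

abbreviation "fact_A A \<equiv> (''A'', m, n, A :: nat \<Rightarrow> nat \<Rightarrow> real)"
abbreviation "fact_I \<equiv> (''I'', m, r, \<lambda>i k. of_bool ((i, k) \<in> I) :: real)"
abbreviation "fact_J \<equiv> (''J'', n, r, \<lambda>j k. of_bool ((j, k) \<in> J) :: real)"
abbreviation "fact_X X \<equiv> (''X'', m, r, X :: nat \<Rightarrow> nat \<Rightarrow> real)"
abbreviation "fact_Y Y \<equiv> (''Y'', n, r, Y :: nat \<Rightarrow> nat \<Rightarrow> real)"
abbreviation "fact_row_inter \<equiv> (''cI'', r, r, (\<lambda>i j. real (card (column I i \<inter> column I j))) :: nat \<Rightarrow>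
  nat \<Rightarrow> real)"
abbreviation "fact_col_inter \<equiv> (''cJ'', r, r, (\<lambda>i j. real (card (column J i \<inter> column J j))) :: nat \<Rightarrow>
  nat \<Rightarrow> real)"
abbreviation "fact_same_class \<equiv> (''E'', r, r, (\<lambda>i j. of_bool (S i = S j)) :: nat \<Rightarrow> nat \<Rightarrow> real)"
abbreviation "fact_class_size \<equiv> (''P'', r, 1, (\<lambda>i j. real (card (cl i))) :: nat \<Rightarrow> nat \<Rightarrow> real)"
abbreviation "fact_in_T \<equiv> (''T'', r, 1, (\<lambda>i j. of_bool (i \<in> T)) :: nat \<Rightarrow> nat \<Rightarrow> real)"
abbreviation "fact_cover \<equiv> (''N'', m, n, (cover) :: nat \<Rightarrow> nat \<Rightarrow> real)"
abbreviation "fact_row_count \<equiv> (''RR'', m, r, (row_count) :: nat \<Rightarrow> nat \<Rightarrow> real)"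
abbreviation "fact_col_count \<equiv> (''CC'', n, r, (col_count) :: nat \<Rightarrow> nat \<Rightarrow> real)"
abbreviation "fact_red_rows X \<equiv> (''W'', m, r, (red_rows X) :: nat \<Rightarrow> nat \<Rightarrow> real)"
abbreviation "fact_red_cols Y \<equiv> (''Z'', n, r, (red_cols Y) :: nat \<Rightarrow> nat \<Rightarrow> real)"
abbreviation "fact_row_rank \<equiv> (''rI'', m, r, (\<lambda>i l. real (rk (column I l) i)) :: nat \<Rightarrow> nat \<Rightarrow> real)"
abbreviation "fact_col_rank \<equiv> (''rJ'', n, r, (\<lambda>j l. real (rk (column J l) j)) :: nat \<Rightarrow> nat \<Rightarrow> real)"
abbreviation "fact_class_rank \<equiv> (''Q'', r, 1, (\<lambda>l j. real (rk (cl l) l)) :: nat \<Rightarrow> nat \<Rightarrow> real)"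
abbreviation "fact_unit_rows \<equiv> (''UX'', m, r, (unit_rows) :: nat \<Rightarrow> nat \<Rightarrow> real)"
abbreviation "fact_unit_cols \<equiv> (''UY'', n, r, (unit_cols) :: nat \<Rightarrow> nat \<Rightarrow> real)"
abbreviation "fact_fill_rows A \<equiv> (''FX'', m, r, (fill_rows A) :: nat \<Rightarrow> nat \<Rightarrow> real)"
abbreviation "fact_fill_cols A \<equiv> (''FY'', n, r, (fill_cols A) :: nat \<Rightarrow> nat \<Rightarrow> real)"
abbreviation "fact_full_rows A X \<equiv> (''W'', m, r, (full_rows A X) :: nat \<Rightarrow> nat \<Rightarrow> real)"
abbreviation "fact_full_cols A Y \<equiv> (''Z'', n, r, (full_cols A Y) :: nat \<Rightarrow> nat \<Rightarrow> real)"
abbreviation "fact_row_overlap \<equiv> (''EI'', r, r, (row_overlap) :: nat \<Rightarrow> nat \<Rightarrow> real)"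
abbreviation "fact_col_overlap \<equiv> (''EJ'', r, r, (col_overlap) :: nat \<Rightarrow> nat \<Rightarrow> real)"
abbreviation "fact_pos \<equiv> (''B'', r, 1, (\<lambda>l j. real (pos l)) :: nat \<Rightarrow> nat \<Rightarrow> real)"
abbreviation "fact_index \<equiv> (''D'', r, 1, (\<lambda>i j. real i) :: nat \<Rightarrow> nat \<Rightarrow> real)"

section \<open>Correctness of the individual tables\<close>

lemma tab_row_inter_ok:
  assumes "ok (dims m n r) \<Gamma> s" "set [fact_I] \<subseteq> set \<Gamma>" "''cI'' \<notin> fst ` set \<Gamma>"
  shows "ok (dims m n r) (fact_row_inter # \<Gamma>) (exec \<O> tab_row_inter s)"
  unfolding tab_row_inter_def
proof (rule tab_ok[OF assms(1,2,3), where H = "\<lambda>i j k. of_bool ((k, i) \<in> I \<and> (k, j) \<in> I)"])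
  show "(\<lambda>i j. real (card (column I i \<inter> column I j))) i j = (\<Sum>k<m::nat. (\<lambda>i j k. of_bool ((k, i) \<in>
    I \<and> (k, j) \<in> I)) i j k)" if "i < r" "j < r" for i j
    by (subst sum_of_bool_card) (auto simp: column_def Int_def dest: I_bounds)
qed (auto simp: of_bool_conj)

lemma tab_col_inter_ok:
  assumes "ok (dims m n r) \<Gamma> s" "set [fact_J] \<subseteq> set \<Gamma>" "''cJ'' \<notin> fst ` set \<Gamma>"
  shows "ok (dims m n r) (fact_col_inter # \<Gamma>) (exec \<O> tab_col_inter s)"
  unfolding tab_col_inter_def
proof (rule tab_ok[OF assms(1,2,3), where H = "\<lambda>i j k. of_bool ((k, i) \<in> J \<and> (k, j) \<in> J)"])
  show "(\<lambda>i j. real (card (column J i \<inter> column J j))) i j = (\<Sum>k<n::nat. (\<lambda>i j k. of_bool ((k, i) \<in>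
    J \<and> (k, j) \<in> J)) i j k)" if "i < r" "j < r" for i j
    by (subst sum_of_bool_card) (auto simp: column_def Int_def dest: J_bounds)
qed (auto simp: of_bool_conj)

lemma tab_same_class_ok:
  assumes "ok (dims m n r) \<Gamma> s" "set [fact_row_inter, fact_col_inter] \<subseteq> set \<Gamma>" "''E'' \<notin> fst ` set \<Gamma>"
  shows "ok (dims m n r) (fact_same_class # \<Gamma>) (exec \<O> tab_same_class s)"
  unfolding tab_same_class_def
proof (rule tab_ok[OF assms(1,2,3), where H = "\<lambda>i j k. of_bool (S i = S j)"])
  show "(\<lambda>i j. of_bool (S i = S j)) i j = (\<Sum>k<1::nat. (\<lambda>i j k. of_bool (S i = S j)) i j k)" if "i
    < r" "j < r" for i j
    by (simp only: sum_lessThan_one)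
qed (auto simp: S_eq_iff)

lemma tab_class_size_ok:
  assumes "ok (dims m n r) \<Gamma> s" "set [fact_same_class] \<subseteq> set \<Gamma>" "''P'' \<notin> fst ` set \<Gamma>"
  shows "ok (dims m n r) (fact_class_size # \<Gamma>) (exec \<O> tab_class_size s)"
  unfolding tab_class_size_def
proof (rule tab_ok[OF assms(1,2,3), where H = "\<lambda>i j k. of_bool (S i = S k)"])
  show "(\<lambda>i j. real (card (cl i))) i j = (\<Sum>k<r::nat. (\<lambda>i j k. of_bool (S i = S k)) i j k)" if "i <
    r" "j < 1" for i j
    proof -
    have "(\<Sum>k<r. of_bool (S i = S k)) = (\<Sum>k<r. of_bool (k < r \<and> S k = S i) :: real)"
      by (intro sum.cong) auto
    also have "\<dots> = real (card {k. k < r \<and> S k = S i})" by (rule sum_of_bool_card) simp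
    finally show ?thesis by (simp only: cl_def)
  qed
qed (auto simp: of_bool_def)

lemma tab_in_T_ok:
  assumes "ok (dims m n r) \<Gamma> s" "set [fact_class_size, fact_row_inter, fact_col_inter] \<subseteq> set \<Gamma>"
    "''T'' \<notin> fst ` set \<Gamma>"
  shows "ok (dims m n r) (fact_in_T # \<Gamma>) (exec \<O> tab_in_T s)"
  unfolding tab_in_T_def
proof (rule tab_ok[OF assms(1,2,3), where H = "\<lambda>i j k. of_bool (i \<in> T)"])
  show "(\<lambda>i j. of_bool (i \<in> T)) i j = (\<Sum>k<1::nat. (\<lambda>i j k. of_bool (i \<in> T)) i j k)" if "i < r" "j
    < 1" for i j
    by (simp only: sum_lessThan_one)
qed (auto simp: T_iff min_le_iff_disj not_less de_Morgan_conj)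

lemma tab_cover_ok:
  assumes "ok (dims m n r) \<Gamma> s" "set [fact_in_T, fact_I, fact_J] \<subseteq> set \<Gamma>" "''N'' \<notin> fst ` set \<Gamma>"
  shows "ok (dims m n r) (fact_cover # \<Gamma>) (exec \<O> tab_cover s)"
  unfolding tab_cover_def
proof (rule tab_ok[OF assms(1,2,3), where H = "\<lambda>i j k. of_bool (k \<in> T) * (of_bool ((i, k) \<in> I) *
  of_bool ((j, k) \<in> J))"])
  show "(cover) i j = (\<Sum>k<r::nat. (\<lambda>i j k. of_bool (k \<in> T) * (of_bool ((i, k) \<in> I) * of_bool ((j,
    k) \<in> J))) i j k)" if "i < m" "j < n" for i j
    by (rule cover_def)
qed (auto simp: of_bool_def)

lemma tab_row_count_ok:
  assumes "ok (dims m n r) \<Gamma> s" "set [fact_cover, fact_in_T, fact_I, fact_J] \<subseteq> set \<Gamma>" "''RR'' \<notin>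
    fst ` set \<Gamma>"
  shows "ok (dims m n r) (fact_row_count # \<Gamma>) (exec \<O> tab_row_count s)"
  unfolding tab_row_count_def
proof (rule tab_ok[OF assms(1,2,3), where H = "\<lambda>i k j. of_bool (k \<in> Tb \<and> (i, j) \<in> Sp k)"])
  show "(row_count) i j = (\<Sum>k<n::nat. (\<lambda>i k j. of_bool (k \<in> Tb \<and> (i, j) \<in> Sp k)) i j k)" if "i <
    m" "j < r" for i j
    unfolding row_count_def by (subst sum_of_bool_card) (auto simp: Sp_iff dest: J_bounds)
qed (auto simp: cover_pos Sp_iff Tb_iff)

lemma tab_col_count_ok:
  assumes "ok (dims m n r) \<Gamma> s" "set [fact_cover, fact_in_T, fact_I, fact_J] \<subseteq> set \<Gamma>" "''CC'' \<notin>
    fst ` set \<Gamma>"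
  shows "ok (dims m n r) (fact_col_count # \<Gamma>) (exec \<O> tab_col_count s)"
  unfolding tab_col_count_def
proof (rule tab_ok[OF assms(1,2,3), where H = "\<lambda>j k i. of_bool (k \<in> Tb \<and> (i, j) \<in> Sp k)"])
  show "(col_count) i j = (\<Sum>k<m::nat. (\<lambda>j k i. of_bool (k \<in> Tb \<and> (i, j) \<in> Sp k)) i j k)" if "i <
    n" "j < r" for i j
    unfolding col_count_def by (subst sum_of_bool_card) (auto simp: Sp_iff dest: I_bounds)
qed (auto simp: cover_pos Sp_iff Tb_iff)

lemma tab_red_rows_ok:
  assumes "ok (dims m n r) \<Gamma> s" "set [fact_row_count, fact_X X] \<subseteq> set \<Gamma>" "''W'' \<notin> fst ` set \<Gamma>"
  shows "ok (dims m n r) (fact_red_rows X # \<Gamma>) (exec \<O> tab_red_rows s)"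
  unfolding tab_red_rows_def
proof (rule tab_ok[OF assms(1,2,3), where H = "\<lambda>i j k. red_rows X i j"])
  show "(red_rows X) i j = (\<Sum>k<1::nat. (\<lambda>i j k. red_rows X i j) i j k)" if "i < m" "j < r" for i j
    by (simp only: sum_lessThan_one)
qed (auto simp: row_count_pos red_rows_def)

lemma tab_red_cols_ok:
  assumes "ok (dims m n r) \<Gamma> s" "set [fact_col_count, fact_Y Y] \<subseteq> set \<Gamma>" "''Z'' \<notin> fst ` set \<Gamma>"
  shows "ok (dims m n r) (fact_red_cols Y # \<Gamma>) (exec \<O> tab_red_cols s)"
  unfolding tab_red_cols_def
proof (rule tab_ok[OF assms(1,2,3), where H = "\<lambda>i j k. red_cols Y i j"])
  show "(red_cols Y) i j = (\<Sum>k<1::nat. (\<lambda>i j k. red_cols Y i j) i j k)" if "i < n" "j < r" for i j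
    by (simp only: sum_lessThan_one)
qed (auto simp: col_count_pos red_cols_def)

lemma tab_row_rank_ok:
  assumes "ok (dims m n r) \<Gamma> s" "set [fact_I] \<subseteq> set \<Gamma>" "''rI'' \<notin> fst ` set \<Gamma>"
  shows "ok (dims m n r) (fact_row_rank # \<Gamma>) (exec \<O> tab_row_rank s)"
  unfolding tab_row_rank_def
proof (rule tab_ok[OF assms(1,2,3), where H = "\<lambda>i l k. of_bool ((k, l) \<in> I \<and> k < i)"])
  show "(\<lambda>i l. real (rk (column I l) i)) i j = (\<Sum>k<m::nat. (\<lambda>i l k. of_bool ((k, l) \<in> I \<and> k < i))
    i j k)" if "i < m" "j < r" for i j
    by (subst sum_of_bool_card) (auto simp: rk_def column_def dest: I_bounds)
qed (auto simp: of_bool_def)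

lemma tab_col_rank_ok:
  assumes "ok (dims m n r) \<Gamma> s" "set [fact_J] \<subseteq> set \<Gamma>" "''rJ'' \<notin> fst ` set \<Gamma>"
  shows "ok (dims m n r) (fact_col_rank # \<Gamma>) (exec \<O> tab_col_rank s)"
  unfolding tab_col_rank_def
proof (rule tab_ok[OF assms(1,2,3), where H = "\<lambda>j l k. of_bool ((k, l) \<in> J \<and> k < j)"])
  show "(\<lambda>j l. real (rk (column J l) j)) i j = (\<Sum>k<n::nat. (\<lambda>j l k. of_bool ((k, l) \<in> J \<and> k < j))
    i j k)" if "i < n" "j < r" for i j
    by (subst sum_of_bool_card) (auto simp: rk_def column_def dest: J_bounds)
qed (auto simp: of_bool_def)

lemma tab_class_rank_ok:
  assumes "ok (dims m n r) \<Gamma> s" "set [fact_same_class] \<subseteq> set \<Gamma>" "''Q'' \<notin> fst ` set \<Gamma>"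
  shows "ok (dims m n r) (fact_class_rank # \<Gamma>) (exec \<O> tab_class_rank s)"
  unfolding tab_class_rank_def
proof (rule tab_ok[OF assms(1,2,3), where H = "\<lambda>l j k. of_bool (k < l \<and> S l = S k)"])
  show "(\<lambda>l j. real (rk (cl l) l)) i j = (\<Sum>k<r::nat. (\<lambda>l j k. of_bool (k < l \<and> S l = S k)) i j k)"
    if "i < r" "j < 1" for i j
    proof -
    have "{k. k < i \<and> S i = S k} = {k \<in> cl i. k < i}" using that by (auto simp: cl_def)
    then show ?thesis using that by (subst sum_of_bool_card) (auto simp: rk_def)
  qed
qed (auto simp: of_bool_def)

lemma tab_unit_rows_ok:
  assumes "ok (dims m n r) \<Gamma> s" "set [fact_class_size, fact_row_inter, fact_row_rank,
    fact_class_rank, fact_in_T, fact_I] \<subseteq> set \<Gamma>" "''UX'' \<notin> fst ` set \<Gamma>"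
  shows "ok (dims m n r) (fact_unit_rows # \<Gamma>) (exec \<O> tab_unit_rows s)"
  unfolding tab_unit_rows_def
proof (rule tab_ok[OF assms(1,2,3), where H = "\<lambda>i j k. unit_rows i j"])
  show "(unit_rows) i j = (\<Sum>k<1::nat. (\<lambda>i j k. unit_rows i j) i j k)" if "i < m" "j < r" for i j
    by (simp only: sum_lessThan_one)
qed (auto simp: unit_rows_def row_mode_def not_less)

lemma tab_unit_cols_ok:
  assumes "ok (dims m n r) \<Gamma> s" "set [fact_class_size, fact_row_inter, fact_col_rank,
    fact_class_rank, fact_in_T, fact_J] \<subseteq> set \<Gamma>" "''UY'' \<notin> fst ` set \<Gamma>"
  shows "ok (dims m n r) (fact_unit_cols # \<Gamma>) (exec \<O> tab_unit_cols s)"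
  unfolding tab_unit_cols_def
proof (rule tab_ok[OF assms(1,2,3), where H = "\<lambda>i j k. unit_cols i j"])
  show "(unit_cols) i j = (\<Sum>k<1::nat. (\<lambda>i j k. unit_cols i j) i j k)" if "i < n" "j < r" for i j
    by (simp only: sum_lessThan_one)
qed (auto simp: unit_cols_def row_mode_def not_le)

lemma tab_fill_rows_ok:
  assumes "ok (dims m n r) \<Gamma> s" "set [fact_I, fact_unit_cols, fact_A A, fact_class_size,
    fact_cover] \<subseteq> set \<Gamma>" "''FX'' \<notin> fst ` set \<Gamma>"
  shows "ok (dims m n r) (fact_fill_rows A # \<Gamma>) (exec \<O> tab_fill_rows s)"
  unfolding tab_fill_rows_def
proof (rule tab_ok[OF assms(1,2,3), where H = "\<lambda>i l j. of_bool ((i, l) \<in> I) * (unit_cols j l * share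
  A i j l)"])
  show "(fill_rows A) i j = (\<Sum>k<n::nat. (\<lambda>i l j. of_bool ((i, l) \<in> I) * (unit_cols j l * share A i
    j l)) i j k)" if "i < m" "j < r" for i j
    by (rule fill_rows_def)
qed (auto simp: share_def)

lemma tab_fill_cols_ok:
  assumes "ok (dims m n r) \<Gamma> s" "set [fact_J, fact_unit_rows, fact_A A, fact_class_size,
    fact_cover] \<subseteq> set \<Gamma>" "''FY'' \<notin> fst ` set \<Gamma>"
  shows "ok (dims m n r) (fact_fill_cols A # \<Gamma>) (exec \<O> tab_fill_cols s)"
  unfolding tab_fill_cols_def
proof (rule tab_ok[OF assms(1,2,3), where H = "\<lambda>j l i. of_bool ((j, l) \<in> J) * (unit_rows i l * share
  A i j l)"])
  show "(fill_cols A) i j = (\<Sum>k<m::nat. (\<lambda>j l i. of_bool ((j, l) \<in> J) * (unit_rows i l * share A i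
    j l)) i j k)" if "i < n" "j < r" for i j
    by (rule fill_cols_def)
qed (auto simp: share_def)

lemma tab_full_rows_ok:
  assumes "ok (dims m n r) \<Gamma> s" "set [fact_X X, fact_unit_rows, fact_fill_rows A] \<subseteq> set \<Gamma>" "''W''
    \<notin> fst ` set \<Gamma>"
  shows "ok (dims m n r) (fact_full_rows A X # \<Gamma>) (exec \<O> tab_full_rows s)"
  unfolding tab_full_rows_def
proof (rule tab_ok[OF assms(1,2,3), where H = "\<lambda>i j k. full_rows A X i j"])
  show "(full_rows A X) i j = (\<Sum>k<1::nat. (\<lambda>i j k. full_rows A X i j) i j k)" if "i < m" "j < r" for i j
    by (simp only: sum_lessThan_one)
qed (auto simp: full_rows_def)

lemma tab_full_cols_ok:
  assumes "ok (dims m n r) \<Gamma> s" "set [fact_Y Y, fact_unit_cols, fact_fill_cols A] \<subseteq> set \<Gamma>" "''Z''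
    \<notin> fst ` set \<Gamma>"
  shows "ok (dims m n r) (fact_full_cols A Y # \<Gamma>) (exec \<O> tab_full_cols s)"
  unfolding tab_full_cols_def
proof (rule tab_ok[OF assms(1,2,3), where H = "\<lambda>i j k. full_cols A Y i j"])
  show "(full_cols A Y) i j = (\<Sum>k<1::nat. (\<lambda>i j k. full_cols A Y i j) i j k)" if "i < n" "j < r" for i j
    by (simp only: sum_lessThan_one)
qed (auto simp: full_cols_def)

lemma tab_row_overlap_ok:
  assumes "ok (dims m n r) \<Gamma> s" "set [fact_row_count] \<subseteq> set \<Gamma>" "''EI'' \<notin> fst ` set \<Gamma>"
  shows "ok (dims m n r) (fact_row_overlap # \<Gamma>) (exec \<O> tab_row_overlap s)"
  unfolding tab_row_overlap_def
proof (rule tab_ok[OF assms(1,2,3), where H = "\<lambda>i j k. row_count k i * row_count k j"])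
  show "(row_overlap) i j = (\<Sum>k<m::nat. (\<lambda>i j k. row_count k i * row_count k j) i j k)" if "i < r"
    "j < r" for i j
    by (rule row_overlap_def)
qed (auto simp: of_bool_def)

lemma tab_col_overlap_ok:
  assumes "ok (dims m n r) \<Gamma> s" "set [fact_col_count] \<subseteq> set \<Gamma>" "''EJ'' \<notin> fst ` set \<Gamma>"
  shows "ok (dims m n r) (fact_col_overlap # \<Gamma>) (exec \<O> tab_col_overlap s)"
  unfolding tab_col_overlap_def
proof (rule tab_ok[OF assms(1,2,3), where H = "\<lambda>i j k. col_count k i * col_count k j"])
  show "(col_overlap) i j = (\<Sum>k<n::nat. (\<lambda>i j k. col_count k i * col_count k j) i j k)" if "i < r"
    "j < r" for i j
    by (rule col_overlap_def)
qed (auto simp: of_bool_def)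

lemma tab_pos_ok:
  assumes "ok (dims m n r) \<Gamma> s" "set [fact_row_overlap, fact_col_overlap] \<subseteq> set \<Gamma>" "''B'' \<notin> fst ` set \<Gamma>"
  shows "ok (dims m n r) (fact_pos # \<Gamma>) (exec \<O> tab_pos s)"
  unfolding tab_pos_def
proof (rule tab_ok[OF assms(1,2,3), where H = "\<lambda>l j k. of_bool (k < r \<and> k < l \<and> (\<exists>i j. row_in i k \<and>
  row_in i l \<and> col_in j k \<and> col_in j l))"])
  show "(\<lambda>l j. real (pos l)) i j = (\<Sum>k<r::nat. (\<lambda>l j k. of_bool (k < r \<and> k < l \<and> (\<exists>i j. row_in i k
    \<and> row_in i l \<and> col_in j k \<and> col_in j l))) i j k)" if "i < r" "j < 1" for i j
    unfolding pos_def by (subst sum_of_bool_card) auto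
qed (auto simp: overlap_pos)

lemma tab_index_ok:
  assumes "ok (dims m n r) \<Gamma> s" "set [] \<subseteq> set \<Gamma>" "''D'' \<notin> fst ` set \<Gamma>"
  shows "ok (dims m n r) (fact_index # \<Gamma>) (exec \<O> tab_index s)"
  unfolding tab_index_def
proof (rule tab_ok[OF assms(1,2,3), where H = "\<lambda>i j k. of_bool (k < i)"])
  show "(\<lambda>i j. real i) i j = (\<Sum>k<r::nat. (\<lambda>i j k. of_bool (k < i)) i j k)" if "i < r" "j < 1" for i j
    using that by (subst sum_of_bool_card) auto
qed (auto simp: of_bool_def)

end

section \<open>Reduction, reconstruction and solution programs\<close>

definition analysis :: "com list" where
  "analysis = [tab_row_inter, tab_col_inter, tab_same_class, tab_class_size, tab_in_T, tab_cover]"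

definition reduce_prog :: com where
  "reduce_prog = seqs (analysis @ [tab_row_count, tab_col_count, tab_red_rows, tab_red_cols,
    copy_rows ''X'' ''W'', copy_cols ''Y'' ''Z''])"

definition fill_prog :: com where
  "fill_prog = seqs (analysis @ [tab_row_rank, tab_col_rank, tab_class_rank, tab_unit_rows,
    tab_unit_cols,
    tab_fill_rows, tab_fill_cols, tab_full_rows, tab_full_cols,
    copy_rows ''X'' ''W'', copy_cols ''Y'' ''Z''])"

definition mask_block :: com where
  "mask_block = tab ''M'' vm vn vone
    (BAnd (pos_exp (cell ''RR'' ''i'' ''l'')) (pos_exp (cell ''CC'' ''j'' ''l''))) (cell ''A''
      ''i'' ''j'')"

text \<open>An array entry cannot serve as an index, so \<open>pos l\<close> is located by scanning
  \<open>k < r\<close> and comparing reals. The two register tests say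
  \<open>k < min m n\<close>.\<close>

definition pick_index :: bexp where
  "pick_index = BAnd (real_eq (cell0 ''B'' ''l'') (cell0 ''D'' ''k''))
    (BAnd (ILess (IVar ''k'') vm) (ILess (IVar ''k'') vn))"

definition pick_rows :: com where
  "pick_rows = tabcol ''X'' (IVar ''l'') vm vr (BAnd (pos_exp (cell ''RR'' ''i'' ''l'')) pick_index)
    (RMul (cell0 ''z'' ''k'') (cell ''U'' ''i'' ''k''))"

definition pick_cols :: com where
  "pick_cols = tabcol ''Y'' (IVar ''l'') vn vr (BAnd (pos_exp (cell ''CC'' ''i'' ''l'')) pick_index)
    (cell ''V'' ''i'' ''k'')"

text \<open>Each column decomposes its own block anew, at full size with zeros outside. The oracle is a
  function of the matrix, so all columns of a block see the same decomposition.\<close>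

definition block_svds :: com where
  "block_svds = For ''l'' vr (seqs [mask_block, SVD ''M'' vm vn ''U'' ''z'' ''V'', pick_rows,
    pick_cols])"

text \<open>\<open>block_svds\<close> leaves an optimal reduced solution in \<open>''X''\<close> and
  \<open>''Y''\<close>, which \<open>fill_prog\<close> treats as its input. The analysis is computed
  a second time so that \<open>fill_ok\<close> applies as it stands.\<close>

definition solve_prog :: com where
  "solve_prog = Seq (seqs (analysis @ [tab_row_count, tab_col_count, tab_row_overlap, tab_col_overlap,
    tab_pos, tab_index, block_svds])) fill_prog"

lemmas prog_defs = reduce_prog_def fill_prog_def solve_prog_def analysis_def mask_block_def
  pick_index_def pick_rows_def pick_cols_def block_svds_def table_defs tab_def tabcol_def

lemma size_bounded_progs: "size_bounded reduce_prog" "size_bounded fill_prog" "size_bounded solve_prog"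
  by (simp_all add: prog_defs size_bounded_seqs size_exps_def)

lemma svd_free_progs: "svd_free reduce_prog" "svd_free fill_prog"
  by (simp_all add: prog_defs svd_free_seqs)

context reducible_instance begin

lemma copy_rows_ok:
  assumes "ok (dims m n r) \<Gamma> s" "set [(b, m, r, F)] \<subseteq> set \<Gamma>" "a \<notin> fst ` set \<Gamma>"
  shows "ok (dims m n r) ((a, m, r, F) # \<Gamma>) (exec \<O> (copy_rows a b) s)"
  unfolding copy_rows_def
  by (rule tab_ok[OF assms, where H = "\<lambda>i j k. F i j"]) (auto simp: sum_lessThan_one)

lemma copy_cols_ok:
  assumes "ok (dims m n r) \<Gamma> s" "set [(b, n, r, F)] \<subseteq> set \<Gamma>" "a \<notin> fst ` set \<Gamma>"
  shows "ok (dims m n r) ((a, n, r, F) # \<Gamma>) (exec \<O> (copy_cols a b) s)"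
  unfolding copy_cols_def
  by (rule tab_ok[OF assms, where H = "\<lambda>i j k. F i j"]) (auto simp: sum_lessThan_one)

abbreviation inputs where "inputs A X Y \<equiv> solution_facts m n r X Y @ input_facts m n r I J A"

lemma analysis_ok:
  assumes "ok (dims m n r) (inputs A X Y) s"
  shows "ok (dims m n r) ([fact_cover, fact_in_T, fact_class_size, fact_same_class, fact_col_inter,
    fact_row_inter] @ inputs A X Y) (exec \<O> (seqs analysis) s)"
  unfolding analysis_def seqs.simps exec_simps append.simps
  by (rule tab_row_inter_ok tab_col_inter_ok tab_same_class_ok tab_class_size_ok tab_in_T_ok
      tab_cover_ok assms[unfolded append.simps] | (simp; fail))+

text \<open>\<open>tab\<close> zeroes an entry before accumulating into it, so results that depend
  on \<open>''X''\<close> and \<open>''Y''\<close> are built in \<open>''W''\<close> and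
  \<open>''Z''\<close> and copied back.\<close>

lemma copy_solution_ok:
  assumes "ok (dims m n r) \<Gamma> s" "set [(''W'', m, r, F), (''Z'', n, r, G)] \<subseteq> set \<Gamma>"
  shows "ok (dims m n r) (solution_facts m n r F G)
    (exec \<O> (seqs [copy_rows ''X'' ''W'', copy_cols ''Y'' ''Z'']) s)"
proof -
  \<comment> \<open>The facts on the old \<open>''X''\<close> and \<open>''Y''\<close> are dropped:
    a table may only be written to a name absent from the known facts.\<close>
  have "ok (dims m n r) [(''W'', m, r, F), (''Z'', n, r, G)] s"
    using assms(1) subset_refl assms(2) by (rule ok_mono)
  then have "ok (dims m n r) [(''Y'', n, r, G), (''X'', m, r, F), (''W'', m, r, F), (''Z'', n, r, G)]
      (exec \<O> (seqs [copy_rows ''X'' ''W'', copy_cols ''Y'' ''Z'']) s)"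
    unfolding seqs.simps exec_simps by (intro copy_rows_ok copy_cols_ok) simp_all
  then show ?thesis by (rule ok_mono) auto
qed

lemma reduce_ok:
  assumes "ok (dims m n r) (inputs A X Y) s"
  shows "ok (dims m n r) (solution_facts m n r (red_rows X) (red_cols Y)) (exec \<O> reduce_prog s)"
proof -
  have *: "reduce_prog = seqs ((analysis @ [tab_row_count, tab_col_count, tab_red_rows, tab_red_cols]) @
      [copy_rows ''X'' ''W'', copy_cols ''Y'' ''Z''])"
    by (simp add: reduce_prog_def)
  have "ok (dims m n r) ([fact_red_cols Y, fact_red_rows X, fact_col_count, fact_row_count,
      fact_cover, fact_in_T, fact_class_size, fact_same_class, fact_col_inter, fact_row_inter]
        @ inputs A X Y)
    (exec \<O> (seqs (analysis @ [tab_row_count, tab_col_count, tab_red_rows, tab_red_cols])) s)"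
    unfolding exec_seqs_append seqs.simps exec_simps append.simps
    by (rule tab_row_count_ok tab_col_count_ok tab_red_rows_ok tab_red_cols_ok
        analysis_ok[OF assms, unfolded append.simps] | (simp; fail))+
  then show ?thesis unfolding * exec_seqs_append[of _ "_ @ _"] by (rule copy_solution_ok) simp
qed

lemma fill_ok:
  assumes "ok (dims m n r) (inputs A X Y) s"
  shows "ok (dims m n r) (solution_facts m n r (full_rows A X) (full_cols A Y)) (exec \<O> fill_prog s)"
proof -
  let ?cs = "[tab_row_rank, tab_col_rank, tab_class_rank, tab_unit_rows, tab_unit_cols,
    tab_fill_rows, tab_fill_cols, tab_full_rows, tab_full_cols]"
  have *: "fill_prog = seqs ((analysis @ ?cs) @ [copy_rows ''X'' ''W'', copy_cols ''Y'' ''Z''])"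
    by (simp add: fill_prog_def)
  have "ok (dims m n r) ([fact_full_cols A Y, fact_full_rows A X, fact_fill_cols A, fact_fill_rows A,
      fact_unit_cols, fact_unit_rows, fact_class_rank, fact_col_rank, fact_row_rank,
      fact_cover, fact_in_T, fact_class_size, fact_same_class, fact_col_inter, fact_row_inter]
        @ inputs A X Y)
    (exec \<O> (seqs (analysis @ ?cs)) s)"
    unfolding exec_seqs_append seqs.simps exec_simps append.simps
    by (rule tab_row_rank_ok tab_col_rank_ok tab_class_rank_ok tab_unit_rows_ok tab_unit_cols_ok
        tab_fill_rows_ok tab_fill_cols_ok tab_full_rows_ok tab_full_cols_ok
        analysis_ok[OF assms, unfolded append.simps] | (simp; fail))+
  then show ?thesis unfolding * exec_seqs_append[of _ "_ @ _"] by (rule copy_solution_ok) simp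
qed

section \<open>Truncated decompositions in the solution program\<close>

definition block_svd :: "svd_oracle \<Rightarrow> (nat \<Rightarrow> nat \<Rightarrow> real) \<Rightarrow> nat \<Rightarrow> real mat \<times> real vec \<times> real mat" where
  "block_svd \<O> A l = \<O> (mat m n (\<lambda>(i, j). masked A l i j))"

definition block_U :: "svd_oracle \<Rightarrow> (nat \<Rightarrow> nat \<Rightarrow> real) \<Rightarrow> nat \<Rightarrow> nat \<Rightarrow> nat \<Rightarrow> real" where
  "block_U \<O> A l i t = fst (block_svd \<O> A l) $$ (i, t)"

definition block_s :: "svd_oracle \<Rightarrow> (nat \<Rightarrow> nat \<Rightarrow> real) \<Rightarrow> nat \<Rightarrow> nat \<Rightarrow> real" where
  "block_s \<O> A l t = fst (snd (block_svd \<O> A l)) $ t"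

definition block_V :: "svd_oracle \<Rightarrow> (nat \<Rightarrow> nat \<Rightarrow> real) \<Rightarrow> nat \<Rightarrow> nat \<Rightarrow> nat \<Rightarrow> real" where
  "block_V \<O> A l j t = snd (snd (block_svd \<O> A l)) $$ (j, t)"

lemma opt_svd:
  assumes "valid_svd_oracle \<O>"
  shows "opt m n r IR JC (off_ST A) (svd_rows (block_s \<O> A) (block_U \<O> A)) (svd_cols (block_V \<O> A))"
proof -
  have svd: "is_svd (mat m n (\<lambda>(i, j). masked A l i j)) (fst (block_svd \<O> A l),
      fst (snd (block_svd \<O> A l)), snd (snd (block_svd \<O> A l)))" for l
    using assms by (simp add: valid_svd_oracle_def block_svd_def)
  note s = svd_orthonormal[OF svd mat_carrier, folded block_U_def block_s_def block_V_def]
  have masked: "masked A l i j = (\<Sum>t<min m n. block_s \<O> A l t * block_U \<O> A l i t * block_V \<O> A l j t)"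
    if "i < m" "j < n" for l i j
    using s(5)[OF that, of l] that by simp
  have cong: "block_s \<O> A k = block_s \<O> A l \<and> block_U \<O> A k = block_U \<O> A l \<and> block_V \<O> A k =
    block_V \<O> A l"
    if "k \<in> Tb" "l \<in> Tb" "Sp k = Sp l" for k l
  proof -
    have "masked A k = masked A l"
      using that by (intro ext) (simp add: masked_def row_col_in)
    then have "block_svd \<O> A k = block_svd \<O> A l" by (simp add: block_svd_def)
    then show ?thesis by (simp add: fun_eq_iff block_s_def block_U_def block_V_def)
  qed
  show ?thesis
    unfolding opt_def
    by (intro conjI supported_svd allI impI svd_optimal cong s(1-4) masked)
qed

lemma pos_less: "l < r \<Longrightarrow> pos l < r"
proof -
  assume "l < r"
  have "pos l \<le> card {..<l}" unfolding pos_def by (intro card_mono) auto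
  with \<open>l < r\<close> show ?thesis by simp
qed

text \<open>By \<open>pos_less\<close> the scan over \<open>k < r\<close> meets
  \<open>k = pos l\<close> exactly once; the guard has the shape tested by
  \<open>pick_rows\<close>.\<close>

lemma svd_rows_sum:
  assumes "l < r"
  shows "svd_rows s U i l = (\<Sum>k<r. if row_in i l \<and> pos l = k \<and> k < m \<and> k < n then s l k * U l i k
    else 0)"
proof -
  have "(\<Sum>k<r. if row_in i l \<and> pos l = k \<and> k < m \<and> k < n then s l k * U l i k else 0)
      = (\<Sum>k<r. if pos l = k then svd_rows s U i l else 0)"
    by (intro sum.cong) (auto simp: svd_rows_def)
  then show ?thesis using pos_less[OF assms] by simp
qed

lemma svd_cols_sum:
  assumes "l < r"
  shows "svd_cols V j l = (\<Sum>k<r. if col_in j l \<and> pos l = k \<and> k < m \<and> k < n then V l j k else 0)"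
proof -
  have "(\<Sum>k<r. if col_in j l \<and> pos l = k \<and> k < m \<and> k < n then V l j k else 0)
      = (\<Sum>k<r. if pos l = k then svd_cols V j l else 0)"
    by (intro sum.cong) (auto simp: svd_cols_def)
  then show ?thesis using pos_less[OF assms] by simp
qed

lemma block_svds_ok:
  assumes valid: "valid_svd_oracle \<O>"
    and ok: "ok (dims m n r) ([fact_index, fact_pos, fact_col_count, fact_row_count] @
      input_facts m n r I J A) s"
  shows "ok (dims m n r) (inputs A (svd_rows (block_s \<O> A) (block_U \<O> A)) (svd_cols (block_V \<O> A)))
    (exec \<O> block_svds s)"
proof -
  let ?G = "[fact_index, fact_pos, fact_col_count, fact_row_count] @ input_facts m n r I J A"
  let ?X = "svd_rows (block_s \<O> A) (block_U \<O> A)" and ?Y = "svd_cols (block_V \<O> A)"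
  \<comment> \<open>After \<open>l\<close> passes the first \<open>l\<close> columns of both factors
    are final. The mask and its decomposition stay outside the invariant, since each pass overwrites
    them.\<close>
  let ?P = "\<lambda>l. ok (dims m n r) ([(''X'', m, l, ?X), (''Y'', n, l, ?Y)] @ ?G)"
  have "?P r (exec \<O> block_svds s)"
    unfolding block_svds_def
  proof (rule exec_For_inv[where P = ?P])
    show "ival vr s = r" "?P 0 s" using ok by simp_all
    fix l t assume l: "l < r" and P: "?P l t"
    let ?R = "(''l'', l) # dims m n r"
    let ?M = "(''M'', m, n, masked A l)"
    let ?S = "[(''U'', m, min m n, block_U \<O> A l), (''z'', min m n, 1, \<lambda>t _. block_s \<O> A l t),
      (''V'', n, min m n, block_V \<O> A l)]"
    define t0 where "t0 = set_reg ''l'' l t"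
    define t1 where "t1 = exec \<O> mask_block t0"
    define t2 where "t2 = exec \<O> (SVD ''M'' vm vn ''U'' ''z'' ''V'') t1"
    define t3 where "t3 = exec \<O> pick_rows t2"
    define t4 where "t4 = exec \<O> pick_cols t3"
    have "ok (dims m n r) ([(''X'', m, l, ?X), (''Y'', n, l, ?Y)] @ ?G) t0"
      using P by (simp add: t0_def)
    then have ok0: "ok ?R ([(''X'', m, l, ?X), (''Y'', n, l, ?Y)] @ ?G) t0" by (simp add: t0_def)
    have ok1: "ok ?R (?M # [(''X'', m, l, ?X), (''Y'', n, l, ?Y)] @ ?G) t1"
      unfolding t1_def mask_block_def
    proof (rule tab_ok[OF ok0, where \<Delta> = "[fact_row_count, fact_col_count, fact_A A]" and H =
      "\<lambda>i j k. masked A l i j"])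
      show "masked A l i j = (\<Sum>k<1::nat. masked A l i j)" if "i < m" "j < n" for i j
        by (simp only: sum_lessThan_one)
    qed (auto simp: masked_def row_count_pos col_count_pos l)
    have ok2: "ok ?R (?S @ ?M # [(''X'', m, l, ?X), (''Y'', n, l, ?Y)] @ ?G) t2"
      using svd_ok[OF ok1, of "''M''" m n "masked A l" "''U''" "''z''" "''V''" vm vn \<O>
          "fst (block_svd \<O> A l)" "fst (snd (block_svd \<O> A l))" "snd (snd (block_svd \<O> A l))"] valid ok1
      unfolding t2_def block_U_def block_s_def block_V_def by (simp add: block_svd_def)
    \<comment> \<open>\<open>tabcol_ok\<close> wants its target at the head of the facts and nowhere
      else, hence the reordering.\<close>
    have "ok ?R ((''X'', m, l, ?X) # ?S @ (''Y'', n, l, ?Y) # ?G) t2"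
      by (rule ok_mono[OF ok2]) auto
    then have ok3: "ok ?R ((''X'', m, Suc l, ?X) # ?S @ (''Y'', n, l, ?Y) # ?G) t3"
      unfolding t3_def pick_rows_def
    proof (rule tabcol_ok)
      show "?X i l = (\<Sum>k<r. if row_in i l \<and> pos l = k \<and> k < m \<and> k < n then block_s \<O> A l k *
        block_U \<O> A l i k else 0)" for i
        by (rule svd_rows_sum[OF l])
    qed (auto simp: pick_index_def row_count_pos l)
    have "ok ?R ((''Y'', n, l, ?Y) # ?S @ (''X'', m, Suc l, ?X) # ?G) t3"
      by (rule ok_mono[OF ok3]) auto
    then have ok4: "ok ?R ((''Y'', n, Suc l, ?Y) # ?S @ (''X'', m, Suc l, ?X) # ?G) t4"
      unfolding t4_def pick_cols_def
    proof (rule tabcol_ok)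
      show "?Y j l = (\<Sum>k<r. if col_in j l \<and> pos l = k \<and> k < m \<and> k < n then block_V \<O> A l j k
        else 0)" for j
        by (rule svd_cols_sum[OF l])
    qed (auto simp: pick_index_def col_count_pos l)
    have "?P (Suc l) t4" by (rule ok_mono[OF ok4]) auto
    then show "?P (Suc l) (exec \<O> (seqs [mask_block, SVD ''M'' vm vn ''U'' ''z'' ''V'',
      pick_rows, pick_cols]) (set_reg ''l'' l t))"
      by (simp only: seqs.simps exec_simps t4_def t3_def t2_def t1_def t0_def)
  qed
  then show ?thesis by (rule ok_mono) auto
qed

lemma solve_ok:
  assumes valid: "valid_svd_oracle \<O>" and ok: "ok (dims m n r) (inputs A X Y) s"
  shows "ok (dims m n r) (solution_facts m n r
    (full_rows A (svd_rows (block_s \<O> A) (block_U \<O> A))) (full_cols A (svd_cols (block_V \<O> A))))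
    (exec \<O> solve_prog s)"
proof -
  let ?cs = "[tab_row_count, tab_col_count, tab_row_overlap, tab_col_overlap, tab_pos, tab_index]"
  have *: "analysis @ [tab_row_count, tab_col_count, tab_row_overlap, tab_col_overlap, tab_pos,
    tab_index, block_svds]
      = (analysis @ ?cs) @ [block_svds]"
    by simp
  have "ok (dims m n r) ([fact_index, fact_pos, fact_col_overlap, fact_row_overlap,
    fact_col_count, fact_row_count,
      fact_cover, fact_in_T, fact_class_size, fact_same_class, fact_col_inter, fact_row_inter]
        @ inputs A X Y)
    (exec \<O> (seqs (analysis @ ?cs)) s)"
    unfolding exec_seqs_append seqs.simps exec_simps append.simps
    by (rule tab_row_count_ok tab_col_count_ok tab_row_overlap_ok tab_col_overlap_ok tab_pos_ok
      tab_index_ok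
        analysis_ok[OF ok, unfolded append.simps] | (simp; fail))+
  then have "ok (dims m n r) ([fact_index, fact_pos, fact_col_count, fact_row_count] @ input_facts
    m n r I J A)
    (exec \<O> (seqs (analysis @ ?cs)) s)"
    by (rule ok_mono) auto
  from block_svds_ok[OF valid this] show ?thesis
    unfolding solve_prog_def * exec_simps exec_seqs_append[of _ "_ @ _"] seqs.simps
    by (rule fill_ok)
qed

end

lemma fsmf_optimal_carrier:
  assumes "fsmf_optimal m n r A K L XY"
  obtains X Y where "XY = (X, Y)" "X \<in> carrier_mat m r" "Y \<in> carrier_mat n r"
  using assms by (cases XY) (auto simp: fsmf_optimal_def fsmf_feasible_iff)

theorem theorem3p8:
  shows
    "(\<forall>m n r I J R C. reducible m n r I J R C \<longrightarrow>
        disjoint_family_on (class_supp (I1 r I J R) (J1 r I J C))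
          (supp_classes r (I1 r I J R) (J1 r I J C)))
   \<and> (\<forall>m n r I J R C A. reducible m n r I J R C \<longrightarrow> A \<in> carrier_mat m n \<longrightarrow>
        fsmf_inf m n r A I J =
        fsmf_inf m n r (restrict_mat A (S_Tbar m n r I J)) (I1 r I J R) (J1 r I J C))
   \<and> (\<exists>(c :: com) (p :: nat poly). svd_free c \<and>
        (\<forall>\<O> m n r I J R C A XY. reducible m n r I J R C \<longrightarrow> A \<in> carrier_mat m n \<longrightarrow>
          fsmf_optimal m n r A I J XY \<longrightarrow>
          computes_within \<O> c m n r (input_of m n r A I J XY) (poly p (m + n + r))
            (fsmf_optimal m n r (restrict_mat A (S_Tbar m n r I J)) (I1 r I J R) (J1 r I J C))))
   \<and> (\<exists>(c :: com) (p :: nat poly). svd_free c \<and>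
        (\<forall>\<O> m n r I J R C A XY. reducible m n r I J R C \<longrightarrow> A \<in> carrier_mat m n \<longrightarrow>
          fsmf_optimal m n r (restrict_mat A (S_Tbar m n r I J)) (I1 r I J R) (J1 r I J C) XY \<longrightarrow>
          computes_within \<O> c m n r (input_of m n r A I J XY) (poly p (m + n + r))
            (fsmf_optimal m n r A I J)))
   \<and> (\<exists>(c :: com) (p :: nat poly).
        \<forall>\<O> m n r I J R C A. valid_svd_oracle \<O> \<longrightarrow> reducible m n r I J R C \<longrightarrow>
          A \<in> carrier_mat m n \<longrightarrow>
          computes_within \<O> c m n r (input_of m n r A I J (0\<^sub>m m r, 0\<^sub>m n r)) (poly p (m + n + r))
            (fsmf_optimal m n r A I J))"
proof (intro conjI)
  show "\<forall>m n r I J R C. reducible m n r I J R C \<longrightarrow>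
      disjoint_family_on (class_supp (I1 r I J R) (J1 r I J C)) (supp_classes r (I1 r I J R)
        (J1 r I J C))"
    by (intro allI impI reducible_instance.disjoint_reduced_classes) (rule reducible_instance.intro)
  show "\<forall>m n r I J R C A. reducible m n r I J R C \<longrightarrow> A \<in> carrier_mat m n \<longrightarrow>
      fsmf_inf m n r A I J = fsmf_inf m n r (restrict_mat A (S_Tbar m n r I J)) (I1 r I J R)
        (J1 r I J C)"
    by (intro allI impI reducible_instance.fsmf_inf_eq) (rule reducible_instance.intro)
  show "\<exists>c p. svd_free c \<and> (\<forall>\<O> m n r I J R C A XY. reducible m n r I J R C \<longrightarrow> A \<in> carrier_mat m n \<longrightarrow>
      fsmf_optimal m n r A I J XY \<longrightarrow>
      computes_within \<O> c m n r (input_of m n r A I J XY) (poly p (m + n + r))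
        (fsmf_optimal m n r (restrict_mat A (S_Tbar m n r I J)) (I1 r I J R) (J1 r I J C)))"
  \<comment> \<open>Program and polynomial are chosen before the instance, which is possible because
    \<open>cost\<close> looks only at the program text.\<close>
  proof (intro exI[of _ reduce_prog] exI[of _ "cost reduce_prog"] conjI allI impI svd_free_progs)
    fix \<O> m n r I J R C A XY
    assume "reducible m n r I J R C" and A: "A \<in> carrier_mat m n" and opt: "fsmf_optimal m n r A I J XY"
    then interpret reducible_instance m n r I J R C by unfold_locales
    obtain X Y where XY: "XY = (X, Y)" and c: "X \<in> carrier_mat m r" "Y \<in> carrier_mat n r"
      using opt by (rule fsmf_optimal_carrier)
    have "opt m n r I J (\<lambda>i j. A $$ (i, j)) (\<lambda>i k. X $$ (i, k)) (\<lambda>j k. Y $$ (j, k))"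
      using opt by (simp add: XY fsmf_optimal_iff[OF A])
    from opt_red[OF this] show "computes_within \<O> reduce_prog m n r (input_of m n r A I J XY)
        (poly (cost reduce_prog) (m + n + r))
        (fsmf_optimal m n r (restrict_mat A (S_Tbar m n r I J)) IR JC)"
      unfolding XY opt_restrict_mat[OF A, symmetric]
      by (rule computes_withinI[OF size_bounded_progs(1) restrict_mat_off_ST(1)[OF A]
        reduce_ok[OF input_ok[OF A c]]])
  qed
  show "\<exists>c p. svd_free c \<and> (\<forall>\<O> m n r I J R C A XY. reducible m n r I J R C \<longrightarrow> A \<in> carrier_mat m n \<longrightarrow>
      fsmf_optimal m n r (restrict_mat A (S_Tbar m n r I J)) (I1 r I J R) (J1 r I J C) XY \<longrightarrow>
      computes_within \<O> c m n r (input_of m n r A I J XY) (poly p (m + n + r)) (fsmf_optimal m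
        n r A I J))"
  proof (intro exI[of _ fill_prog] exI[of _ "cost fill_prog"] conjI allI impI svd_free_progs)
    fix \<O> m n r I J R C A XY
    assume "reducible m n r I J R C" and A: "A \<in> carrier_mat m n"
      and opt: "fsmf_optimal m n r (restrict_mat A (S_Tbar m n r I J)) (I1 r I J R) (J1 r I J C) XY"
    then interpret reducible_instance m n r I J R C by unfold_locales
    obtain X Y where XY: "XY = (X, Y)" and c: "X \<in> carrier_mat m r" "Y \<in> carrier_mat n r"
      using opt by (rule fsmf_optimal_carrier)
    have "opt m n r IR JC (off_ST (\<lambda>i j. A $$ (i, j))) (\<lambda>i k. X $$ (i, k)) (\<lambda>j k. Y $$ (j, k))"
      using opt by (simp add: XY fsmf_optimal_iff[OF restrict_mat_off_ST(1)[OF A]]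
        opt_restrict_mat[OF A])
    from opt_full[OF this] show "computes_within \<O> fill_prog m n r (input_of m n r A I J XY)
        (poly (cost fill_prog) (m + n + r)) (fsmf_optimal m n r A I J)"
      unfolding XY by (rule computes_withinI[OF size_bounded_progs(2) A fill_ok[OF input_ok[OF A c]]])
  qed
  show "\<exists>c p. \<forall>\<O> m n r I J R C A. valid_svd_oracle \<O> \<longrightarrow> reducible m n r I J R C \<longrightarrow> A \<in> carrier_mat m n \<longrightarrow>
      computes_within \<O> c m n r (input_of m n r A I J (0\<^sub>m m r, 0\<^sub>m n r)) (poly p (m + n + r))
        (fsmf_optimal m n r A I J)"
  proof (intro exI[of _ solve_prog] exI[of _ "cost solve_prog"] allI impI)
    fix \<O> m n r I J R C and A :: "real mat"
    assume valid: "valid_svd_oracle \<O>" and "reducible m n r I J R C" and A: "A \<in> carrier_mat m n"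
    then interpret reducible_instance m n r I J R C by unfold_locales
    \<comment> \<open>The optimal reduced solution comes from the decompositions themselves, so the
      zero matrices supplied as input are mere placeholders.\<close>
    from opt_full[OF opt_svd[OF valid, of "\<lambda>i j. A $$ (i, j)"]]
    show "computes_within \<O> solve_prog m n r (input_of m n r A I J (0\<^sub>m m r, 0\<^sub>m n r))
        (poly (cost solve_prog) (m + n + r)) (fsmf_optimal m n r A I J)"
      by (rule computes_withinI[OF size_bounded_progs(3) A
          solve_ok[OF valid input_ok[OF A zero_carrier_mat zero_carrier_mat]]])
  qed
qed

end
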